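(* The following is a complete list of the three-dimensional solvable real Lie subalgebras of $\mathfrak{sl}_3(\mathbb{R})$ up to conjugation in $\mathrm{SL}_3(\mathbb{R})$: (1) $\mathfrak{u}_{3,1}=\langle X_\alpha,\,X_{\alpha+\beta},\,2H_\alpha+H_\beta\rangle$; (2) $\mathfrak{u}_{3,2}=\langle X_\alpha,\,Y_\beta,\,H_\alpha-H_\beta\rangle$; (3) $\mathfrak{u}_{3,3}=\langle X_\alpha,\,X_{\alpha+\beta},\,2H_\alpha+H_\beta+X_\beta\rangle$; (4) $\mathfrak{u}_{3,4}=\langle Y_\alpha,\,Y_{\alpha+\beta},\,2H_\alpha+H_\beta+X_\beta\rangle$; (5) $\mathfrak{u}_{3,5}=\langle X_\alpha+X_\beta,\,X_{\alpha+\beta},\,H_\alpha+H_\beta\rangle$; (6) $\mathfrak{u}_{3,6}=\langle X_\alpha,\,H_\alpha,\,H_\beta\rangle$; (7) $\mathfrak{u}_{3,7}^a=\langle X_\alpha,\,X_{\alpha+\beta},\,(a-1)H_\alpha+aH_\beta\rangle$, $a\in\mathbb{R}$, $a\neq\pm1$, where $\mathfrak{u}_{3,7}^a\sim\mathfrak{u}_{3,7}^b$ iff $a=b$ or $ab=1$ (equivalently, for $a,b\in(-1,1)$ one has $\mathfrak{u}_{3,7}^a\sim\mathfrak{u}_{3,7}^b$ iff $a=b$, and for every $c\in\mathbb{R}\setminus\{\pm1\}$ one has $\mathfrak{u}_{3,7}^c\sim\mathfrak{u}_{3,7}^a$ for some $a\in(-1,1)$); (8) $\mathfrak{u}_{3,8}^t=\langle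 X_\alpha,\,X_{\alpha+\beta},\,H_\alpha+\frac12H_\beta-tX_\beta+tY_\beta\rangle$, $t\in\mathbb{R}\setminus\{0\}$, where $\mathfrak{u}_{3,8}^t\sim\mathfrak{u}_{3,8}^s$ iff $t=\pm s$; (9) $\mathfrak{u}_{3,9}^a=\langle X_\alpha,\,Y_\beta,\,H_\alpha+aH_\beta\rangle$, $a\in\mathbb{R}$, $a\neq\pm1$, where $\mathfrak{u}_{3,9}^a\sim\mathfrak{u}_{3,9}^b$ iff $a=b$ or $ab=1$ (equivalently, for $a,b\in(-1,1)$ one has $\mathfrak{u}_{3,9}^a\sim\mathfrak{u}_{3,9}^b$ iff $a=b$, and for every $c\in\mathbb{R}\setminus\{\pm1\}$ one has $\mathfrak{u}_{3,9}^c\sim\mathfrak{u}_{3,9}^a$ for some $a\in(-1,1)$); (10) $\mathfrak{u}_{3,10}^t=\langle X_\alpha,\,Y_\beta,\,-\frac12H_\alpha+\frac12H_\beta-tX_{\alpha+\beta}+\frac t4Y_{\alpha+\beta}\rangle$, $t\in\mathbb{R}\setminus\{0\}$, where $\mathfrak{u}_{3,10}^t\sim\mathfrak{u}_{3,10}^s$ iff $t=\pm s$; (11) $\mathfrak{u}_{3,11}=\langle X_\alpha,\,X_{\alpha+\beta},\,H_\beta\rangle$; (12) $\mathfrak{u}_{3,12}=\langle X_\alpha,\,X_{\alpha+\beta},\,X_\beta-Y_\beta\rangle$; (13) $\mathfrak{u}_{3,13}=\langle X_\alpha,\,Y_\beta,\,H_\alpha+H_\beta\rangle$; (14) $\mathfrak{u}_{3,14}=\langle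 X_\alpha,\,Y_\beta,\,-X_{\alpha+\beta}+Y_{\alpha+\beta}\rangle$; (15) $\mathfrak{u}_{3,15}=\langle X_\alpha,\,X_\beta,\,X_{\alpha+\beta}\rangle$. That is, every three-dimensional solvable real subalgebra of $\mathfrak{sl}_3(\mathbb{R})$ is conjugate under $\mathrm{SL}_3(\mathbb{R})$ to a subalgebra in this list, and subalgebras in the list are pairwise non-conjugate under $\mathrm{SL}_3(\mathbb{R})$ except for the conjugacies within the families (7), (8), (9), (10) indicated above.
   Context: $\mathfrak{sl}_3(\mathbb{R})$ is the Lie algebra of traceless real $3\times3$ matrices and $\mathrm{SL}_3(\mathbb{R})$ acts on its subalgebras by $g\cdot\mathfrak{u}=g\mathfrak{u}g^{-1}$; $\mathfrak{u}\sim\mathfrak{v}$ means that $\mathfrak{u}$ and $\mathfrak{v}$ lie in the same orbit of this action. With $E_{ij}$ the matrix units, the basis of $\mathfrak{sl}_3(\mathbb{R})$ used is $H_\alpha=E_{11}-E_{22}$, $H_\beta=E_{22}-E_{33}$, $X_\alpha=E_{12}$, $X_\beta=E_{23}$, $X_{\alpha+\beta}=-E_{13}$, $Y_\alpha=E_{21}$, $Y_\beta=E_{32}$, $Y_{\alpha+\beta}=-E_{31}$. $\langle\cdots\rangle$ denotes the real linear span. *)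

theory Defs
  imports "HOL-Analysis.Analysis"
begin

definition lie_bracket :: "real^3^3 \<Rightarrow> real^3^3 \<Rightarrow> real^3^3" where
  "lie_bracket A B = A ** B - B ** A"

definition sl3 :: "(real^3^3) set" where
  "sl3 = {A. trace A = 0}"

definition SL3 :: "(real^3^3) set" where
  "SL3 = {g. det g = 1}"

definition lie_subalgebra_sl3 :: "(real^3^3) set \<Rightarrow> bool" where
  "lie_subalgebra_sl3 \<uu> \<longleftrightarrow>
     \<uu> \<subseteq> sl3 \<and> subspace \<uu> \<and> (\<forall>A\<in>\<uu>. \<forall>B\<in>\<uu>. lie_bracket A B \<in> \<uu>)"

definition derived_algebra :: "(real^3^3) set \<Rightarrow> (real^3^3) set" where
  "derived_algebra \<uu> = span {lie_bracket A B | A B. A \<in> \<uu> \<and> B \<in> \<uu>}"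

definition solvable_lie :: "(real^3^3) set \<Rightarrow> bool" where
  "solvable_lie \<uu> \<longleftrightarrow> (\<exists>n. (derived_algebra ^^ n) \<uu> = {0})"

definition conj_action :: "real^3^3 \<Rightarrow> (real^3^3) set \<Rightarrow> (real^3^3) set" where
  "conj_action g \<uu> = (\<lambda>A. g ** A ** matrix_inv g) ` \<uu>"

definition SL3_conjugate :: "(real^3^3) set \<Rightarrow> (real^3^3) set \<Rightarrow> bool"  (infix "\<sim>\<^sub>S" 50) where
  "\<uu> \<sim>\<^sub>S \<vv> \<longleftrightarrow> (\<exists>g\<in>SL3. \<vv> = conj_action g \<uu>)"

definition mat_unit :: "3 \<Rightarrow> 3 \<Rightarrow> real^3^3" where
  "mat_unit i j = (\<chi> r c. if r = i \<and> c = j then 1 else 0)"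

definition H\<alpha> :: "real^3^3" where "H\<alpha> = mat_unit 1 1 - mat_unit 2 2"
definition H\<beta> :: "real^3^3" where "H\<beta> = mat_unit 2 2 - mat_unit 3 3"
definition X\<alpha> :: "real^3^3" where "X\<alpha> = mat_unit 1 2"
definition X\<beta> :: "real^3^3" where "X\<beta> = mat_unit 2 3"
definition X\<alpha>\<beta> :: "real^3^3" where "X\<alpha>\<beta> = - mat_unit 1 3"
definition Y\<alpha> :: "real^3^3" where "Y\<alpha> = mat_unit 2 1"
definition Y\<beta> :: "real^3^3" where "Y\<beta> = mat_unit 3 2"
definition Y\<alpha>\<beta> :: "real^3^3" where "Y\<alpha>\<beta> = - mat_unit 3 1"

text \<open>
  The entries of the classification are represented by labels, and \<open>\<uu>\<^sub>3\<close> sends a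
  label to the subalgebra it denotes. Working with labels keeps apart entries that could a
  priori denote the same set of matrices, so that non-conjugacy of distinct entries
  also includes that they are different. Parameters are unrestricted reals; their
  ranges are given by \<open>admissible\<close>.
\<close>

datatype label =
    U1 | U2 | U3 | U4 | U5 | U6
  | U7 real | U8 real | U9 real | U10 real
  | U11 | U12 | U13 | U14 | U15

primrec \<uu>\<^sub>3 :: "label \<Rightarrow> (real^3^3) set" where
  "\<uu>\<^sub>3 U1 = span {X\<alpha>, X\<alpha>\<beta>, 2 *\<^sub>R H\<alpha> + H\<beta>}"
| "\<uu>\<^sub>3 U2 = span {X\<alpha>, Y\<beta>, H\<alpha> - H\<beta>}"
| "\<uu>\<^sub>3 U3 = span {X\<alpha>, X\<alpha>\<beta>, 2 *\<^sub>R H\<alpha> + H\<beta> + X\<beta>}"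
| "\<uu>\<^sub>3 U4 = span {Y\<alpha>, Y\<alpha>\<beta>, 2 *\<^sub>R H\<alpha> + H\<beta> + X\<beta>}"
| "\<uu>\<^sub>3 U5 = span {X\<alpha> + X\<beta>, X\<alpha>\<beta>, H\<alpha> + H\<beta>}"
| "\<uu>\<^sub>3 U6 = span {X\<alpha>, H\<alpha>, H\<beta>}"
| "\<uu>\<^sub>3 (U7 a) = span {X\<alpha>, X\<alpha>\<beta>, (a - 1) *\<^sub>R H\<alpha> + a *\<^sub>R H\<beta>}"
| "\<uu>\<^sub>3 (U8 t) = span {X\<alpha>, X\<alpha>\<beta>, H\<alpha> + (1/2) *\<^sub>R H\<beta> - t *\<^sub>R X\<beta> + t *\<^sub>R Y\<beta>}"
| "\<uu>\<^sub>3 (U9 a) = span {X\<alpha>, Y\<beta>, H\<alpha> + a *\<^sub>R H\<beta>}"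
| "\<uu>\<^sub>3 (U10 t) = span {X\<alpha>, Y\<beta>,
      (-1/2) *\<^sub>R H\<alpha> + (1/2) *\<^sub>R H\<beta> - t *\<^sub>R X\<alpha>\<beta> + (t/4) *\<^sub>R Y\<alpha>\<beta>}"
| "\<uu>\<^sub>3 U11 = span {X\<alpha>, X\<alpha>\<beta>, H\<beta>}"
| "\<uu>\<^sub>3 U12 = span {X\<alpha>, X\<alpha>\<beta>, X\<beta> - Y\<beta>}"
| "\<uu>\<^sub>3 U13 = span {X\<alpha>, Y\<beta>, H\<alpha> + H\<beta>}"
| "\<uu>\<^sub>3 U14 = span {X\<alpha>, Y\<beta>, - X\<alpha>\<beta> + Y\<alpha>\<beta>}"
| "\<uu>\<^sub>3 U15 = span {X\<alpha>, X\<beta>, X\<alpha>\<beta>}"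

definition admissible :: "label \<Rightarrow> bool" where
  "admissible l \<longleftrightarrow>
     (case l of U7 a \<Rightarrow> a \<noteq> 1 \<and> a \<noteq> -1
              | U8 t \<Rightarrow> t \<noteq> 0
              | U9 a \<Rightarrow> a \<noteq> 1 \<and> a \<noteq> -1
              | U10 t \<Rightarrow> t \<noteq> 0
              | _ \<Rightarrow> True)"

end

theory Submission
  imports Defs
begin

text \<open>
  Every listed algebra except \<open>U5\<close>, \<open>U6\<close>, \<open>U15\<close> is, up to conjugation and transposition, a row algebra:
  all matrices with first row \<open>(- z tr B, x, y)\<close>, zero first column below it and block \<open>z B\<close>, for a fixed
  two by two matrix \<open>B\<close>. Non-nilpotent blocks give conjugate algebras iff they are similar up to a nonzero
  scalar, because the nilpotent elements are exactly the first rows and so the line of \<open>e\<^sub>1\<close> is preserved. The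
  remaining cases are separated by which nilpotents occur and whether their images lie in a common line.

  For completeness, a solvable algebra \<open>u\<close> has a two-dimensional ideal \<open>n\<close> containing \<open>[u, u]\<close>. Jacobson's
  lemma (a commutator \<open>[z, q]\<close> that commutes with \<open>q\<close> is nilpotent) almost always produces a nilpotent \<open>w\<close>
  spanning an ideal of \<open>u\<close>. In the normal form \<open>E\<^sub>1\<^sub>2 + E\<^sub>2\<^sub>3\<close> or \<open>E\<^sub>1\<^sub>3\<close> for \<open>w\<close> the normalizer of the line of
  \<open>w\<close> is upper triangular, and \<open>u\<close> can be read off. Otherwise \<open>n\<close> consists of commuting square-zero
  matrices with zero products, that is, of first rows or of last columns.
\<close>

subsection \<open>Explicit three by three matrices\<close>

text \<open>Lie's theorem is not at hand over the reals: the blocks of \<open>U8\<close> and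
  \<open>U12\<close> have nonreal eigenvalues, so a solvable algebra need not be triangularizable.
  An invariant nilpotent line is the substitute. If the plane n is not abelian, its own bracket
  spans one. If n is abelian, only the map ad z on n matters, with z outside n. Rank one gives the
  line as its image. Rank zero means that u is abelian and has no nonzero commutators, so a
  nilpotent must be found by linear algebra, through a common eigenvector. Rank two makes all of n
  nilpotent, but ad z may have no real invariant line in n; the square-zero case takes care of
  this.\<close>

definition mat3 :: "real \<Rightarrow> real \<Rightarrow> real \<Rightarrow> real \<Rightarrow> real \<Rightarrow> real \<Rightarrow> real \<Rightarrow> real \<Rightarrow> real \<Rightarrow> real^3^3" where
  "mat3 a b c d e f g h i = vector [vector [a, b, c], vector [d, e, f], vector [g, h, i]]"

lemma mat3_nth [simp]:
  "mat3 a b c d e f g h i $ 1 $ 1 = a" "mat3 a b c d e f g h i $ 1 $ 2 = b" "mat3 a b c d e f g h i $ 1 $ 3 = c"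
  "mat3 a b c d e f g h i $ 2 $ 1 = d" "mat3 a b c d e f g h i $ 2 $ 2 = e" "mat3 a b c d e f g h i $ 2 $ 3 = f"
  "mat3 a b c d e f g h i $ 3 $ 1 = g" "mat3 a b c d e f g h i $ 3 $ 2 = h" "mat3 a b c d e f g h i $ 3 $ 3 = i"
  by (simp_all add: mat3_def)

lemma mat_eq_iff_3:
  "A = (B :: real^3^3) \<longleftrightarrow>
     A $ 1 $ 1 = B $ 1 $ 1 \<and> A $ 1 $ 2 = B $ 1 $ 2 \<and> A $ 1 $ 3 = B $ 1 $ 3 \<and>
     A $ 2 $ 1 = B $ 2 $ 1 \<and> A $ 2 $ 2 = B $ 2 $ 2 \<and> A $ 2 $ 3 = B $ 2 $ 3 \<and>
     A $ 3 $ 1 = B $ 3 $ 1 \<and> A $ 3 $ 2 = B $ 3 $ 2 \<and> A $ 3 $ 3 = B $ 3 $ 3"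
  by (auto simp: vec_eq_iff forall_3)

lemma mat3_eta:
  "mat3 (A $ 1 $ 1) (A $ 1 $ 2) (A $ 1 $ 3) (A $ 2 $ 1) (A $ 2 $ 2) (A $ 2 $ 3)
        (A $ 3 $ 1) (A $ 3 $ 2) (A $ 3 $ 3) = A"
  by (simp add: mat_eq_iff_3)

lemma mat3_cases:
  obtains a b c d e f g h i where "A = mat3 a b c d e f g h i"
  using mat3_eta[of A] by metis

lemma mat3_eq_iff [simp]:
  "mat3 a b c d e f g h i = mat3 a' b' c' d' e' f' g' h' i' \<longleftrightarrow>
     a = a' \<and> b = b' \<and> c = c' \<and> d = d' \<and> e = e' \<and> f = f' \<and> g = g' \<and> h = h' \<and> i = i'"
  by (simp add: mat_eq_iff_3)

lemma mat3_mult [simp]: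
  "mat3 a b c d e f g h i ** mat3 a' b' c' d' e' f' g' h' i' =
     mat3 (a*a' + b*d' + c*g') (a*b' + b*e' + c*h') (a*c' + b*f' + c*i')
          (d*a' + e*d' + f*g') (d*b' + e*e' + f*h') (d*c' + e*f' + f*i')
          (g*a' + h*d' + i*g') (g*b' + h*e' + i*h') (g*c' + h*f' + i*i')"
  by (simp add: mat_eq_iff_3 matrix_matrix_mult_def sum_3)

lemma mat3_add [simp]:
  "mat3 a b c d e f g h i + mat3 a' b' c' d' e' f' g' h' i' =
     mat3 (a+a') (b+b') (c+c') (d+d') (e+e') (f+f') (g+g') (h+h') (i+i')"
  by (simp add: mat_eq_iff_3)

lemma mat3_diff [simp]:
  "mat3 a b c d e f g h i - mat3 a' b' c' d' e' f' g' h' i' =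
     mat3 (a-a') (b-b') (c-c') (d-d') (e-e') (f-f') (g-g') (h-h') (i-i')"
  by (simp add: mat_eq_iff_3)

lemma mat3_uminus [simp]:
  "- mat3 a b c d e f g h i = mat3 (-a) (-b) (-c) (-d) (-e) (-f) (-g) (-h) (-i)"
  by (simp add: mat_eq_iff_3)

lemma mat3_scaleR [simp]:
  "r *\<^sub>R mat3 a b c d e f g h i = mat3 (r*a) (r*b) (r*c) (r*d) (r*e) (r*f) (r*g) (r*h) (r*i)"
  by (simp add: mat_eq_iff_3)

lemma mat3_transpose [simp]:
  "transpose (mat3 a b c d e f g h i) = mat3 a d g b e h c f i"
  by (simp add: mat_eq_iff_3 transpose_def)

lemma mat3_zero: "0 = mat3 0 0 0 0 0 0 0 0 0"
  by (simp add: mat_eq_iff_3)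

lemma mat3_one: "mat 1 = mat3 1 0 0 0 1 0 0 0 1"
  by (simp add: mat_eq_iff_3 mat_def)

lemma mat3_eq_zero [simp]:
  "mat3 a b c d e f g h i = 0 \<longleftrightarrow>
     a = 0 \<and> b = 0 \<and> c = 0 \<and> d = 0 \<and> e = 0 \<and> f = 0 \<and> g = 0 \<and> h = 0 \<and> i = 0"
  unfolding mat3_zero by simp

lemma mat3_eq_one [simp]:
  "mat3 a b c d e f g h i = mat 1 \<longleftrightarrow>
     a = 1 \<and> b = 0 \<and> c = 0 \<and> d = 0 \<and> e = 1 \<and> f = 0 \<and> g = 0 \<and> h = 0 \<and> i = 1"
  unfolding mat3_one by simp

lemma trace_3: "trace (A :: real^3^3) = A $ 1 $ 1 + A $ 2 $ 2 + A $ 3 $ 3"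
  by (simp add: trace_def sum_3)

lemma mat3_trace [simp]: "trace (mat3 a b c d e f g h i) = a + e + i"
  by (simp add: trace_3)

lemma mat3_det:
  "det (mat3 a b c d e f g h i) = a*e*i + b*f*g + c*d*h - a*f*h - b*d*i - c*e*g"
  by (simp add: det_3)

lemma mat3_mem_sl3 [simp]: "mat3 a b c d e f g h i \<in> sl3 \<longleftrightarrow> a + e + i = 0"
  by (simp add: sl3_def)

lemma mat_unit_mat3:
  "H\<alpha> = mat3 1 0 0 0 (-1) 0 0 0 0" "H\<beta> = mat3 0 0 0 0 1 0 0 0 (-1)"
  "X\<alpha> = mat3 0 1 0 0 0 0 0 0 0" "X\<beta> = mat3 0 0 0 0 0 1 0 0 0" "X\<alpha>\<beta> = mat3 0 0 (-1) 0 0 0 0 0 0"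
  "Y\<alpha> = mat3 0 0 0 1 0 0 0 0 0" "Y\<beta> = mat3 0 0 0 0 0 0 0 1 0" "Y\<alpha>\<beta> = mat3 0 0 0 0 0 0 (-1) 0 0"
  by (simp_all add: mat_eq_iff_3 H\<alpha>_def H\<beta>_def X\<alpha>_def X\<beta>_def X\<alpha>\<beta>_def Y\<alpha>_def Y\<beta>_def Y\<alpha>\<beta>_def mat_unit_def)

subsection \<open>Conjugation\<close>

text \<open>The inverse is carried along as a second matrix \<open>Q\<close>, so that symmetry and
  transitivity need no facts on \<open>matrix_inv\<close>; the determinant of \<open>P\<close> is
  left free.\<close>

definition gl_conj :: "(real^3^3) set \<Rightarrow> (real^3^3) set \<Rightarrow> bool" (infix "\<sim>\<^sub>G" 50) where
  "u \<sim>\<^sub>G v \<longleftrightarrow> (\<exists>P Q. P ** Q = mat 1 \<and> Q ** P = mat 1 \<and> v = (\<lambda>A. P ** A ** Q) ` u)"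

lemma gl_conjI:
  assumes "P ** Q = mat 1" "Q ** P = mat 1" "\<And>A. A \<in> u \<Longrightarrow> P ** A ** Q \<in> v"
    "\<And>A. A \<in> v \<Longrightarrow> Q ** A ** P \<in> u"
  shows "u \<sim>\<^sub>G v"
proof -
  have "A = P ** (Q ** A ** P) ** Q" for A
    using assms(1,2) by (metis matrix_mul_assoc matrix_mul_lid matrix_mul_rid)
  then have "v = (\<lambda>A. P ** A ** Q) ` u"
    using assms(3,4) by blast
  then show ?thesis
    using assms(1,2) unfolding gl_conj_def by blast
qed

lemma gl_conj_refl [simp]: "u \<sim>\<^sub>G u"
  by (rule gl_conjI[of "mat 1" "mat 1"]) auto

lemma conj_cancel:
  fixes P Q :: "real^3^3"
  assumes "P ** Q = mat 1"
  shows "P ** (Q ** A ** P) ** Q = A"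
  using assms by (metis matrix_mul_assoc matrix_mul_lid matrix_mul_rid)

lemma gl_conj_sym:
  assumes "u \<sim>\<^sub>G v" shows "v \<sim>\<^sub>G u"
proof -
  obtain P Q where PQ: "P ** Q = mat 1" "Q ** P = mat 1" "v = (\<lambda>A. P ** A ** Q) ` u"
    using assms unfolding gl_conj_def by blast
  have "u = (\<lambda>A. Q ** A ** P) ` v"
    using PQ by (simp add: image_image conj_cancel)
  then show ?thesis
    using PQ(1,2) unfolding gl_conj_def by blast
qed

lemma gl_conj_trans [trans]:
  assumes "u \<sim>\<^sub>G v" "v \<sim>\<^sub>G w" shows "u \<sim>\<^sub>G w"
proof -
  obtain P Q where PQ: "P ** Q = mat 1" "Q ** P = mat 1" "v = (\<lambda>A. P ** A ** Q) ` u"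
    using assms unfolding gl_conj_def by blast
  obtain P' Q' where PQ': "P' ** Q' = mat 1" "Q' ** P' = mat 1" "w = (\<lambda>A. P' ** A ** Q') ` v"
    using assms unfolding gl_conj_def by blast
  have "w = (\<lambda>A. (P' ** P) ** A ** (Q ** Q')) ` u"
    unfolding PQ'(3) PQ(3) by (simp add: image_image matrix_mul_assoc)
  moreover have "(P' ** P) ** (Q ** Q') = mat 1" "(Q ** Q') ** (P' ** P) = mat 1"
    using PQ(1,2) PQ'(1,2) by (metis matrix_mul_assoc matrix_mul_lid)+
  ultimately show ?thesis
    unfolding gl_conj_def by blast
qed

lemma inverse_pair:
  fixes P Q :: "real^3^3"
  assumes "P ** Q = mat 1"
  shows "Q ** P = mat 1" "matrix_inv P = Q" "det P * det Q = 1"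
proof -
  show *: "Q ** P = mat 1"
    using assms matrix_left_right_inverse by blast
  show "matrix_inv P = Q"
  proof -
    have "P ** matrix_inv P = mat 1 \<and> matrix_inv P ** P = mat 1"
      unfolding matrix_inv_def by (rule someI[of _ Q]) (use assms * in blast)
    then show ?thesis
      using * by (metis matrix_mul_assoc matrix_mul_lid matrix_mul_rid)
  qed
  show "det P * det Q = 1"
    using assms by (metis det_I det_mul)
qed

lemma exists_inverse_pair:
  fixes P :: "real^3^3"
  assumes "det P \<noteq> 0"
  obtains Q where "P ** Q = mat 1" "Q ** P = mat 1"
  using assms invertible_det_nz unfolding invertible_def by blast

text \<open>Conjugation ignores scalar factors of \<open>P\<close>, and in dimension three a real
  cube root scales every nonzero determinant to 1. Hence determinants need not be tracked
  afterwards.\<close>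

lemma SL3_conjugate_iff: "u \<sim>\<^sub>S v \<longleftrightarrow> u \<sim>\<^sub>G v"
proof
  assume "u \<sim>\<^sub>S v"
  then obtain g where g: "det g = 1" "v = conj_action g u"
    unfolding SL3_conjugate_def SL3_def by blast
  obtain Q where "g ** Q = mat 1" "Q ** g = mat 1"
    using exists_inverse_pair[of g] g(1) by auto
  then show "u \<sim>\<^sub>G v"
    using g(2) inverse_pair(2)[of g Q] unfolding gl_conj_def conj_action_def by metis
next
  assume "u \<sim>\<^sub>G v"
  then obtain P Q where PQ: "P ** Q = mat 1" "Q ** P = mat 1" "v = (\<lambda>A. P ** A ** Q) ` u"
    unfolding gl_conj_def by blast
  define c where "c = root 3 (det P)"
  have det: "det P \<noteq> 0" 
    using inverse_pair(3)[OF PQ(1)] by auto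
  then have c: "c \<noteq> 0" "c ^ 3 = det P"
    by (auto simp: c_def odd_real_root_pow)
  define g where "g = (1 / c) *\<^sub>R P"
  have "g ** (c *\<^sub>R Q) = mat 1"
    using c PQ(1) by (simp add: g_def scalar_matrix_assoc[symmetric] matrix_scalar_ac)
  then have inv: "matrix_inv g = c *\<^sub>R Q"
    by (rule inverse_pair(2))
  have "det g = (1 / c) ^ 3 * det P"
    by (simp add: g_def det_3 power3_eq_cube algebra_simps)
  then have "det g = 1"
    using c det by (simp add: power_divide)
  moreover have "v = conj_action g u"
    unfolding conj_action_def inv PQ(3)
    using c(1) by (simp add: g_def scalar_matrix_assoc[symmetric] matrix_scalar_ac)
  ultimately show "u \<sim>\<^sub>S v"
    unfolding SL3_conjugate_def SL3_def by blast
qed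

lemma matrix_add_rdistrib_3: "(A + B) ** C = A ** C + B ** (C :: real^3^3)"
  and matrix_sub_ldistrib_3: "A ** (B - C) = A ** B - A ** (C :: real^3^3)"
  and matrix_sub_rdistrib_3: "(A - B) ** C = A ** C - B ** (C :: real^3^3)"
  by (simp_all add: mat_eq_iff_3 matrix_matrix_mult_def sum_3 algebra_simps)

lemma lie_bracket_conj:
  fixes P Q :: "real^3^3"
  assumes "Q ** P = mat 1"
  shows "lie_bracket (P ** A ** Q) (P ** B ** Q) = P ** lie_bracket A B ** Q"
proof -
  have "P ** A ** Q ** (P ** B ** Q) = P ** (A ** B) ** Q" for A B
    using assms by (metis matrix_mul_assoc matrix_mul_rid)
  then show ?thesis
    by (simp add: lie_bracket_def matrix_sub_ldistrib_3 matrix_sub_rdistrib_3)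
qed

lemma lie_bracket_transpose: "lie_bracket (transpose A) (transpose B) = - transpose (lie_bracket A B)"
  by (simp add: lie_bracket_def matrix_transpose_mul mat_eq_iff_3 transpose_def matrix_matrix_mult_def sum_3)

lemma linear_conj: "linear (\<lambda>A. (P :: real^3^3) ** A ** (Q :: real^3^3))"
  by (rule linearI) (simp_all add: matrix_add_ldistrib matrix_add_rdistrib_3 scalar_matrix_assoc[symmetric] matrix_scalar_ac)

lemma linear_transpose: "linear (transpose :: real^3^3 \<Rightarrow> real^3^3)"
  by (rule linearI) (simp_all add: mat_eq_iff_3 transpose_def)

lemma trace_conj:
  fixes P Q :: "real^3^3"
  assumes "Q ** P = mat 1"
  shows "trace (P ** A ** Q) = trace A"
  by (metis assms matrix_mul_assoc matrix_mul_lid trace_mul_sym)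

definition lie3 :: "(real^3^3) set \<Rightarrow> bool" where
  "lie3 u \<longleftrightarrow> lie_subalgebra_sl3 u \<and> dim u = 3"

lemma lie3D:
  assumes "lie3 u"
  shows "subspace u" "dim u = 3" "A \<in> u \<Longrightarrow> trace A = 0"
    "A \<in> u \<Longrightarrow> B \<in> u \<Longrightarrow> lie_bracket A B \<in> u"
  using assms by (auto simp: lie3_def lie_subalgebra_sl3_def sl3_def)

lemma lie3_conj:
  assumes "u \<sim>\<^sub>G v" "lie3 u"
  shows "lie3 v"
proof -
  obtain P Q where PQ: "P ** Q = mat 1" "Q ** P = mat 1" "v = (\<lambda>A. P ** A ** Q) ` u"
    using assms(1) unfolding gl_conj_def by blast
  have "inj (\<lambda>A. P ** A ** Q)"
    by (rule inj_on_inverseI[of _ "\<lambda>A. Q ** A ** P"]) (simp add: conj_cancel PQ)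
  then have "dim v = dim u"
    unfolding PQ(3) by (intro dim_image_eq linear_conj) (auto intro: inj_on_subset)
  moreover have "subspace v"
    unfolding PQ(3) using lie3D(1)[OF assms(2)] by (intro linear_subspace_image linear_conj)
  ultimately show ?thesis
    using assms(2) PQ by (auto simp: lie3_def lie_subalgebra_sl3_def sl3_def trace_conj lie_bracket_conj)
qed

lemma transpose_mem_image [simp]: "A \<in> transpose ` u \<longleftrightarrow> transpose A \<in> u"
  for u :: "(real^3^3) set"
proof
  assume "transpose A \<in> u"
  then have "transpose (transpose A) \<in> transpose ` u" by (rule imageI)
  then show "A \<in> transpose ` u" by simp
qed auto

lemma transpose_image_image [simp]: "transpose ` transpose ` u = u"
  for u :: "(real^3^3) set"
  by (simp add: image_image)

lemma lie3_transpose: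
  assumes "lie3 u" shows "lie3 (transpose ` u)"
proof -
  have "inj (transpose :: real^3^3 \<Rightarrow> _)"
    by (rule inj_on_inverseI[of _ transpose]) simp
  then have "dim (transpose ` u) = dim u"
    by (intro dim_image_eq linear_transpose) (auto intro: inj_on_subset)
  moreover have "subspace (transpose ` u)"
    using lie3D(1)[OF assms(1)] by (intro linear_subspace_image linear_transpose)
  moreover have "transpose A \<in> u \<Longrightarrow> trace A = 0" for A
    using lie3D(3)[OF assms, of "transpose A"] by (simp add: trace_3 transpose_def)
  moreover have "transpose A \<in> u \<Longrightarrow> transpose B \<in> u \<Longrightarrow> transpose (lie_bracket A B) \<in> u" for A B
    using lie3D(4)[OF assms, of "transpose A" "transpose B"] subspace_neg[OF lie3D(1)[OF assms]]
    unfolding lie_bracket_transpose by force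
  ultimately show ?thesis
    using lie3D(2)[OF assms] unfolding lie3_def lie_subalgebra_sl3_def sl3_def
    by (simp add: subset_eq)
qed

lemma gl_conj_transpose:
  assumes "u \<sim>\<^sub>G v" shows "transpose ` u \<sim>\<^sub>G transpose ` v"
proof -
  obtain P Q where PQ: "P ** Q = mat 1" "Q ** P = mat 1" "v = (\<lambda>A. P ** A ** Q) ` u"
    using assms(1) unfolding gl_conj_def by blast
  have "transpose ` v = (\<lambda>A. transpose Q ** A ** transpose P) ` transpose ` u"
    unfolding PQ(3) by (simp add: image_image matrix_transpose_mul matrix_mul_assoc)
  moreover have "transpose Q ** transpose P = mat 1" "transpose P ** transpose Q = mat 1"
    using PQ(1,2) by (metis matrix_transpose_mul transpose_mat)+
  ultimately show ?thesis
    unfolding gl_conj_def by blast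
qed

definition listed :: "(real^3^3) set \<Rightarrow> bool" where
  "listed u \<longleftrightarrow> (\<exists>k. admissible k \<and> u \<sim>\<^sub>G \<uu>\<^sub>3 k)"

lemma listed_conj: "u \<sim>\<^sub>G v \<Longrightarrow> listed v \<Longrightarrow> listed u"
  unfolding listed_def using gl_conj_trans by blast

lemma span_3: "span {a, b, c} = {x *\<^sub>R a + y *\<^sub>R b + z *\<^sub>R c | x y z. True}" for a b c :: "'a::real_vector"
proof -
  have "v \<in> span {a, b, c} \<longleftrightarrow> (\<exists>x y z. v = x *\<^sub>R a + y *\<^sub>R b + z *\<^sub>R c)" for v
  proof -
    have "v \<in> span {a, b, c} \<longleftrightarrow> (\<exists>x y z. v - x *\<^sub>R a - y *\<^sub>R b - z *\<^sub>R c = 0)"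
      by (simp add: span_breakdown_eq)
    then show ?thesis
      by (simp add: algebra_simps)
  qed
  then show ?thesis
    by blast
qed

section \<open>Row algebras and their normal forms\<close>

definition row_algebra :: "real \<Rightarrow> real \<Rightarrow> real \<Rightarrow> real \<Rightarrow> (real^3^3) set" where
  "row_algebra p q r s = {mat3 (- z * (p + s)) x y 0 (z * p) (z * q) 0 (z * r) (z * s) | x y z. True}"

lemma row_algebraI:
  "a = - z * (p + s) \<Longrightarrow> e = z * p \<Longrightarrow> f = z * q \<Longrightarrow> h = z * r \<Longrightarrow> i = z * s \<Longrightarrow>
     mat3 a b c 0 e f 0 h i \<in> row_algebra p q r s"
  unfolding row_algebra_def by blast

lemma span_3_eqI:
  fixes a b c :: "'a::real_vector"
  assumes "\<And>x y z. x *\<^sub>R a + y *\<^sub>R b + z *\<^sub>R c \<in> S"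
    "\<And>A. A \<in> S \<Longrightarrow> \<exists>x y z. A = x *\<^sub>R a + y *\<^sub>R b + z *\<^sub>R c"
  shows "span {a, b, c} = S"
  using assms unfolding span_3 by blast

text \<open>The entry -1 is the sign in \<open>X\<alpha>\<beta>\<close>; the span then has the form
  used in the list.\<close>

lemma span_row_algebra:
  "span {mat3 0 1 0 0 0 0 0 0 0, mat3 0 0 (-1) 0 0 0 0 0 0, mat3 (- (p + s)) 0 0 0 p q 0 r s} = row_algebra p q r s"
proof (rule span_3_eqI)
  fix A assume "A \<in> row_algebra p q r s"
  then obtain x y z where A: "A = mat3 (- z * (p + s)) x y 0 (z * p) (z * q) 0 (z * r) (z * s)"
    unfolding row_algebra_def by auto
  show "\<exists>x y z. A = x *\<^sub>R mat3 0 1 0 0 0 0 0 0 0 + y *\<^sub>R mat3 0 0 (-1) 0 0 0 0 0 0 +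
      z *\<^sub>R mat3 (- (p + s)) 0 0 0 p q 0 r s"
    by (rule exI[of _ x], rule exI[of _ "- y"], rule exI[of _ z]) (simp add: A algebra_simps)
qed (auto intro!: row_algebraI simp: algebra_simps)

text \<open>Up to the sign of the generator, \<open>U1\<close> and \<open>U11\<close> are the
  members of the family \<open>U7\<close> at the excluded parameters -1 and 1. \<open>U12\<close> is
  the trace-free counterpart of \<open>U8\<close>, and \<open>U3\<close> carries a Jordan
  block.\<close>

lemma \<uu>\<^sub>3_row_algebra:
  "\<uu>\<^sub>3 U1 = row_algebra (-1) 0 0 (-1)"
  "\<uu>\<^sub>3 U3 = row_algebra (-1) 1 0 (-1)"
  "\<uu>\<^sub>3 (U7 a) = row_algebra 1 0 0 (-a)"
  "\<uu>\<^sub>3 (U8 t) = row_algebra (-1/2) (-t) t (-1/2)"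
  "\<uu>\<^sub>3 U11 = row_algebra 1 0 0 (-1)"
  "\<uu>\<^sub>3 U12 = row_algebra 0 1 (-1) 0"
  unfolding span_row_algebra[symmetric] by (simp_all add: mat_unit_mat3)

lemma \<uu>\<^sub>3_U15: "\<uu>\<^sub>3 U15 = {mat3 0 x z 0 0 y 0 0 0 | x y z. True}"
  unfolding \<uu>\<^sub>3.simps
proof (rule span_3_eqI)
  fix A assume "A \<in> {mat3 0 x z 0 0 y 0 0 0 | x y z. True}"
  then obtain x y z where A: "A = mat3 0 x z 0 0 y 0 0 0" by auto
  show "\<exists>x y z. A = x *\<^sub>R X\<alpha> + y *\<^sub>R X\<beta> + z *\<^sub>R X\<alpha>\<beta>"
    by (rule exI[of _ x], rule exI[of _ y], rule exI[of _ "- z"]) (simp add: A mat_unit_mat3)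
qed (auto simp: mat_unit_mat3)

lemma \<uu>\<^sub>3_U5: "\<uu>\<^sub>3 U5 = {mat3 z x y 0 0 x 0 0 (-z) | x y z. True}"
  unfolding \<uu>\<^sub>3.simps
proof (rule span_3_eqI)
  fix A assume "A \<in> {mat3 z x y 0 0 x 0 0 (-z) | x y z. True}"
  then obtain x y z where A: "A = mat3 z x y 0 0 x 0 0 (-z)" by auto
  show "\<exists>x y z. A = x *\<^sub>R (X\<alpha> + X\<beta>) + y *\<^sub>R X\<alpha>\<beta> + z *\<^sub>R (H\<alpha> + H\<beta>)"
    by (rule exI[of _ x], rule exI[of _ "- y"], rule exI[of _ z]) (simp add: A mat_unit_mat3)
qed (auto simp: mat_unit_mat3)

lemma \<uu>\<^sub>3_U6: "\<uu>\<^sub>3 U6 = {mat3 y x 0 0 z 0 0 0 (- y - z) | x y z. True}"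
  unfolding \<uu>\<^sub>3.simps
proof (rule span_3_eqI)
  fix A assume "A \<in> {mat3 y x 0 0 z 0 0 0 (- y - z) | x y z. True}"
  then obtain x y z where A: "A = mat3 y x 0 0 z 0 0 0 (- y - z)" by auto
  show "\<exists>x y z. A = x *\<^sub>R X\<alpha> + y *\<^sub>R H\<alpha> + z *\<^sub>R H\<beta>"
    by (rule exI[of _ x], rule exI[of _ y], rule exI[of _ "y + z"]) (simp add: A mat_unit_mat3)
qed (auto simp: mat_unit_mat3)

lemma dim_span_3:
  fixes a b c :: "'a::euclidean_space"
  assumes "\<And>x y z. x *\<^sub>R a + y *\<^sub>R b + z *\<^sub>R c = 0 \<Longrightarrow> x = 0 \<and> y = 0 \<and> z = 0"
  shows "dim (span {a, b, c}) = 3"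
proof -
  have a: "a \<noteq> 0" using assms[of 1 0 0] by auto
  have b: "b \<notin> span {a}"
  proof
    assume "b \<in> span {a}"
    then obtain k where "b - k *\<^sub>R a = 0" by (auto simp: span_breakdown_eq)
    then show False using assms[of "- k" 1 0] by simp
  qed
  have c: "c \<notin> span {b, a}"
  proof
    assume "c \<in> span {b, a}"
    then obtain k l where "c - k *\<^sub>R b - l *\<^sub>R a = 0" by (auto simp: span_breakdown_eq)
    then show False using assms[of "- l" "- k" 1] by (simp add: algebra_simps)
  qed
  have "independent {c, b, a}"
    using a b c by (simp add: independent_insert)
  moreover have "card {c, b, a} = 3"
    using a b c by (metis card_3_iff insertCI span_base)
  ultimately show ?thesis
    by (metis dim_span dim_eq_card_independent insert_commute)
qed

text \<open>Intertwining with \<open>M\<close> avoids writing down its inverse, and one inclusion is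
  enough because the dimensions agree.\<close>

lemma gl_conj_intertwine:
  assumes "subspace u" "subspace v" "dim u = dim v" "det M \<noteq> 0"
    and tw: "\<And>A. A \<in> u \<Longrightarrow> \<exists>A'\<in>v. A ** M = M ** A'"
  shows "u \<sim>\<^sub>G v"
proof -
  obtain N where N: "M ** N = mat 1" "N ** M = mat 1"
    using exists_inverse_pair[OF assms(4)] .
  let ?f = "\<lambda>A. N ** A ** M"
  have sub: "?f ` u \<subseteq> v"
  proof
    fix B assume "B \<in> ?f ` u"
    then obtain A where A: "A \<in> u" "B = N ** A ** M" by blast
    obtain A' where A': "A' \<in> v" "A ** M = M ** A'" using tw A(1) by blast
    then have "B = A'" 
      unfolding A(2) matrix_mul_assoc[symmetric] A'(2) using N(2) by (simp add: matrix_mul_assoc)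
    then show "B \<in> v" using A'(1) by simp
  qed
  have "inj ?f"
    by (rule inj_on_inverseI[of _ "\<lambda>A. M ** A ** N"]) (simp add: conj_cancel N)
  then have "dim (?f ` u) = dim u"
    by (intro dim_image_eq linear_conj) (auto intro: inj_on_subset)
  moreover have "subspace (?f ` u)"
    using assms(1) by (intro linear_subspace_image linear_conj)
  ultimately have "?f ` u = v"
    using sub assms(2,3) by (intro subspace_dim_equal) auto
  then show ?thesis
    using N unfolding gl_conj_def by blast
qed

lemma subspace_row_algebra: "subspace (row_algebra p q r s)"
  unfolding span_row_algebra[symmetric] by (rule subspace_span)

lemma dim_row_algebra:
  assumes "p \<noteq> 0 \<or> q \<noteq> 0 \<or> r \<noteq> 0 \<or> s \<noteq> 0"
  shows "dim (row_algebra p q r s) = 3"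
  unfolding span_row_algebra[symmetric]
  by (rule dim_span_3) (use assms in auto)

text \<open>Conjugation by diag(1, R) with R = (a b; c d): the four middle equations say B R = k R
  B' for the blocks, the last one matches the corners, and first rows are merely multiplied by
  R.\<close>

lemma row_algebra_intertwine:
  assumes "p \<noteq> 0 \<or> q \<noteq> 0 \<or> r \<noteq> 0 \<or> s \<noteq> 0" "p' \<noteq> 0 \<or> q' \<noteq> 0 \<or> r' \<noteq> 0 \<or> s' \<noteq> 0"
    and "a * d - b * c \<noteq> 0"
    and "p * a + q * c = k * (a * p' + b * r')" "p * b + q * d = k * (a * q' + b * s')"
        "r * a + s * c = k * (c * p' + d * r')" "r * b + s * d = k * (c * q' + d * s')"
    and "p + s = k * (p' + s')"
  shows "row_algebra p q r s \<sim>\<^sub>G row_algebra p' q' r' s'"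
proof (rule gl_conj_intertwine)
  show "det (mat3 1 0 0 0 a b 0 c d) \<noteq> 0"
    using assms(3) by (simp add: mat3_det)
  fix A assume "A \<in> row_algebra p q r s"
  then obtain x y z where A: "A = mat3 (- z * (p + s)) x y 0 (z * p) (z * q) 0 (z * r) (z * s)"
    unfolding row_algebra_def by auto
  let ?A' = "mat3 (- (z * k) * (p' + s')) (x * a + y * c) (x * b + y * d) 0 (z * k * p') (z * k * q') 0 (z * k * r') (z * k * s')"
  have "A ** mat3 1 0 0 0 a b 0 c d = mat3 1 0 0 0 a b 0 c d ** ?A'"
    unfolding A using assms(4-8)[THEN arg_cong[where f = "(*) z"]] by (simp add: algebra_simps)
  moreover have "?A' \<in> row_algebra p' q' r' s'"
    by (rule row_algebraI[of _ "z * k"]) (rule refl)+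
  ultimately show "\<exists>A'\<in>row_algebra p' q' r' s'. A ** mat3 1 0 0 0 a b 0 c d = mat3 1 0 0 0 a b 0 c d ** A'"
    by blast
qed (use assms in \<open>simp_all add: subspace_row_algebra dim_row_algebra\<close>)

text \<open>A nonscalar block has a cyclic vector (v, w); in the basis formed by it and its image
  the block becomes the companion matrix of its characteristic polynomial. The quantity in
  \<open>vw\<close> is the determinant of that basis.\<close>

lemma row_algebra_companion:
  assumes "\<not> (q = 0 \<and> r = 0 \<and> p = s)"
  shows "row_algebra p q r s \<sim>\<^sub>G row_algebra 0 (q * r - p * s) 1 (p + s)"
proof -
  obtain v w where vw: "v * (r * v + s * w) - (p * v + q * w) * w \<noteq> 0"
  proof -
    consider "r \<noteq> 0" | "q \<noteq> 0" | "r = 0" "q = 0" "p \<noteq> s" using assms by blast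
    then show ?thesis
    proof cases
      case 1 then show ?thesis using that[of 1 0] by simp
    next
      case 2 then show ?thesis using that[of 0 1] by simp
    next
      case 3 then show ?thesis using that[of 1 1] by simp
    qed
  qed
  show ?thesis
    by (rule row_algebra_intertwine[OF _ _ vw, where k = 1]) (use assms in \<open>auto simp: algebra_simps\<close>)
qed

text \<open>The nonscalar blocks B and c B' have equal trace and determinant, hence the same
  companion matrix. In the middle step diag(c, 1) conjugates it to c times the companion matrix of
  B'.\<close>

lemma row_algebra_conjI:
  assumes "\<not> (q = 0 \<and> r = 0 \<and> p = s)" "\<not> (q' = 0 \<and> r' = 0 \<and> p' = s')"
    and "c \<noteq> 0" "p + s = c * (p' + s')" "p * s - q * r = c\<^sup>2 * (p' * s' - q' * r')"
  shows "row_algebra p q r s \<sim>\<^sub>G row_algebra p' q' r' s'"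
proof -
  have eq: "q * r - p * s = c * (c * (q' * r' - p' * s'))"
    using assms(5) by (simp add: algebra_simps power2_eq_square)
  have "row_algebra p q r s \<sim>\<^sub>G row_algebra 0 (q * r - p * s) 1 (p + s)"
    by (rule row_algebra_companion[OF assms(1)])
  also have "\<dots> \<sim>\<^sub>G row_algebra 0 (q' * r' - p' * s') 1 (p' + s')"
    by (rule row_algebra_intertwine[where a = c and b = 0 and c = 0 and d = 1 and k = c])
      (use assms(3,4) eq in auto)
  also have "\<dots> \<sim>\<^sub>G row_algebra p' q' r' s'"
    by (rule gl_conj_sym[OF row_algebra_companion[OF assms(2)]])
  finally show ?thesis .
qed

lemma row_algebra_scalar:
  assumes "p \<noteq> 0"
  shows "row_algebra p 0 0 p \<sim>\<^sub>G row_algebra (-1) 0 0 (-1)"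
  by (rule row_algebra_intertwine[where a = 1 and b = 0 and c = 0 and d = 1 and k = "- p"]) (use assms in auto)

text \<open>The block is nilpotent here, so there are nilpotents beyond the first rows; this is why
  \<open>U15\<close> stays apart from the other row algebras when conjugacy is decided.\<close>

lemma row_algebra_U15: "row_algebra 0 1 0 0 \<sim>\<^sub>G \<uu>\<^sub>3 U15"
proof -
  have "row_algebra 0 1 0 0 = \<uu>\<^sub>3 U15"
    unfolding \<uu>\<^sub>3_U15 row_algebra_def by auto
  then show ?thesis by simp
qed

text \<open>A nonscalar block is determined up to conjugation and scaling by the sign of its discriminant and
  the ratio of its determinant to its squared trace.\<close>

lemma listed_row_algebra:
  assumes "p \<noteq> 0 \<or> q \<noteq> 0 \<or> r \<noteq> 0 \<or> s \<noteq> 0"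
  shows "listed (row_algebra p q r s)"
proof (cases "q = 0 \<and> r = 0 \<and> p = s")
  case True
  then have "row_algebra p q r s \<sim>\<^sub>G \<uu>\<^sub>3 U1"
    using assms row_algebra_scalar[of p] by (simp only: \<uu>\<^sub>3_row_algebra) auto
  then show ?thesis
    unfolding listed_def admissible_def by (intro exI[of _ U1]) simp
next
  case ns: False
  define t where "t = p + s"
  define d where "d = p * s - q * r"
  note I = row_algebra_conjI[OF ns]
  have *: "listed (row_algebra p q r s)" if "admissible k" "row_algebra p q r s \<sim>\<^sub>G \<uu>\<^sub>3 k" for k
    using that unfolding listed_def by blast
  show ?thesis
  proof (cases "t = 0")
    case t: True
    consider "d < 0" | "d = 0" | "d > 0" by linarith
    then show ?thesis
    proof cases
      case 1
      have "row_algebra p q r s \<sim>\<^sub>G \<uu>\<^sub>3 U11"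
        unfolding \<uu>\<^sub>3_row_algebra 
        by (rule I[where c = "sqrt (- d)"]) (use 1 t in \<open>auto simp: t_def d_def\<close>)
      then show ?thesis by (rule *[rotated]) (simp add: admissible_def)
    next
      case 2
      have "row_algebra p q r s \<sim>\<^sub>G row_algebra 0 1 0 0"
        by (rule I[where c = 1]) (use 2 t in \<open>auto simp: t_def d_def\<close>)
      then have "row_algebra p q r s \<sim>\<^sub>G \<uu>\<^sub>3 U15"
        using row_algebra_U15 gl_conj_trans by blast
      then show ?thesis by (rule *[rotated]) (simp add: admissible_def)
    next
      case 3
      have "row_algebra p q r s \<sim>\<^sub>G \<uu>\<^sub>3 U12"
        unfolding \<uu>\<^sub>3_row_algebra 
        by (rule I[where c = "sqrt d"]) (use 3 t in \<open>auto simp: t_def d_def\<close>)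
      then show ?thesis by (rule *[rotated]) (simp add: admissible_def)
    qed
  next
    case t: False
    consider "t\<^sup>2 - 4 * d = 0" | "t\<^sup>2 - 4 * d > 0" | "t\<^sup>2 - 4 * d < 0" by linarith
    then show ?thesis
    proof cases
      case 1
      have "row_algebra p q r s \<sim>\<^sub>G \<uu>\<^sub>3 U3"
        unfolding \<uu>\<^sub>3_row_algebra 
        by (rule I[where c = "- t / 2"]) (use 1 t in \<open>auto simp: t_def[symmetric] d_def[symmetric] power_divide\<close>)
      then show ?thesis by (rule *[rotated]) (simp add: admissible_def)
    next
      case 2
      define e where "e = sqrt (t\<^sup>2 - 4 * d)"
      have e: "e > 0" "e\<^sup>2 = t\<^sup>2 - 4 * d" using 2 by (auto simp: e_def)
      obtain l m where lm: "l \<noteq> 0" "l \<noteq> m" "l + m = t" "l * m = d"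
      \<comment> \<open>\<open>l\<close> and \<open>m\<close> are the eigenvalues. The block is
        later normalized to diag(1, m / l), so \<open>l\<close> must be a nonzero one.\<close>
      proof (cases "t + e = 0")
        case True
        then have te: "t = - e" by linarith
        then have "d = 0" using e(2) by simp
        then show ?thesis
          by (intro that[of t 0]) (use t in auto)
      next
        case False
        show ?thesis
          by (rule that[of "(t + e) / 2" "(t - e) / 2"])
             (use e False t in \<open>auto simp: field_simps power2_eq_square\<close>)
      qed
      have a: "- m / l \<noteq> 1" "- m / l \<noteq> -1"
        using lm t by (auto simp: field_simps)
      have "row_algebra p q r s \<sim>\<^sub>G \<uu>\<^sub>3 (U7 (- m / l))"
        unfolding \<uu>\<^sub>3_row_algebra 
        by (rule I[where c = l])
          (use lm in \<open>auto simp: t_def[symmetric] d_def[symmetric] field_simps power2_eq_square\<close>)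
      then show ?thesis by (rule *[rotated]) (use a in \<open>simp add: admissible_def\<close>)
    next
      case 3
      \<comment> \<open>Scaling the trace to -1 leaves determinant d / t^2, which has to equal the 1
        / 4 + f^2 of \<open>U8 f\<close>.\<close>
      define f where "f = sqrt (d / t\<^sup>2 - 1 / 4)"
      have "d / t\<^sup>2 - 1 / 4 > 0" using 3 t by (simp add: field_simps)
      then have f: "f > 0" "f\<^sup>2 = d / t\<^sup>2 - 1 / 4" by (auto simp: f_def)
      have "t\<^sup>2 * (1 / 4 + f * f) = d" using f(2) t by (simp add: field_simps power2_eq_square)
      then have "row_algebra p q r s \<sim>\<^sub>G \<uu>\<^sub>3 (U8 f)"
        unfolding \<uu>\<^sub>3_row_algebra 
        by (intro I[where c = "- t"]) (use t f(1) in \<open>auto simp: t_def[symmetric] d_def[symmetric]\<close>)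
      then show ?thesis by (rule *[rotated]) (use f in \<open>simp add: admissible_def\<close>)
    qed
  qed
qed

subsection \<open>Duality\<close>

text \<open>Transposition is an anti-automorphism, so it permutes the conjugacy classes of subalgebras.
  It sends \<open>\<uu>\<^sub>3 k\<close> to a conjugate of \<open>\<uu>\<^sub>3 (dual k)\<close>.\<close>

fun dual :: "label \<Rightarrow> label" where
  "dual U1 = U2" | "dual U2 = U1"
| "dual U3 = U4" | "dual U4 = U3"
| "dual (U7 a) = U9 a" | "dual (U9 a) = U7 a"
| "dual (U8 t) = U10 (2 * t)" | "dual (U10 t) = U8 (t / 2)"
| "dual U11 = U13" | "dual U13 = U11"
| "dual U12 = U14" | "dual U14 = U12"
| "dual U5 = U5" | "dual U6 = U6" | "dual U15 = U15"

lemma dual_dual [simp]: "dual (dual k) = k"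
  by (cases k) auto

lemma admissible_dual [simp]: "admissible (dual k) \<longleftrightarrow> admissible k"
  by (cases k) (auto simp: admissible_def)

lemma transpose_eq_mat3_iff [simp]:
  "transpose A = mat3 a b c d e f g h i \<longleftrightarrow> A = mat3 a d g b e h c f i"
  by (metis mat3_transpose transpose_transpose)

lemma span_column:
  "span {X\<alpha>, Y\<beta>, mat3 p 0 q 0 (- (p + s)) 0 r 0 s} =
     {mat3 (z * p) x (z * q) 0 (- z * (p + s)) 0 (z * r) y (z * s) | x y z. True}"
proof (rule span_3_eqI)
  fix A assume "A \<in> {mat3 (z * p) x (z * q) 0 (- z * (p + s)) 0 (z * r) y (z * s) | x y z. True}"
  then obtain x y z where A: "A = mat3 (z * p) x (z * q) 0 (- z * (p + s)) 0 (z * r) y (z * s)"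
    by auto
  show "\<exists>x y z. A = x *\<^sub>R X\<alpha> + y *\<^sub>R Y\<beta> + z *\<^sub>R mat3 p 0 q 0 (- (p + s)) 0 r 0 s"
    by (rule exI[of _ x], rule exI[of _ y], rule exI[of _ z]) (simp add: A mat_unit_mat3 algebra_simps)
qed (auto simp: mat_unit_mat3 algebra_simps)

text \<open>Transposition turns the middle column into a middle row and transposes the complementary
  block; exchanging the first two basis vectors by \<open>?K\<close> moves that row to the
  top.\<close>

lemma transpose_column:
  "transpose ` span {X\<alpha>, Y\<beta>, mat3 p 0 q 0 (- (p + s)) 0 r 0 s} \<sim>\<^sub>G row_algebra p r q s"
proof (rule gl_conjI)
  let ?K = "mat3 0 1 0 1 0 0 0 0 1"
  show "?K ** ?K = mat 1" "?K ** ?K = mat 1"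
    by simp_all
  show "?K ** A ** ?K \<in> row_algebra p r q s"
    if "A \<in> transpose ` span {X\<alpha>, Y\<beta>, mat3 p 0 q 0 (- (p + s)) 0 r 0 s}" for A
    using that unfolding span_column row_algebra_def by auto
  show "?K ** A ** ?K \<in> transpose ` span {X\<alpha>, Y\<beta>, mat3 p 0 q 0 (- (p + s)) 0 r 0 s}"
    if "A \<in> row_algebra p r q s" for A
    using that unfolding span_column row_algebra_def by auto
qed

lemma transpose_\<uu>\<^sub>3_row_algebra:
  "transpose ` \<uu>\<^sub>3 U2 \<sim>\<^sub>G row_algebra 1 0 0 1"
  "transpose ` \<uu>\<^sub>3 U4 \<sim>\<^sub>G row_algebra (-1) 0 1 (-1)"
  "transpose ` \<uu>\<^sub>3 (U9 a) \<sim>\<^sub>G row_algebra 1 0 0 (- a)"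
  "transpose ` \<uu>\<^sub>3 (U10 t) \<sim>\<^sub>G row_algebra (-1/2) (- t / 4) t (-1/2)"
  "transpose ` \<uu>\<^sub>3 U13 \<sim>\<^sub>G row_algebra 1 0 0 (-1)"
  "transpose ` \<uu>\<^sub>3 U14 \<sim>\<^sub>G row_algebra 0 (-1) 1 0"
proof -
  show "transpose ` \<uu>\<^sub>3 U2 \<sim>\<^sub>G row_algebra 1 0 0 1"
    using transpose_column[of 1 0 1 0] by (simp add: mat_unit_mat3)
  show "transpose ` \<uu>\<^sub>3 (U9 a) \<sim>\<^sub>G row_algebra 1 0 0 (- a)"
    using transpose_column[of 1 0 "- a" 0] by (simp add: mat_unit_mat3)
  show "transpose ` \<uu>\<^sub>3 (U10 t) \<sim>\<^sub>G row_algebra (-1/2) (- t / 4) t (-1/2)"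
    using transpose_column[of "-1/2" t "-1/2" "- t / 4"] by (simp add: mat_unit_mat3)
  show "transpose ` \<uu>\<^sub>3 U13 \<sim>\<^sub>G row_algebra 1 0 0 (-1)"
    using transpose_column[of 1 0 "-1" 0] by (simp add: mat_unit_mat3)
  show "transpose ` \<uu>\<^sub>3 U14 \<sim>\<^sub>G row_algebra 0 (-1) 1 0"
    using transpose_column[of 0 1 0 "-1"] by (simp add: mat_unit_mat3)
  have "transpose ` \<uu>\<^sub>3 U4 = row_algebra (-1) 0 1 (-1)"
    unfolding \<uu>\<^sub>3.simps span_row_algebra[symmetric] linear_span_image[OF linear_transpose, symmetric]
    by (simp add: mat_unit_mat3)
  then show "transpose ` \<uu>\<^sub>3 U4 \<sim>\<^sub>G row_algebra (-1) 0 1 (-1)"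
    by simp
qed

text \<open>\<open>?J ** transpose A ** ?J\<close> reflects \<open>A\<close> in the antidiagonal,
  which keeps the upper triangular shapes of \<open>U5\<close> and \<open>U15\<close>; for
  \<open>U6\<close> exchanging the first two basis vectors is enough.\<close>

lemma transpose_\<uu>\<^sub>3_self:
  "transpose ` \<uu>\<^sub>3 U5 \<sim>\<^sub>G \<uu>\<^sub>3 U5"
  "transpose ` \<uu>\<^sub>3 U6 \<sim>\<^sub>G \<uu>\<^sub>3 U6"
  "transpose ` \<uu>\<^sub>3 U15 \<sim>\<^sub>G \<uu>\<^sub>3 U15"
proof -
  let ?J = "mat3 0 0 1 0 1 0 1 0 0"
  have J: "?J ** ?J = mat 1"
    by simp
  have "A \<in> transpose ` \<uu>\<^sub>3 U5 \<Longrightarrow> ?J ** A ** ?J \<in> \<uu>\<^sub>3 U5" "A \<in> \<uu>\<^sub>3 U5 \<Longrightarrow> ?J ** A ** ?J \<in> transpose ` \<uu>\<^sub>3 U5" for A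
    unfolding \<uu>\<^sub>3_U5 by (auto intro: exI[of _ "- _"])
  then show "transpose ` \<uu>\<^sub>3 U5 \<sim>\<^sub>G \<uu>\<^sub>3 U5"
    using gl_conjI[OF J J] by blast
  have "A \<in> transpose ` \<uu>\<^sub>3 U15 \<Longrightarrow> ?J ** A ** ?J \<in> \<uu>\<^sub>3 U15" "A \<in> \<uu>\<^sub>3 U15 \<Longrightarrow> ?J ** A ** ?J \<in> transpose ` \<uu>\<^sub>3 U15" for A
    unfolding \<uu>\<^sub>3_U15 by auto
  then show "transpose ` \<uu>\<^sub>3 U15 \<sim>\<^sub>G \<uu>\<^sub>3 U15"
    using gl_conjI[OF J J] by blast
  let ?K = "mat3 0 1 0 1 0 0 0 0 1"
  have K: "?K ** ?K = mat 1"
    by simp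
  have "A \<in> transpose ` \<uu>\<^sub>3 U6 \<Longrightarrow> ?K ** A ** ?K \<in> \<uu>\<^sub>3 U6" "A \<in> \<uu>\<^sub>3 U6 \<Longrightarrow> ?K ** A ** ?K \<in> transpose ` \<uu>\<^sub>3 U6" for A
    unfolding \<uu>\<^sub>3_U6 by auto
  then show "transpose ` \<uu>\<^sub>3 U6 \<sim>\<^sub>G \<uu>\<^sub>3 U6"
    using gl_conjI[OF K K] by blast
qed

lemma transpose_\<uu>\<^sub>3:
  shows "transpose ` \<uu>\<^sub>3 k \<sim>\<^sub>G \<uu>\<^sub>3 (dual k)"
proof -
  note R = transpose_\<uu>\<^sub>3_row_algebra
  have U2: "transpose ` \<uu>\<^sub>3 U2 \<sim>\<^sub>G \<uu>\<^sub>3 U1"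
    using gl_conj_trans[OF R(1) row_algebra_scalar] by (simp add: \<uu>\<^sub>3_row_algebra del: \<uu>\<^sub>3.simps)
  have U4: "transpose ` \<uu>\<^sub>3 U4 \<sim>\<^sub>G \<uu>\<^sub>3 U3"
    by (rule gl_conj_trans[OF R(2)]) (simp only: \<uu>\<^sub>3_row_algebra, rule row_algebra_conjI[where c = 1], auto)
  have U9: "transpose ` \<uu>\<^sub>3 (U9 a) \<sim>\<^sub>G \<uu>\<^sub>3 (U7 a)" for a
    using R(3) by (simp only: \<uu>\<^sub>3_row_algebra)
  \<comment> \<open>The block of \<open>U10 t\<close> has determinant 1 / 4 + (t / 2)^2, as does
    that of \<open>U8 (t / 2)\<close>, and the traces agree. At t = 0 both blocks are scalar and the
    companion argument does not apply.\<close>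
  have U10: "transpose ` \<uu>\<^sub>3 (U10 t) \<sim>\<^sub>G \<uu>\<^sub>3 (U8 (t / 2))" for t
  proof (cases "t = 0")
    case True
    then show ?thesis using R(4)[of 0] by (simp add: \<uu>\<^sub>3_row_algebra del: \<uu>\<^sub>3.simps)
  next
    case False
    then show ?thesis
      by (intro gl_conj_trans[OF R(4)]) (simp only: \<uu>\<^sub>3_row_algebra, rule row_algebra_conjI[where c = 1], auto)
  qed
  have U13: "transpose ` \<uu>\<^sub>3 U13 \<sim>\<^sub>G \<uu>\<^sub>3 U11"
    using R(5) by (simp only: \<uu>\<^sub>3_row_algebra)
  have U14: "transpose ` \<uu>\<^sub>3 U14 \<sim>\<^sub>G \<uu>\<^sub>3 U12"
    by (rule gl_conj_trans[OF R(6)]) (simp only: \<uu>\<^sub>3_row_algebra, rule row_algebra_conjI[where c = 1], auto)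
  have sym: "transpose ` \<uu>\<^sub>3 l \<sim>\<^sub>G \<uu>\<^sub>3 k" if "transpose ` \<uu>\<^sub>3 k \<sim>\<^sub>G \<uu>\<^sub>3 l" for k l
    using gl_conj_sym[OF gl_conj_transpose[OF that]] by simp
  show ?thesis
    using U2 U4 U9 U10 U13 U14 U10[of "2 * t" for t] transpose_\<uu>\<^sub>3_self sym
    by (cases k) (auto simp del: \<uu>\<^sub>3.simps)
qed

lemma listed_transpose:
  assumes "listed (transpose ` u)" shows "listed u"
proof -
  obtain k where k: "admissible k" "transpose ` u \<sim>\<^sub>G \<uu>\<^sub>3 k"
    using assms unfolding listed_def by blast
  have "u \<sim>\<^sub>G transpose ` \<uu>\<^sub>3 k"
    using gl_conj_transpose[OF k(2)] by simp
  then have "u \<sim>\<^sub>G \<uu>\<^sub>3 (dual k)"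
    using transpose_\<uu>\<^sub>3 gl_conj_trans by blast
  then show ?thesis
    using k(1) unfolding listed_def by (meson admissible_dual)
qed

subsection \<open>Algebras of triangular shape\<close>

text \<open>Rank-nullity: a map from three dimensions to two is not injective. This supplies
  elements with two prescribed zero entries.\<close>

lemma exists_common_zero:
  fixes f g :: "'a::euclidean_space \<Rightarrow> real"
  assumes "subspace u" "dim u = 3" "linear f" "linear g"
  obtains A where "A \<in> u" "A \<noteq> 0" "f A = 0" "g A = 0"
proof (rule ccontr)
  assume "\<not> thesis"
  then have *: "\<And>A. A \<in> u \<Longrightarrow> f A = 0 \<Longrightarrow> g A = 0 \<Longrightarrow> A = 0"
    using that by blast
  let ?h = "\<lambda>A. (f A, g A)"
  have lin: "linear ?h"
    by (intro linearI) (simp_all add: linear_add[OF assms(3)] linear_add[OF assms(4)]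
        linear_scale[OF assms(3)] linear_scale[OF assms(4)])
  have "inj_on ?h u"
  proof (rule inj_onI)
    fix A B assume "A \<in> u" "B \<in> u" "?h A = ?h B"
    then have "A - B = 0"
      using assms(1) by (intro *) (auto simp: linear_diff[OF assms(3)] linear_diff[OF assms(4)] subspace_diff)
    then show "A = B" by simp
  qed
  then have "dim (?h ` u) = dim u"
    using assms(1) by (intro dim_image_eq[OF lin]) (simp add: span_eq_iff[THEN iffD2])
  moreover have "dim (?h ` u) \<le> DIM(real \<times> real)"
    by (rule dim_subset_UNIV)
  ultimately show False
    using assms(2) by simp
qed

lemma linear_entry: "linear (\<lambda>A :: real^3^3. A $ i $ j)"
  by (rule linearI) simp_all

lemma lie3_entries_zero:
  assumes "lie3 u"
  obtains A where "A \<in> u" "A \<noteq> 0" "A $ i $ j = 0" "A $ k $ l = 0"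
  using exists_common_zero[OF lie3D(1,2)[OF assms] linear_entry[of i j] linear_entry[of k l]] .

lemma subspace_mat3_scale:
  assumes "subspace u" "mat3 a b c d e f g h i \<in> u"
    and "a' = k * a" "b' = k * b" "c' = k * c" "d' = k * d" "e' = k * e" "f' = k * f" "g' = k * g" "h' = k * h" "i' = k * i"
  shows "mat3 a' b' c' d' e' f' g' h' i' \<in> u"
  using subspace_mul[OF assms(1,2), of k] by (simp add: assms(3-))

text \<open>Modulo the first rows the algebra is one-dimensional. A generator \<open>C\<close>
  cleared at 12 and 13 has only its block left, the corner being fixed by the trace.\<close>

lemma listed_of_row:
  assumes u: "lie3 u" and E: "mat3 0 1 0 0 0 0 0 0 0 \<in> u" "mat3 0 0 1 0 0 0 0 0 0 \<in> u"
    and upper: "\<And>A. A \<in> u \<Longrightarrow> A $ 2 $ 1 = 0 \<and> A $ 3 $ 1 = 0"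
  shows "listed u"
proof -
  note sub = lie3D(1)[OF u]
  obtain C where C: "C \<in> u" "C \<noteq> 0" "C $ 1 $ 2 = 0" "C $ 1 $ 3 = 0"
    using lie3_entries_zero[OF u] .
  define p q r s where "p = C $ 2 $ 2" "q = C $ 2 $ 3" "r = C $ 3 $ 2" "s = C $ 3 $ 3"
  have "C $ 1 $ 1 = - (p + s)"
    using lie3D(3)[OF u C(1)] by (simp add: trace_3 p_q_r_s_def)
  then have C': "C = mat3 (- (p + s)) 0 0 0 p q 0 r s"
    using C upper[OF C(1)] by (simp add: mat_eq_iff_3 p_q_r_s_def)
  have nz: "p \<noteq> 0 \<or> q \<noteq> 0 \<or> r \<noteq> 0 \<or> s \<noteq> 0"
    using C(2) unfolding C' by auto
  have "row_algebra p q r s \<subseteq> u"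
  proof
    fix A assume "A \<in> row_algebra p q r s"
    then obtain x y z where "A = mat3 (- z * (p + s)) x y 0 (z * p) (z * q) 0 (z * r) (z * s)"
      unfolding row_algebra_def by auto
    then have "A = x *\<^sub>R mat3 0 1 0 0 0 0 0 0 0 + y *\<^sub>R mat3 0 0 1 0 0 0 0 0 0 + z *\<^sub>R C"
      by (simp add: C' algebra_simps)
    then show "A \<in> u"
      using sub E C(1) by (simp only:) (intro subspace_add subspace_mul)
  qed
  then have "row_algebra p q r s = u"
    using sub lie3D(2)[OF u] dim_row_algebra[OF nz] by (intro subspace_dim_equal subspace_row_algebra) auto
  then show ?thesis
    using listed_row_algebra[OF nz] by simp
qed

text \<open>Reflection in the antidiagonal carries the last column to the first row.\<close>

lemma listed_of_column:
  assumes u: "lie3 u" and E: "mat3 0 0 1 0 0 0 0 0 0 \<in> u" "mat3 0 0 0 0 0 1 0 0 0 \<in> u"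
    and upper: "\<And>A. A \<in> u \<Longrightarrow> A $ 3 $ 1 = 0 \<and> A $ 3 $ 2 = 0"
  shows "listed u"
proof -
  let ?J = "mat3 0 0 1 0 1 0 1 0 0"
  define v where "v = (\<lambda>A. ?J ** A ** ?J) ` transpose ` u"
  have uv: "transpose ` u \<sim>\<^sub>G v"
    unfolding gl_conj_def v_def by (intro exI[of _ ?J]) simp
  have "lie3 v"
    using lie3_conj[OF uv lie3_transpose[OF u]] .
  moreover have "mat3 0 1 0 0 0 0 0 0 0 \<in> v" "mat3 0 0 1 0 0 0 0 0 0 \<in> v"
    using imageI[OF E(1), of "\<lambda>A. ?J ** transpose A ** ?J"] imageI[OF E(2), of "\<lambda>A. ?J ** transpose A ** ?J"]
    by (simp_all add: v_def image_image)
  moreover have "A $ 2 $ 1 = 0 \<and> A $ 3 $ 1 = 0" if A: "A \<in> v" for A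
  proof -
    obtain B where B: "B \<in> u" "A = ?J ** transpose B ** ?J"
      using A unfolding v_def by auto
    obtain a b c d e f g h i where "B = mat3 a b c d e f g h i"
      by (rule mat3_cases)
    then show ?thesis
      using upper[OF B(1)] B(2) by simp
  qed
  ultimately have "listed v"
    by (rule listed_of_row)
  then show ?thesis
    using uv listed_conj listed_transpose by blast
qed

lemma dim_\<uu>\<^sub>3_special: "dim (\<uu>\<^sub>3 U5) = 3" "dim (\<uu>\<^sub>3 U6) = 3" "dim (\<uu>\<^sub>3 U15) = 3"
  unfolding \<uu>\<^sub>3.simps by (rule dim_span_3; simp add: mat_unit_mat3)+

lemma subspace_\<uu>\<^sub>3: "subspace (\<uu>\<^sub>3 k)"
  by (cases k) (simp_all only: \<uu>\<^sub>3.simps subspace_span)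

lemma gl_conj_\<uu>\<^sub>3_intertwine:
  assumes "lie3 u" "dim (\<uu>\<^sub>3 k) = 3" "det M \<noteq> 0"
    "\<And>A. A \<in> u \<Longrightarrow> \<exists>A'\<in>\<uu>\<^sub>3 k. A ** M = M ** A'"
  shows "u \<sim>\<^sub>G \<uu>\<^sub>3 k"
  using assms lie3D(1,2)[OF assms(1)] subspace_\<uu>\<^sub>3 by (intro gl_conj_intertwine[of _ _ M]) auto

text \<open>The centralizer of this regular nilpotent in sl3 is spanned by it and its square;
  normalizing its line adds only diag(1, 0, -1). That is \<open>U5\<close>, and equality follows by
  dimension.\<close>

lemma listed_of_regular:
  assumes u: "lie3 u"
    and norm: "\<And>A. A \<in> u \<Longrightarrow> \<exists>c. lie_bracket A (mat3 0 1 0 0 0 1 0 0 0) = c *\<^sub>R mat3 0 1 0 0 0 1 0 0 0"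
  shows "listed u"
proof -
  have "u \<sim>\<^sub>G \<uu>\<^sub>3 U5"
  proof (rule gl_conj_\<uu>\<^sub>3_intertwine[OF u dim_\<uu>\<^sub>3_special(1)])
    show "det (mat 1 :: real^3^3) \<noteq> 0" by simp
    fix A assume A: "A \<in> u"
    obtain a b c d e f g h i where eq: "A = mat3 a b c d e f g h i"
      by (rule mat3_cases)
    have "A \<in> \<uu>\<^sub>3 U5"
      using norm[OF A] lie3D(3)[OF u A] unfolding eq \<uu>\<^sub>3_U5 by (auto simp: lie_bracket_def)
    then show "\<exists>A'\<in>\<uu>\<^sub>3 U5. A ** mat 1 = mat 1 ** A'" by auto
  qed
  moreover have "admissible U5" by (simp add: admissible_def)
  ultimately show ?thesis unfolding listed_def by blast
qed

text \<open>Everything depends on the strictly upper triangular elements outside the line of E13.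
  One with a single nonzero superdiagonal entry makes a row or a column algebra. If they exist but
  always have both entries nonzero, the result is \<open>U5\<close>. If there are none, a
  two-dimensional diagonal part remains and the result is \<open>U6\<close>.\<close>

lemma listed_of_upper:
  assumes u: "lie3 u" and E13: "mat3 0 0 1 0 0 0 0 0 0 \<in> u"
    and upper: "\<And>A. A \<in> u \<Longrightarrow> A $ 2 $ 1 = 0 \<and> A $ 3 $ 1 = 0 \<and> A $ 3 $ 2 = 0"
  shows "listed u"
proof -
  note sub = lie3D(1)[OF u]
  note scale = subspace_mat3_scale[OF sub]
  have form: "\<exists>p q r s t. A = mat3 p q r 0 s t 0 0 (- p - s)" if "A \<in> u" for A
  proof -
    have "A $ 3 $ 3 = - A $ 1 $ 1 - A $ 2 $ 2"
      using lie3D(3)[OF u that] by (simp add: trace_3)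
    then have "A = mat3 (A $ 1 $ 1) (A $ 1 $ 2) (A $ 1 $ 3) 0 (A $ 2 $ 2) (A $ 2 $ 3) 0 0 (- A $ 1 $ 1 - A $ 2 $ 2)"
      using upper[OF that] by (simp add: mat_eq_iff_3)
    then show ?thesis by blast
  qed
  have mod13: "mat3 p q r' 0 s t 0 0 v \<in> u" if "mat3 p q r 0 s t 0 0 v \<in> u" for p q r r' s t v
    using subspace_add[OF sub that subspace_mul[OF sub E13, of "r' - r"]] by simp
  have row: "listed u" if "mat3 0 a c 0 0 0 0 0 0 \<in> u" "a \<noteq> 0" for a c
  proof (rule listed_of_row[OF u _ E13])
    show "mat3 0 1 0 0 0 0 0 0 0 \<in> u"
      using scale[OF mod13[OF that(1), of 0], of _ "1 / a"] that(2) by simp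
  qed (use upper in blast)
  have col: "listed u" if "mat3 0 0 c 0 0 b 0 0 0 \<in> u" "b \<noteq> 0" for b c
  proof (rule listed_of_column[OF u E13])
    show "mat3 0 0 0 0 0 1 0 0 0 \<in> u"
      using scale[OF mod13[OF that(1), of 0], of _ "1 / b"] that(2) by simp
  qed (use upper in blast)
  show ?thesis
  proof (cases "\<exists>a b c. mat3 0 a c 0 0 b 0 0 0 \<in> u \<and> (a \<noteq> 0 \<or> b \<noteq> 0)")
    case True
    then obtain a b c where abc: "mat3 0 a c 0 0 b 0 0 0 \<in> u" "a \<noteq> 0 \<or> b \<noteq> 0" by blast
    have m: "mat3 0 a 0 0 0 b 0 0 0 \<in> u" by (rule mod13[OF abc(1)])
    show ?thesis
    proof (rule ccontr)
      assume nl: "\<not> listed u"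
      have no_row: "a = 0" if "mat3 0 a c 0 0 0 0 0 0 \<in> u" for a c using row that nl by blast
      have no_col: "b = 0" if "mat3 0 0 c 0 0 b 0 0 0 \<in> u" for b c using col that nl by blast
      have ab: "a \<noteq> 0" "b \<noteq> 0" using no_row[of a 0] no_col[of 0 b] abc(2) m by auto
      \<comment> \<open>Subtracting (p - s) times the element in \<open>m\<close> from its bracket
        leaves 3 s b in the last column, which \<open>no_col\<close> forbids unless s = 0.\<close>
      have middle: "s = 0" if "mat3 p q r 0 s t 0 0 (- p - s) \<in> u" for p q r s t
      proof -
        have "lie_bracket (mat3 p q r 0 s t 0 0 (- p - s)) (mat3 0 a 0 0 0 b 0 0 0) - (p - s) *\<^sub>R mat3 0 a 0 0 0 b 0 0 0 \<in> u"
          using that m by (intro subspace_diff[OF sub] subspace_mul[OF sub] lie3D(4)[OF u])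
        then have "mat3 0 0 (q * b - t * a) 0 0 (3 * s * b) 0 0 0 \<in> u"
          by (simp add: lie_bracket_def algebra_simps)
        then show ?thesis using no_col ab by fastforce
      qed
      obtain h0 where h0: "h0 \<in> u" "h0 \<noteq> 0" "h0 $ 1 $ 3 = 0" "h0 $ 2 $ 3 = 0"
        using lie3_entries_zero[OF u] .
      obtain p q r s t where h0_eq: "h0 = mat3 p q r 0 s t 0 0 (- p - s)"
        using form[OF h0(1)] by blast
      have s: "s = 0" using middle h0(1) h0_eq by blast
      have "p \<noteq> 0"
      proof
        assume "p = 0"
        then have "mat3 0 q 0 0 0 0 0 0 0 \<in> u" "q \<noteq> 0" using h0 s unfolding h0_eq by auto
        then show False using no_row by blast
      qed
      define x where "x = q / p"
      have h: "mat3 1 x 0 0 0 0 0 0 (-1) \<in> u"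
        by (rule scale[of p q 0 0 0 0 0 0 "- p" _ "1 / p"])
          (use h0 \<open>p \<noteq> 0\<close> s in \<open>auto simp: h0_eq x_def\<close>)
      \<comment> \<open>The columns are eigenvectors of the element in \<open>h\<close> for 1, 0,
        -1, scaled so that the element in \<open>m\<close> maps the third to the second and the
        second to the first, modulo the first.\<close>
      let ?M = "mat3 1 (- x / a) 0 0 (1 / a) 0 0 0 (1 / (a * b))"
      have "u \<sim>\<^sub>G \<uu>\<^sub>3 U5"
      proof (rule gl_conj_\<uu>\<^sub>3_intertwine[OF u dim_\<uu>\<^sub>3_special(1)])
        show "det ?M \<noteq> 0" using ab by (simp add: mat3_det)
        fix A assume A: "A \<in> u"
        obtain p q r s t where A_eq: "A = mat3 p q r 0 s t 0 0 (- p - s)"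
          using form[OF A] by blast
        have s: "s = 0" using middle A A_eq by blast
        have "A - p *\<^sub>R mat3 1 x 0 0 0 0 0 0 (-1) - (t / b) *\<^sub>R mat3 0 a 0 0 0 b 0 0 0 \<in> u"
          using A h m by (intro subspace_diff[OF sub] subspace_mul[OF sub])
        then have "mat3 0 (q - p * x - t / b * a) r 0 0 0 0 0 0 \<in> u"
          using ab s by (simp add: A_eq)
        then have q: "q = p * x + t / b * a" using no_row by fastforce
        let ?A' = "mat3 p (t / b) (r / (a * b) + x / a * (t / b)) 0 0 (t / b) 0 0 (- p)"
        have "?A' \<in> \<uu>\<^sub>3 U5" unfolding \<uu>\<^sub>3_U5 by blast
        moreover have "A ** ?M = ?M ** ?A'"
          using ab by (simp add: A_eq q s field_simps)
        ultimately show "\<exists>A'\<in>\<uu>\<^sub>3 U5. A ** ?M = ?M ** A'" by blast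
      qed
      moreover have "admissible U5" by (simp add: admissible_def)
      ultimately show False using nl unfolding listed_def by blast
    qed
  next
    case False
    then have no: "a = 0 \<and> b = 0" if "mat3 0 a c 0 0 b 0 0 0 \<in> u" for a b c
      using that by blast
    obtain h0 where h0: "h0 \<in> u" "h0 \<noteq> 0" "h0 $ 1 $ 3 = 0" "h0 $ 2 $ 2 = 0"
      using lie3_entries_zero[OF u] .
    obtain p q r s t where h0_eq: "h0 = mat3 p q r 0 s t 0 0 (- p - s)"
      using form[OF h0(1)] by blast
    have "p \<noteq> 0"
      using no[of q 0 t] h0 unfolding h0_eq by auto
    define m n where "m = q / p" "n = t / p"
    have h: "mat3 1 m 0 0 0 n 0 0 (-1) \<in> u"
      by (rule scale[of p q 0 0 0 t 0 0 "- p" _ "1 / p"])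
        (use h0 \<open>p \<noteq> 0\<close> in \<open>auto simp: h0_eq m_n_def\<close>)
    \<comment> \<open>Columns: e1, a vector on which the element in \<open>h\<close> acts by -1
      modulo e1, and a kernel vector of it. Listing the lift of e3 before that of e2 turns E13 into
      the E12 of \<open>U6\<close>.\<close>
    let ?M = "mat3 1 0 (- m) 0 (- n) 1 0 1 0"
    have "u \<sim>\<^sub>G \<uu>\<^sub>3 U6"
    proof (rule gl_conj_\<uu>\<^sub>3_intertwine[OF u dim_\<uu>\<^sub>3_special(2)])
      show "det ?M \<noteq> 0" by (simp add: mat3_det)
      fix A assume A: "A \<in> u"
      obtain p q r s t where A_eq: "A = mat3 p q r 0 s t 0 0 (- p - s)"
        using form[OF A] by blast
      \<comment> \<open>This bracket is strictly upper triangular, hence a multiple of E13 by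
        \<open>no\<close>; that determines \<open>q\<close> and \<open>t\<close> from the
        diagonal.\<close>
      have "lie_bracket (mat3 1 m 0 0 0 n 0 0 (-1)) A \<in> u"
        using lie3D(4)[OF u h A] .
      then have "mat3 0 (q + m * s - p * m) (2 * r + m * t - q * n) 0 0 (n * (- p - s) - s * n + t) 0 0 0 \<in> u"
        unfolding A_eq by (simp add: lie_bracket_def algebra_simps)
      then have "q + m * s - p * m = 0 \<and> n * (- p - s) - s * n + t = 0"
        by (rule no)
      then have q: "q = p * m - m * s" and t: "t = s * n - n * (- p - s)"
        by (auto simp: algebra_simps)
      let ?A' = "mat3 p (r - q * n) 0 0 (- p - s) 0 0 0 s"
      have "?A' = mat3 p (r - q * n) 0 0 (- p - s) 0 0 0 (- p - (- p - s))" by simp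
      then have "?A' \<in> \<uu>\<^sub>3 U6" unfolding \<uu>\<^sub>3_U6 by blast
      moreover have "A ** ?M = ?M ** ?A'"
        by (simp add: A_eq q t algebra_simps)
      ultimately show "\<exists>A'\<in>\<uu>\<^sub>3 U6. A ** ?M = ?M ** A'" by blast
    qed
    moreover have "admissible U6" by (simp add: admissible_def)
    ultimately show ?thesis unfolding listed_def by blast
  qed
qed

subsection \<open>Normal forms of nilpotent matrices\<close>

definition cols3 :: "real^3 \<Rightarrow> real^3 \<Rightarrow> real^3 \<Rightarrow> real^3^3" where
  "cols3 a b c = mat3 (a $ 1) (b $ 1) (c $ 1) (a $ 2) (b $ 2) (c $ 2) (a $ 3) (b $ 3) (c $ 3)"

lemma cols3_mult_vec: "cols3 a b c *v x = x $ 1 *\<^sub>R a + x $ 2 *\<^sub>R b + x $ 3 *\<^sub>R c"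
  by (simp add: cols3_def matrix_vector_mult_def vec_eq_iff sum_3 forall_3)

lemma mult_cols3: "A ** cols3 a b c = cols3 (A *v a) (A *v b) (A *v c)"
  by (simp add: cols3_def mat_eq_iff_3 matrix_matrix_mult_def matrix_vector_mult_def sum_3)

lemma cols3_mult:
  "cols3 x y z ** mat3 a b c d e f g h i =
     cols3 (a *\<^sub>R x + d *\<^sub>R y + g *\<^sub>R z) (b *\<^sub>R x + e *\<^sub>R y + h *\<^sub>R z) (c *\<^sub>R x + f *\<^sub>R y + i *\<^sub>R z)"
  by (simp add: cols3_def)

lemma det_cols3_nonzero:
  assumes "\<And>x y z. x *\<^sub>R a + y *\<^sub>R b + z *\<^sub>R c = 0 \<Longrightarrow> x = 0 \<and> y = 0 \<and> z = 0"
  shows "det (cols3 a b c) \<noteq> 0"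
proof -
  have "x = 0" if "cols3 a b c *v x = 0" for x
    using assms[of "x $ 1" "x $ 2" "x $ 3"] that by (simp add: cols3_mult_vec vec_eq_iff forall_3)
  then show ?thesis
    using matrix_left_invertible_ker invertible_left_inverse invertible_det_nz by blast
qed

lemma matrix_eq_zero_axis: "A = 0" if "\<And>k. A *v axis k 1 = 0" for A :: "real^3^3"
proof -
  have "A $ i $ k = 0" for i k
    using that[of k] by (metis column_def matrix_vector_mul_component matrix_vector_mult_basis vec_lambda_beta zero_index)
  then show ?thesis by (simp add: vec_eq_iff)
qed

lemma matrix_eq_zeroI: "A = 0" if "\<And>x. A *v x = 0" for A :: "real^3^3"
  using that matrix_eq_zero_axis by blast

lemma mult_vec_axis_3:
  "A *v x = x $ 1 *\<^sub>R (A *v axis 1 1) + x $ 2 *\<^sub>R (A *v axis 2 1) + x $ 3 *\<^sub>R (A *v axis 3 1)"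
  for A :: "real^3^3"
  by (simp add: vec_eq_iff matrix_vector_mult_def sum_3 axis_def)

text \<open>A Jordan basis: powers of \<open>w\<close> applied to a vector, or for
  \<open>w ** w = 0\<close> an image vector \<open>a\<close>, a further kernel vector
  \<open>b\<close> and a preimage of \<open>a\<close>. With \<open>b\<close> in the middle the
  single entry lands at position 13, whose line has an upper triangular normalizer.\<close>

lemma nilpotent_normal_form:
  fixes w :: "real^3^3"
  assumes "w \<noteq> 0" "w ** w ** w = 0"
  obtains M where "det M \<noteq> 0" "w ** w \<noteq> 0" "w ** M = M ** mat3 0 1 0 0 0 1 0 0 0"
    | M where "det M \<noteq> 0" "w ** w = 0" "w ** M = M ** mat3 0 0 1 0 0 0 0 0 0"
proof (cases "w ** w = 0")
  case False
  then obtain v where v: "w ** w *v v \<noteq> 0"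
    using matrix_eq_zeroI by blast
  have w3: "w *v (w *v (w *v x)) = 0" for x
    using assms(2) by (simp add: matrix_vector_mul_assoc matrix_mul_assoc)
  have w2: "w *v (w *v v) \<noteq> 0"
    using v by (simp add: matrix_vector_mul_assoc)
  let ?M = "cols3 (w *v (w *v v)) (w *v v) v"
  have "det ?M \<noteq> 0"
  proof (rule det_cols3_nonzero)
    fix x y z assume eq: "x *\<^sub>R (w *v (w *v v)) + y *\<^sub>R (w *v v) + z *\<^sub>R v = 0"
    have "w *v (w *v (x *\<^sub>R (w *v (w *v v)) + y *\<^sub>R (w *v v) + z *\<^sub>R v)) = 0"
      using eq by simp
    then have z: "z = 0"
      using w2 w3 by (simp add: matrix_vector_right_distrib matrix_vector_mult_scaleR)
    have "w *v (x *\<^sub>R (w *v (w *v v)) + y *\<^sub>R (w *v v) + z *\<^sub>R v) = 0"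
      using eq by simp
    then have "y = 0"
      using w2 w3 z by (simp add: matrix_vector_right_distrib matrix_vector_mult_scaleR)
    then show "x = 0 \<and> y = 0 \<and> z = 0"
      using eq z w2 by simp
  qed
  moreover have "w ** ?M = ?M ** mat3 0 1 0 0 0 1 0 0 0"
    by (simp add: mult_cols3 cols3_mult w3)
  ultimately show ?thesis
    using that(1) False by blast
next
  case True
  have w2: "w *v (w *v x) = 0" for x
    using True by (simp add: matrix_vector_mul_assoc)
  obtain j where j: "w *v axis j 1 \<noteq> 0"
    using assms(1) matrix_eq_zero_axis by blast
  define a where "a = w *v axis j 1"
  \<comment> \<open>An image vector not proportional to \<open>a\<close> lies in the kernel since
    \<open>w ** w = 0\<close>. Otherwise \<open>w\<close> is a functional times \<open>a\<close>,
    and a nonzero vector killed by it and orthogonal to \<open>a\<close> will do.\<close>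
  obtain b where b: "w *v b = 0" "\<And>c. b \<noteq> c *\<^sub>R a"
  proof (cases "\<forall>k. \<exists>c. w *v axis k 1 = c *\<^sub>R a")
    case False
    then show ?thesis using that w2 by blast
  next
    case True
    then obtain l where l: "\<And>k. w *v axis k 1 = l k *\<^sub>R a" by metis
    have lin: "linear (\<lambda>x :: real^3. x $ 1 * l 1 + x $ 2 * l 2 + x $ 3 * l 3)"
      by (rule linearI) (simp_all add: algebra_simps)
    have dim3: "dim (UNIV :: (real^3) set) = 3" by simp
    obtain b where b: "b \<noteq> 0" "b $ 1 * l 1 + b $ 2 * l 2 + b $ 3 * l 3 = 0" "a \<bullet> b = 0"
      using exists_common_zero[OF subspace_UNIV dim3 lin bounded_linear.linear[OF bounded_linear_inner_right]] by blast
    have "w *v b = (b $ 1 * l 1 + b $ 2 * l 2 + b $ 3 * l 3) *\<^sub>R a"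
      by (subst mult_vec_axis_3) (simp add: l algebra_simps)
    moreover have "b \<noteq> c *\<^sub>R a" for c
      using b(1,3) by (metis inner_eq_zero_iff inner_scaleR_left mult_zero_right)
    ultimately show ?thesis
      using that b(2) by simp
  qed
  let ?M = "cols3 a b (axis j 1)"
  have a: "w *v a = 0" "a \<noteq> 0" using w2 j by (auto simp: a_def)
  have "det ?M \<noteq> 0"
  proof (rule det_cols3_nonzero)
    fix x y z assume eq: "x *\<^sub>R a + y *\<^sub>R b + z *\<^sub>R axis j 1 = 0"
    have "w *v (x *\<^sub>R a + y *\<^sub>R b + z *\<^sub>R axis j 1) = 0"
      using eq by simp
    then have z: "z = 0"
      using a b by (simp add: matrix_vector_right_distrib matrix_vector_mult_scaleR a_def[symmetric])
    have "y = 0"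
    proof (rule ccontr)
      assume "y \<noteq> 0"
      moreover have "y *\<^sub>R b = (- x) *\<^sub>R a" using eq z by (simp add: add_eq_0_iff)
      ultimately have "b = (- x / y) *\<^sub>R a"
        by (metis (no_types) divide_inverse_commute scaleR_one scaleR_scaleR left_inverse)
      then show False using b(2) by blast
    qed
    then show "x = 0 \<and> y = 0 \<and> z = 0"
      using eq z a(2) by simp
  qed
  moreover have "w ** ?M = ?M ** mat3 0 0 1 0 0 0 0 0 0"
    by (simp add: mult_cols3 cols3_mult a(1) b(1) a_def[symmetric])
  ultimately show ?thesis
    using that(2) True by blast
qed

lemma gl_conj_by:
  assumes "det M \<noteq> 0"
  obtains N where "M ** N = mat 1" "N ** M = mat 1" "u \<sim>\<^sub>G (\<lambda>A. N ** A ** M) ` u"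
  using exists_inverse_pair[OF assms] unfolding gl_conj_def by metis

lemma intertwine_conj: "w ** M = M ** K \<Longrightarrow> N ** M = mat 1 \<Longrightarrow> N ** w ** M = (K :: real^3^3)"
  by (metis matrix_mul_assoc matrix_mul_lid)

lemma listed_of_nilpotent_line:
  assumes u: "lie3 u" and w: "w \<in> u" "w \<noteq> 0" "w ** w ** w = 0"
    and norm: "\<And>A. A \<in> u \<Longrightarrow> \<exists>c. lie_bracket A w = c *\<^sub>R w"
  shows "listed u"
proof -
  have conj_norm: "\<exists>v. u \<sim>\<^sub>G v \<and> lie3 v \<and> K \<in> v \<and> (\<forall>B\<in>v. \<exists>c. lie_bracket B K = c *\<^sub>R K)"
    if M: "det M \<noteq> 0" "w ** M = M ** K" for M K
  proof -
    obtain N where N: "M ** N = mat 1" "N ** M = mat 1" "u \<sim>\<^sub>G (\<lambda>A. N ** A ** M) ` u"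
      using gl_conj_by[OF M(1)] .
    have K: "N ** w ** M = K"
      by (rule intertwine_conj[OF M(2) N(2)])
    have "\<exists>c. lie_bracket (N ** A ** M) K = c *\<^sub>R K" if A: "A \<in> u" for A
    proof -
      obtain c where "lie_bracket A w = c *\<^sub>R w" using norm[OF A] by blast
      then have "lie_bracket (N ** A ** M) (N ** w ** M) = N ** (c *\<^sub>R w) ** M"
        by (simp add: lie_bracket_conj[OF N(1)])
      also have "\<dots> = c *\<^sub>R K"
        by (simp add: linear_scale[OF linear_conj] K)
      finally show ?thesis using K by auto
    qed
    moreover have "K \<in> (\<lambda>A. N ** A ** M) ` u" using w(1) K by blast
    ultimately show ?thesis
      using N(3) lie3_conj[OF N(3) u] by blast
  qed
  show ?thesis
  proof (rule nilpotent_normal_form[OF w(2,3)])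
    fix M assume "det M \<noteq> 0" "w ** M = M ** mat3 0 1 0 0 0 1 0 0 0"
    then obtain v where "u \<sim>\<^sub>G v" "lie3 v"
      "\<forall>B\<in>v. \<exists>c. lie_bracket B (mat3 0 1 0 0 0 1 0 0 0) = c *\<^sub>R mat3 0 1 0 0 0 1 0 0 0"
      using conj_norm by blast
    then show "listed u"
      using listed_of_regular listed_conj by blast
  next
    fix M assume "det M \<noteq> 0" "w ** M = M ** mat3 0 0 1 0 0 0 0 0 0"
    then obtain v where v: "u \<sim>\<^sub>G v" "lie3 v" "mat3 0 0 1 0 0 0 0 0 0 \<in> v"
      "\<forall>B\<in>v. \<exists>c. lie_bracket B (mat3 0 0 1 0 0 0 0 0 0) = c *\<^sub>R mat3 0 0 1 0 0 0 0 0 0"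
      using conj_norm by blast
    have "A $ 2 $ 1 = 0 \<and> A $ 3 $ 1 = 0 \<and> A $ 3 $ 2 = 0" if "A \<in> v" for A
    proof -
      obtain a b c d e f g h i where "A = mat3 a b c d e f g h i"
        by (rule mat3_cases)
      then show ?thesis
        using v(4) that by (auto simp: lie_bracket_def)
    qed
    then have "listed v"
      using v(2,3) listed_of_upper by blast
    then show "listed u"
      using v(1) listed_conj by blast
  qed
qed

text \<open>Cayley-Hamilton at trace zero: w^3 = (tr w^2 / 2) w + (det w) 1, where det w = tr w^3 /
  3.\<close>

lemma cube_zero_of_traces:
  fixes w :: "real^3^3"
  assumes "trace w = 0" "trace (w ** w) = 0" "trace (w ** w ** w) = 0"
  shows "w ** w ** w = 0"
proof -
  obtain a b c d e f g h i where w: "w = mat3 a b c d e f g h i"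
    by (rule mat3_cases)
  have i: "i = - a - e" using assms(1) by (simp add: w)
  have "w ** w ** w = (trace (w ** w) / 2) *\<^sub>R w + (trace (w ** w ** w) / 3) *\<^sub>R mat 1"
    by (simp add: w i mat3_one) algebra
  then show ?thesis using assms(2,3) by simp
qed

text \<open>Jacobson's lemma in dimension three: all power traces of the commutator vanish.\<close>

lemma cube_zero_of_bracket:
  fixes z q :: "real^3^3"
  assumes "lie_bracket z q ** q = q ** lie_bracket z q"
  shows "lie_bracket z q ** lie_bracket z q ** lie_bracket z q = 0"
proof (rule cube_zero_of_traces)
  define w where "w = lie_bracket z q"
  have wq: "w ** q = q ** w" using assms by (simp add: w_def)
  \<comment> \<open>By cyclicity tr([z, q] p) = tr(z [q, p]), which vanishes for \<open>p\<close>
    commuting with \<open>q\<close>; it is applied to p = 1, w, w^2.\<close>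
  have tr: "trace (w ** p) = 0" if "p ** q = q ** p" for p
  proof -
    have "trace (w ** p) = trace (z ** (q ** p)) - trace (q ** (z ** p))"
      by (simp add: w_def lie_bracket_def matrix_sub_rdistrib_3 trace_sub matrix_mul_assoc)
    also have "trace (q ** (z ** p)) = trace (z ** (p ** q))"
      by (metis matrix_mul_assoc trace_mul_sym)
    finally show ?thesis using that by simp
  qed
  show "trace (lie_bracket z q) = 0"
    using tr[of "mat 1"] by (simp add: w_def)
  show "trace (lie_bracket z q ** lie_bracket z q) = 0"
    using tr[of w] wq by (simp add: w_def)
  have "(w ** w) ** q = q ** (w ** w)" using wq by (metis matrix_mul_assoc)
  then show "trace (lie_bracket z q ** lie_bracket z q ** lie_bracket z q) = 0"
    using tr[of "w ** w"] by (simp add: w_def matrix_mul_assoc)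
qed

text \<open>Only polynomials commute with a single Jordan block, and trace zero removes the constant
  term.\<close>

lemma centralizer_regular:
  fixes p q :: "real^3^3"
  assumes "p ** p \<noteq> 0" "p ** p ** p = 0" "p ** q = q ** p" "trace q = 0"
  shows "\<exists>b c. q = b *\<^sub>R p + c *\<^sub>R (p ** p)"
proof -
  have "p \<noteq> 0" using assms(1) by auto
  let ?K = "mat3 0 1 0 0 0 1 0 0 0"
  obtain M where M: "det M \<noteq> 0" "p ** M = M ** ?K"
    by (rule nilpotent_normal_form[OF \<open>p \<noteq> 0\<close> assms(2)]) (use assms(1) in blast)+
  obtain N where N: "M ** N = mat 1" "N ** M = mat 1"
    using exists_inverse_pair[OF M(1)] .
  define q' where "q' = N ** q ** M"
  have mult: "N ** X ** M ** (N ** Y ** M) = N ** (X ** Y) ** M" for X Y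
    using N(1) by (metis matrix_mul_assoc matrix_mul_rid)
  have K: "N ** p ** M = ?K" by (rule intertwine_conj[OF M(2) N(2)])
  have "?K ** q' = q' ** ?K"
    unfolding K[symmetric] q'_def mult assms(3) by simp
  moreover have "trace q' = 0"
    unfolding q'_def trace_conj[OF N(1)] by (rule assms(4))
  moreover obtain a b c d e f g h i where q'_eq: "q' = mat3 a b c d e f g h i"
    by (rule mat3_cases)
  ultimately have "q' = b *\<^sub>R ?K + c *\<^sub>R (?K ** ?K)"
    by auto
  also have "\<dots> = N ** (b *\<^sub>R p + c *\<^sub>R (p ** p)) ** M"
    unfolding linear_add[OF linear_conj] linear_scale[OF linear_conj] K[symmetric] mult by simp
  finally have "M ** q' ** N = b *\<^sub>R p + c *\<^sub>R (p ** p)"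
    by (simp add: conj_cancel[OF N(1)])
  moreover have "M ** q' ** N = q"
    by (simp add: q'_def conj_cancel[OF N(1)])
  ultimately show ?thesis by blast
qed

subsection \<open>Solvable algebras are listed\<close>

lemma lie_bracket_bilinear:
  "lie_bracket (A + B) C = lie_bracket A C + lie_bracket B C"
  "lie_bracket C (A + B) = lie_bracket C A + lie_bracket C B"
  "lie_bracket (r *\<^sub>R A) C = r *\<^sub>R lie_bracket A C"
  "lie_bracket C (r *\<^sub>R A) = r *\<^sub>R lie_bracket C A"
  by (simp_all add: lie_bracket_def matrix_add_ldistrib matrix_add_rdistrib_3 scalar_matrix_assoc[symmetric]
      matrix_scalar_ac scaleR_diff_right)

lemma lie_bracket_self [simp]: "lie_bracket A A = 0"
  by (simp add: lie_bracket_def)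

lemma lie_bracket_anticommute: "lie_bracket B A = - lie_bracket A B"
  by (simp add: lie_bracket_def)

lemma lie_bracket_zero_iff: "lie_bracket A B = 0 \<longleftrightarrow> A ** B = B ** A"
  by (simp add: lie_bracket_def)

lemma lie_bracket_jacobi:
  "lie_bracket A (lie_bracket B C) = lie_bracket (lie_bracket A B) C + lie_bracket B (lie_bracket A C)"
  by (simp add: lie_bracket_def matrix_sub_ldistrib_3 matrix_sub_rdistrib_3 matrix_mul_assoc)

lemma cube_zero_of_bracket_eq:
  assumes "lie_bracket z q = w" "lie_bracket q w = 0"
  shows "w ** w ** w = 0"
  using cube_zero_of_bracket[of z q] assms by (simp add: lie_bracket_zero_iff)

lemma derived_algebra_subset:
  assumes "lie3 u" shows "derived_algebra u \<subseteq> u"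
  unfolding derived_algebra_def using lie3D(1,4)[OF assms] by (intro span_minimal) auto

text \<open>Solvability makes the derived algebra proper, so a basis of it extends to one of
  \<open>u\<close> with a vector \<open>z\<close> to spare. The other two span a plane containing
  all brackets, padded arbitrarily when the derived algebra is smaller.\<close>

lemma solvable_flag:
  assumes u: "lie3 u" and "solvable_lie u"
  obtains x y z where "u = span {x, y, z}"
    "\<And>a b c. a *\<^sub>R x + b *\<^sub>R y + c *\<^sub>R z = 0 \<Longrightarrow> a = 0 \<and> b = 0 \<and> c = 0"
    "\<And>A B. A \<in> u \<Longrightarrow> B \<in> u \<Longrightarrow> \<exists>a b. lie_bracket A B = a *\<^sub>R x + b *\<^sub>R y"
proof -
  have neq: "derived_algebra u \<noteq> u"
  proof
    assume "derived_algebra u = u"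
    then have "(derived_algebra ^^ n) u = u" for n by (induction n) auto
    then have "u = {0}" using assms(2) unfolding solvable_lie_def by metis
    then show False using lie3D(2)[OF u] by simp
  qed
  obtain B0 where B0: "B0 \<subseteq> derived_algebra u" "independent B0" "derived_algebra u \<subseteq> span B0"
    using maximal_independent_subset[of "derived_algebra u"] by blast
  obtain B where B: "B0 \<subseteq> B" "B \<subseteq> u" "independent B" "u \<subseteq> span B"
    using maximal_independent_subset_extend[OF _ B0(2), of u] B0(1) derived_algebra_subset[OF u] by blast
  have "card B = 3"
    using B lie3D(2)[OF u] basis_card_eq_dim by metis
  have "span B = u"
    using B lie3D(1)[OF u] by (simp add: span_minimal subset_antisym)
  have "B0 \<noteq> B"
  proof
    assume "B0 = B"
    then have "u \<subseteq> derived_algebra u"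
      using B(4) B0(1) span_minimal[of B0 "derived_algebra u"] unfolding derived_algebra_def by auto
    then show False using neq derived_algebra_subset[OF u] by blast
  qed
  then obtain z where z: "z \<in> B" "z \<notin> B0" using B(1) by blast
  have "card (B - {z}) = 2"
    using \<open>card B = 3\<close> z(1) by simp
  then obtain x y where xy: "B - {z} = {x, y}" "x \<noteq> y"
    by (auto simp: card_2_iff)
  then have B_eq: "B = {x, y, z}" and ne: "x \<noteq> z" "y \<noteq> z" using z(1) by auto
  show ?thesis
  proof
    show "u = span {x, y, z}" using \<open>span B = u\<close> B_eq by simp
  next
    fix a b c assume eq: "a *\<^sub>R x + b *\<^sub>R y + c *\<^sub>R z = 0"
    let ?f = "\<lambda>v. if v = x then a else if v = y then b else c"
    have "finite B" "(\<Sum>v\<in>B. ?f v *\<^sub>R v) = 0"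
      using eq xy(2) ne by (auto simp: B_eq add.assoc)
    then have "\<forall>v\<in>B. ?f v = 0"
      using independentD[OF B(3), of B ?f] by blast
    then show "a = 0 \<and> b = 0 \<and> c = 0"
      using xy(2) ne by (auto simp: B_eq)
  next
    fix A C assume "A \<in> u" "C \<in> u"
    then have "lie_bracket A C \<in> derived_algebra u"
      unfolding derived_algebra_def by (intro span_base) blast
    also have "\<dots> \<subseteq> span B0" by (rule B0(3))
    also have "\<dots> \<subseteq> span {x, y}"
      by (rule span_mono) (use B(1) z xy in blast)
    finally have "\<exists>k l. lie_bracket A C - k *\<^sub>R x - l *\<^sub>R y = 0"
      by (auto simp: span_breakdown_eq)
    then show "\<exists>a b. lie_bracket A C = a *\<^sub>R x + b *\<^sub>R y"
      by (metis add_diff_cancel_left' diff_diff_add eq_iff_diff_eq_0)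
  qed
qed

text \<open>ad A acts on the top exterior power of the plane by its trace \<open>c + f\<close>, and
  w = [x, y] stands for a generator of that power; so the line of w is an ideal.\<close>

lemma listed_of_noncommuting_ideal:
  assumes u: "lie3 u" and xy: "x \<in> u" "y \<in> u" "lie_bracket x y \<noteq> 0"
    and ideal: "\<And>A B. A \<in> u \<Longrightarrow> B \<in> u \<Longrightarrow> \<exists>a b. lie_bracket A B = a *\<^sub>R x + b *\<^sub>R y"
  shows "listed u"
proof -
  define w where "w = lie_bracket x y"
  obtain a b where ab: "w = a *\<^sub>R x + b *\<^sub>R y"
    using ideal[OF xy(1,2)] by (auto simp: w_def)
  have xw: "lie_bracket x w = b *\<^sub>R w" and yw: "lie_bracket y w = (- a) *\<^sub>R w"
    using lie_bracket_anticommute[of y x] by (simp_all add: ab lie_bracket_bilinear) (simp_all add: ab[symmetric] w_def)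
  \<comment> \<open>As [x, w] = b w and [y, w] = - a w with a or b nonzero, \<open>w\<close> is a
    bracket with a multiple of itself, and Jacobson's lemma applies.\<close>
  have "w ** w ** w = 0"
  proof (cases "b = 0")
    case False
    then have "lie_bracket x ((1 / b) *\<^sub>R w) = w" by (simp add: lie_bracket_bilinear xw)
    then show ?thesis by (rule cube_zero_of_bracket_eq) (simp add: lie_bracket_bilinear)
  next
    case True
    then have "a \<noteq> 0" using xy(3) ab by (auto simp: w_def)
    then have "lie_bracket y ((- 1 / a) *\<^sub>R w) = w" by (simp only: lie_bracket_bilinear yw) simp
    then show ?thesis by (rule cube_zero_of_bracket_eq) (simp only: lie_bracket_bilinear lie_bracket_self scaleR_zero_right)
  qed
  moreover have "\<exists>c. lie_bracket A w = c *\<^sub>R w" if A: "A \<in> u" for A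
  proof -
    obtain c d where c: "lie_bracket A x = c *\<^sub>R x + d *\<^sub>R y" using ideal[OF A xy(1)] by blast
    obtain e f where e: "lie_bracket A y = e *\<^sub>R x + f *\<^sub>R y" using ideal[OF A xy(2)] by blast
    have "lie_bracket A w = (c + f) *\<^sub>R w"
      by (simp add: w_def lie_bracket_jacobi[of A x y] c e lie_bracket_bilinear scaleR_left_distrib)
    then show ?thesis by blast
  qed
  ultimately show ?thesis
    using xy lie3D(4)[OF u xy(1,2)] by (intro listed_of_nilpotent_line[OF u, of w]) (auto simp: w_def)
qed

section \<open>Abelian algebras\<close>

text \<open>The commuting two by two blocks span at most a plane, so some element has zero block.\<close>

lemma listed_of_commuting_block:
  assumes u: "lie3 u" and comm: "\<And>A B. A \<in> u \<Longrightarrow> B \<in> u \<Longrightarrow> A ** B = B ** A"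
    and upper: "\<And>A. A \<in> u \<Longrightarrow> A $ 2 $ 1 = 0 \<and> A $ 3 $ 1 = 0"
  shows "listed u"
proof -
  have form: "\<exists>p q r s x y. A = mat3 (- p - s) x y 0 p q 0 r s" if "A \<in> u" for A
  proof -
    have "A $ 1 $ 1 = - A $ 2 $ 2 - A $ 3 $ 3"
      using lie3D(3)[OF u that] by (simp add: trace_3)
    then have "A = mat3 (- A $ 2 $ 2 - A $ 3 $ 3) (A $ 1 $ 2) (A $ 1 $ 3) 0 (A $ 2 $ 2) (A $ 2 $ 3) 0 (A $ 3 $ 2) (A $ 3 $ 3)"
      using upper[OF that] by (simp add: mat_eq_iff_3)
    then show ?thesis by blast
  qed
  have linf: "linear (\<lambda>A :: real^3^3. A $ 2 $ 2 - A $ 3 $ 3)"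
    by (rule linearI) (simp_all add: algebra_simps)
  obtain w where w: "w \<in> u" "w \<noteq> 0" "w $ 2 $ 2 = 0" "w $ 2 $ 3 = 0" "w $ 3 $ 2 = 0" "w $ 3 $ 3 = 0"
  proof (cases "\<forall>A\<in>u. A $ 2 $ 3 = 0 \<and> A $ 3 $ 2 = 0 \<and> A $ 2 $ 2 = A $ 3 $ 3")
    case True
    obtain w where w: "w \<in> u" "w \<noteq> 0" "w $ 2 $ 2 = 0" "w $ 2 $ 2 = 0"
      using lie3_entries_zero[OF u] .
    then show ?thesis using that[of w] bspec[OF True w(1)] by simp
  next
    case False
    then obtain B where B: "B \<in> u" "B $ 2 $ 3 \<noteq> 0 \<or> B $ 3 $ 2 \<noteq> 0 \<or> B $ 2 $ 2 - B $ 3 $ 3 \<noteq> 0"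
      by auto
    \<comment> \<open>Commuting with the nonscalar block of \<open>B\<close> makes the off-diagonal
      entries and the diagonal difference of \<open>A\<close> proportional to those of
      \<open>B\<close>. Killing the one of these three that is nonzero for \<open>B\<close>
      therefore kills all three.\<close>
    have rel: "B $ 2 $ 3 * A $ 3 $ 2 = A $ 2 $ 3 * B $ 3 $ 2"
      "(B $ 2 $ 2 - B $ 3 $ 3) * A $ 2 $ 3 = (A $ 2 $ 2 - A $ 3 $ 3) * B $ 2 $ 3"
      "(B $ 2 $ 2 - B $ 3 $ 3) * A $ 3 $ 2 = (A $ 2 $ 2 - A $ 3 $ 3) * B $ 3 $ 2" if A: "A \<in> u" for A
    proof -
      obtain p q r s x y where B_eq: "B = mat3 (- p - s) x y 0 p q 0 r s" using form[OF B(1)] by blast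
      obtain p' q' r' s' x' y' where A_eq: "A = mat3 (- p' - s') x' y' 0 p' q' 0 r' s'" using form[OF A] by blast
      have eqs: "p' * p + q' * r = p * p' + q * r'" "p' * q + q' * s = p * q' + q * s'" "r' * p + s' * r = r * p' + s * r'"
        using comm[OF A B(1)] unfolding A_eq B_eq mat3_mult mat3_eq_iff by simp_all
      show "B $ 2 $ 3 * A $ 3 $ 2 = A $ 2 $ 3 * B $ 3 $ 2"
        "(B $ 2 $ 2 - B $ 3 $ 3) * A $ 2 $ 3 = (A $ 2 $ 2 - A $ 3 $ 3) * B $ 2 $ 3"
        "(B $ 2 $ 2 - B $ 3 $ 3) * A $ 3 $ 2 = (A $ 2 $ 2 - A $ 3 $ 3) * B $ 3 $ 2"
        using eqs by (simp_all add: A_eq B_eq algebra_simps)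
    qed
    consider "B $ 2 $ 3 \<noteq> 0" | "B $ 3 $ 2 \<noteq> 0" | "B $ 2 $ 2 - B $ 3 $ 3 \<noteq> 0" using B(2) by blast
    then show ?thesis
    proof cases
      case 1
      obtain w where w: "w \<in> u" "w \<noteq> 0" "w $ 2 $ 2 = 0" "w $ 2 $ 3 = 0"
        using lie3_entries_zero[OF u] .
      then show ?thesis using that rel[OF w(1)] 1 by simp
    next
      case 2
      obtain w where w: "w \<in> u" "w \<noteq> 0" "w $ 2 $ 2 = 0" "w $ 3 $ 2 = 0"
        using lie3_entries_zero[OF u] .
      then show ?thesis using that rel[OF w(1)] 2 by simp
    next
      case 3
      obtain w where w: "w \<in> u" "w \<noteq> 0" "w $ 2 $ 2 = 0" "w $ 2 $ 2 - w $ 3 $ 3 = 0"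
        using exists_common_zero[OF lie3D(1,2)[OF u] linear_entry linf] .
      then show ?thesis using that rel[OF w(1)] 3 by simp
    qed
  qed
  obtain p q r s x y where w_eq: "w = mat3 (- p - s) x y 0 p q 0 r s" using form[OF w(1)] by blast
  have "p = 0" "q = 0" "r = 0" "s = 0" using w(3-6) by (simp_all add: w_eq)
  then have "w ** w ** w = 0" by (simp add: w_eq)
  moreover have "\<exists>c. lie_bracket A w = c *\<^sub>R w" if "A \<in> u" for A
    using comm[OF that w(1)] by (intro exI[of _ 0]) (simp add: lie_bracket_def)
  ultimately show ?thesis
    using w(1,2) by (intro listed_of_nilpotent_line[OF u])
qed

lemma exists_frame:
  fixes v :: "real^3"
  assumes "v \<noteq> 0"
  obtains M where "det M \<noteq> 0" "\<And>i. M $ i $ 1 = v $ i"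
proof -
  have "v $ 1 \<noteq> 0 \<or> v $ 2 \<noteq> 0 \<or> v $ 3 \<noteq> 0"
    using assms by (auto simp: vec_eq_iff forall_3)
  then have "det (mat3 (v $ 1) 0 0 (v $ 2) 1 0 (v $ 3) 0 1) \<noteq> 0 \<or>
      det (mat3 (v $ 1) 1 0 (v $ 2) 0 0 (v $ 3) 0 1) \<noteq> 0 \<or>
      det (mat3 (v $ 1) 1 0 (v $ 2) 0 1 (v $ 3) 0 0) \<noteq> 0"
    by (simp add: mat3_det)
  moreover have "\<forall>i. mat3 (v $ 1) b c (v $ 2) e f (v $ 3) h k $ i $ 1 = v $ i" for b c e f h k
    by (simp add: forall_3)
  ultimately show ?thesis
    using that by blast
qed

text \<open>A common eigenvector suffices, since a basis starting with it gives the block shape just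
  treated. If e1 is not one, it comes from the image of a rank-one matrix.\<close>

lemma listed_of_commuting:
  assumes u: "lie3 u" and comm: "\<And>A B. A \<in> u \<Longrightarrow> B \<in> u \<Longrightarrow> A ** B = B ** A"
  shows "listed u"
proof (cases "\<forall>A\<in>u. A $ 2 $ 1 = 0 \<and> A $ 3 $ 1 = 0")
  case True
  then show ?thesis using listed_of_commuting_block[OF u comm] by blast
next
  case False
  then obtain C where C: "C \<in> u" "C $ 2 $ 1 \<noteq> 0 \<or> C $ 3 $ 1 \<noteq> 0" by blast
  obtain w where w: "w \<in> u" "w \<noteq> 0" "w $ 2 $ 1 = 0" "w $ 3 $ 1 = 0"
    using lie3_entries_zero[OF u] .
  \<comment> \<open>\<open>W = w - w\<^sub>1\<^sub>1\<close> kills the independent vectors \<open>e\<^sub>1\<close> and \<open>C e\<^sub>1\<close>, so its image is a line,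
    which is invariant under everything that commutes with \<open>w\<close>.\<close>
  define W where "W = w - (w $ 1 $ 1) *\<^sub>R mat 1"
  have comW: "A ** W = W ** A" if "A \<in> u" for A
    using comm[OF that w(1)] by (simp add: W_def matrix_sub_ldistrib_3 matrix_sub_rdistrib_3
        scalar_matrix_assoc[symmetric] matrix_scalar_ac)
  have W1: "W $ i $ 1 = 0" for i
    by (rule forall_3[THEN iffD2, rule_format]) (simp add: W_def mat_def w)
  have "(W ** C) $ i $ 1 = (C ** W) $ i $ 1" for i
    using comW[OF C(1)] by simp
  then have dep: "W $ i $ 2 * C $ 2 $ 1 + W $ i $ 3 * C $ 3 $ 1 = 0" for i
    by (simp add: matrix_matrix_mult_def sum_3 W1)
  have "W \<noteq> 0"
  proof
    assume "W = 0"
    then have "w = (w $ 1 $ 1) *\<^sub>R mat 1" by (simp add: W_def)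
    then have "trace w = trace ((w $ 1 $ 1) *\<^sub>R (mat 1 :: real^3^3))" by simp
    then have "w $ 1 $ 1 = 0" using lie3D(3)[OF u w(1)] by (simp add: mat3_one)
    then show False using \<open>W = 0\<close> w(2) by (simp add: W_def)
  qed
  \<comment> \<open>\<open>dep\<close> makes the last two columns of \<open>W\<close> proportional;
    \<open>v\<close> is one of them, which \<open>l = 1 \<or> m = 1\<close> records, so
    \<open>v\<close> lies in the image.\<close>
  obtain v l m where v: "v \<noteq> (0 :: real^3)" "\<And>i. W $ i $ 2 = l * v $ i" "\<And>i. W $ i $ 3 = m * v $ i"
    "l = 1 \<or> m = 1"
  proof (cases "C $ 2 $ 1 = 0")
    case True
    then have c3: "C $ 3 $ 1 \<noteq> 0" using C(2) by simp
    have "W $ i $ 3 = 0" for i using dep[of i] True c3 by simp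
    then show ?thesis
      using \<open>W \<noteq> 0\<close> W1 by (intro that[of "\<chi> i. W $ i $ 2" 1 0]) (auto simp: mat_eq_iff_3 vec_eq_iff forall_3)
  next
    case False
    have *: "W $ i $ 2 = (- C $ 3 $ 1 / C $ 2 $ 1) * W $ i $ 3" for i
      using dep[of i] False by (simp add: field_simps)
    show ?thesis
      by (rule that[of "\<chi> i. W $ i $ 3" "- C $ 3 $ 1 / C $ 2 $ 1" 1])
        (use \<open>W \<noteq> 0\<close> W1 * in \<open>auto simp: mat_eq_iff_3 vec_eq_iff forall_3\<close>)
  qed
  \<comment> \<open>With v = W e_j, commutation gives A v = W (A e_j), again on the image
    line.\<close>
  have eig: "\<exists>c. A *v v = c *\<^sub>R v" if A: "A \<in> u" for A
  proof -
    have Wx: "W *v x = (l * x $ 2 + m * x $ 3) *\<^sub>R v" for x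
      by (simp add: vec_eq_iff matrix_vector_mult_def sum_3 W1 v algebra_simps)
    obtain j where j: "W *v axis j 1 = v"
      using v(4) Wx[of "axis 2 1"] Wx[of "axis 3 1"] by (auto simp: axis_def)
    have "A *v v = W *v (A *v axis j 1)"
      using comW[OF A] j by (metis matrix_vector_mul_assoc)
    then show ?thesis using Wx by metis
  qed
  obtain M where M: "det M \<noteq> 0" "\<And>i. M $ i $ 1 = v $ i"
    using exists_frame[OF v(1)] by blast
  obtain N where N: "M ** N = mat 1" "N ** M = mat 1" "u \<sim>\<^sub>G (\<lambda>A. N ** A ** M) ` u"
    using gl_conj_by[OF M(1)] .
  have "listed ((\<lambda>A. N ** A ** M) ` u)"
  proof (rule listed_of_commuting_block)
    show "lie3 ((\<lambda>A. N ** A ** M) ` u)" by (rule lie3_conj[OF N(3) u])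
    have mult: "N ** X ** M ** (N ** Y ** M) = N ** (X ** Y) ** M" for X Y
      using N(1) by (metis matrix_mul_assoc matrix_mul_rid)
    show "A ** B = B ** A" if "A \<in> (\<lambda>A. N ** A ** M) ` u" "B \<in> (\<lambda>A. N ** A ** M) ` u" for A B
      using that comm by (auto simp: mult)
    show "A $ 2 $ 1 = 0 \<and> A $ 3 $ 1 = 0" if A': "A \<in> (\<lambda>A. N ** A ** M) ` u" for A
    proof -
      obtain B where B: "B \<in> u" "A = N ** B ** M" using A' by blast
      obtain c where c: "B *v v = c *\<^sub>R v" using eig[OF B(1)] by blast
      have BM: "(B ** M) $ i $ 1 = c * M $ i $ 1" for i
        using arg_cong[OF c, of "\<lambda>x. x $ i"] by (simp add: matrix_matrix_mult_def matrix_vector_mult_def M(2))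
      have NX: "(N ** X) $ i $ 1 = (\<Sum>k\<in>UNIV. N $ i $ k * X $ k $ 1)" for X i
        by (simp add: matrix_matrix_mult_def)
      have "(N ** (B ** M)) $ i $ 1 = c * (N ** M) $ i $ 1" for i
        by (simp only: NX BM) (simp add: sum_distrib_left mult.left_commute)
      then show ?thesis
        by (simp add: B(2) matrix_mul_assoc N(2) mat_def)
    qed
  qed
  then show ?thesis using N(3) listed_conj by blast
qed

section \<open>Abelian planes of nilpotent matrices\<close>

text \<open>With \<open>x\<close> moved to E13, the vanishing products and the trace leave
  \<open>y\<close> only the entries at 12, 13 and 23, and \<open>y ** y = 0\<close> excludes that
  both 12 and 23 are nonzero. As [A, E13] stays in the plane, every A has the zeros required of a
  row or a column algebra.\<close>

lemma listed_of_square_zero_ideal: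
  assumes u: "lie3 u" and xy: "x \<in> u" "y \<in> u" "x \<noteq> 0" "\<And>c. y \<noteq> c *\<^sub>R x"
    and sq: "x ** x = 0" "y ** y = 0" "x ** y = 0" "y ** x = 0"
    and ideal: "\<And>A. A \<in> u \<Longrightarrow> \<exists>a b. lie_bracket A x = a *\<^sub>R x + b *\<^sub>R y"
  shows "listed u"
proof -
  let ?K = "mat3 0 0 1 0 0 0 0 0 0"
  have "x ** x ** x = 0" using sq(1) by simp
  then obtain M where M: "det M \<noteq> 0" "x ** M = M ** ?K"
    by (rule nilpotent_normal_form[OF xy(3)]) (use sq(1) in blast)+
  obtain N where N: "M ** N = mat 1" "N ** M = mat 1" "u \<sim>\<^sub>G (\<lambda>A. N ** A ** M) ` u"
    using gl_conj_by[OF M(1)] .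
  define v where "v = (\<lambda>A. N ** A ** M) ` u"
  have v: "lie3 v" "u \<sim>\<^sub>G v" using lie3_conj[OF N(3) u] N(3) by (simp_all add: v_def)
  note sub = lie3D(1)[OF v(1)]
  have K: "N ** x ** M = ?K" by (rule intertwine_conj[OF M(2) N(2)])
  define y' where "y' = N ** y ** M"
  have mem: "?K \<in> v" "y' \<in> v"
    using imageI[OF xy(1), of "\<lambda>A. N ** A ** M"] imageI[OF xy(2), of "\<lambda>A. N ** A ** M"]
    by (simp_all only: K v_def y'_def)
  have mult: "N ** X ** M ** (N ** Y ** M) = N ** (X ** Y) ** M" for X Y
    using N(1) by (metis matrix_mul_assoc matrix_mul_rid)
  have prods: "?K ** y' = 0" "y' ** ?K = 0" "y' ** y' = 0"
    unfolding K[symmetric] y'_def mult sq by simp_all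
  have ideal': "\<exists>a b. lie_bracket A ?K = a *\<^sub>R ?K + b *\<^sub>R y'" if A: "A \<in> v" for A
  proof -
    obtain B where B: "B \<in> u" "A = N ** B ** M" using A unfolding v_def by blast
    obtain a b where ab: "lie_bracket B x = a *\<^sub>R x + b *\<^sub>R y" using ideal[OF B(1)] by blast
    have "lie_bracket A ?K = N ** (a *\<^sub>R x + b *\<^sub>R y) ** M"
      unfolding B(2) K[symmetric] lie_bracket_conj[OF N(1)] ab ..
    also have "\<dots> = a *\<^sub>R ?K + b *\<^sub>R y'"
      unfolding linear_add[OF linear_conj] linear_scale[OF linear_conj] K y'_def ..
    finally show ?thesis by blast
  qed
  have ne: "y' \<noteq> c *\<^sub>R ?K" for c
  proof
    assume "y' = c *\<^sub>R ?K"
    then have "y' = N ** (c *\<^sub>R x) ** M"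
      by (simp only: linear_scale[OF linear_conj] K)
    then have "M ** y' ** N = M ** (N ** (c *\<^sub>R x) ** M) ** N"
      by (simp only:)
    then show False using xy(4) by (simp add: y'_def conj_cancel[OF N(1)])
  qed
  obtain a b c d e f g h i where y'_eq: "y' = mat3 a b c d e f g h i" by (rule mat3_cases)
  have "a = 0" "d = 0" "g = 0" "h = 0" "i = 0"
    using prods(1,2) by (simp_all add: y'_eq)
  moreover from this have "e = 0"
    using lie3D(3)[OF v(1) mem(2)] by (simp add: y'_eq)
  ultimately have y': "y' = mat3 0 b c 0 0 f 0 0 0" by (simp add: y'_eq)
  have bf: "b * f = 0" using prods(3) by (simp add: y')
  have "listed v"
  proof (cases "b = 0")
    case False
    then have f: "f = 0" using bf by simp
    show ?thesis
    proof (rule listed_of_row[OF v(1) _ mem(1)])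
      have "(1 / b) *\<^sub>R y' + (- c / b) *\<^sub>R ?K \<in> v"
        by (intro subspace_add[OF sub] subspace_mul[OF sub] mem)
      then show "mat3 0 1 0 0 0 0 0 0 0 \<in> v" using False f by (simp add: y')
      fix A assume "A \<in> v"
      obtain a1 b1 c1 d1 e1 f1 g1 h1 i1 where A: "A = mat3 a1 b1 c1 d1 e1 f1 g1 h1 i1" by (rule mat3_cases)
      show "A $ 2 $ 1 = 0 \<and> A $ 3 $ 1 = 0"
        using ideal'[OF \<open>A \<in> v\<close>] unfolding A y' lie_bracket_def by (simp add: f) blast
    qed
  next
    case True
    then have f: "f \<noteq> 0" using ne[of c] y' by auto
    show ?thesis
    proof (rule listed_of_column[OF v(1) mem(1)])
      have "(1 / f) *\<^sub>R y' + (- c / f) *\<^sub>R ?K \<in> v"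
        by (intro subspace_add[OF sub] subspace_mul[OF sub] mem)
      then show "mat3 0 0 0 0 0 1 0 0 0 \<in> v" using f True by (simp add: y')
      fix A assume "A \<in> v"
      obtain a1 b1 c1 d1 e1 f1 g1 h1 i1 where A: "A = mat3 a1 b1 c1 d1 e1 f1 g1 h1 i1" by (rule mat3_cases)
      show "A $ 3 $ 1 = 0 \<and> A $ 3 $ 2 = 0"
        using ideal'[OF \<open>A \<in> v\<close>] unfolding A y' lie_bracket_def by (simp add: True)
    qed
  qed
  then show ?thesis using v(2) listed_conj by blast
qed

text \<open>If some \<open>p\<close> in the plane has nonzero square, the plane lies in the
  centralizer of a regular nilpotent and is spanned by \<open>p\<close> and its square; the line of
  the square is an ideal since ad A is a derivation. Otherwise polarization makes all products
  vanish.\<close>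

lemma listed_of_nilpotent_ideal:
  assumes u: "lie3 u" and xy: "x \<in> u" "y \<in> u" "x \<noteq> 0" "\<And>c. y \<noteq> c *\<^sub>R x" "lie_bracket x y = 0"
    and nil: "\<And>a b. \<exists>q. \<exists>z\<in>u. lie_bracket z q = a *\<^sub>R x + b *\<^sub>R y \<and> lie_bracket q (a *\<^sub>R x + b *\<^sub>R y) = 0"
    and ideal: "\<And>A B. A \<in> u \<Longrightarrow> B \<in> u \<Longrightarrow> \<exists>a b. lie_bracket A B = a *\<^sub>R x + b *\<^sub>R y"
  shows "listed u"
proof -
  note sub = lie3D(1)[OF u]
  have comm: "x ** y = y ** x" using xy(5) by (simp add: lie_bracket_zero_iff)
  have cube: "(a *\<^sub>R x + b *\<^sub>R y) ** (a *\<^sub>R x + b *\<^sub>R y) ** (a *\<^sub>R x + b *\<^sub>R y) = 0" for a b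
  proof -
    obtain q z where "lie_bracket z q = a *\<^sub>R x + b *\<^sub>R y" "lie_bracket q (a *\<^sub>R x + b *\<^sub>R y) = 0"
      using nil[of a b] by blast
    then show ?thesis by (rule cube_zero_of_bracket_eq)
  qed
  show ?thesis
  proof (cases "\<exists>a b. (a *\<^sub>R x + b *\<^sub>R y) ** (a *\<^sub>R x + b *\<^sub>R y) \<noteq> 0")
    case True
    then obtain a b where ab: "(a *\<^sub>R x + b *\<^sub>R y) ** (a *\<^sub>R x + b *\<^sub>R y) \<noteq> 0" by blast
    define p where "p = a *\<^sub>R x + b *\<^sub>R y"
    have p: "p \<in> u" "p ** p \<noteq> 0" "p ** p ** p = 0"
      unfolding p_def using ab cube[of a b] xy(1,2) sub by (simp_all add: subspace_add subspace_mul)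
    have cent: "\<exists>k l. q = k *\<^sub>R p + l *\<^sub>R (p ** p)" if "q = c *\<^sub>R x + d *\<^sub>R y" for c d q
    proof (rule centralizer_regular[OF p(2,3)])
      have "lie_bracket p q = 0"
        unfolding p_def that by (simp add: lie_bracket_bilinear xy(5) lie_bracket_anticommute[of y x])
      then show "p ** q = q ** p" by (simp add: lie_bracket_zero_iff)
      show "trace q = 0" unfolding that using xy(1,2) sub by (intro lie3D(3)[OF u] subspace_add subspace_mul)
    qed
    obtain k l where x: "x = k *\<^sub>R p + l *\<^sub>R (p ** p)"
      using cent[of x 1 0] unfolding scaleR_one scaleR_zero_left add_0_right by blast
    obtain k' l' where y: "y = k' *\<^sub>R p + l' *\<^sub>R (p ** p)"
      using cent[of y 0 1] unfolding scaleR_one scaleR_zero_left add_0_left by blast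
    \<comment> \<open>\<open>x\<close> and \<open>y\<close> are not both multiples of
      \<open>p\<close>, so one of their expressions can be solved for the square.\<close>
    have pp: "p ** p \<in> u"
    proof (cases "l = 0")
      case False
      then have "p ** p = (1 / l) *\<^sub>R x - (k / l) *\<^sub>R p" by (subst x) (simp add: scaleR_add_right)
      then show ?thesis using xy(1) p(1) sub by (simp add: subspace_diff subspace_mul)
    next
      case True
      have xk: "x = k *\<^sub>R p" by (subst x) (simp add: True)
      then have k: "k \<noteq> 0" using xy(3) by (metis scaleR_zero_left)
      have "l' \<noteq> 0"
      proof
        assume "l' = 0"
        then have "y = k' *\<^sub>R p" using y by simp
        also have "\<dots> = (k' / k) *\<^sub>R k *\<^sub>R p" using k by simp
        finally show False using xy(4) unfolding xk[symmetric] by blast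
      qed
      then have "p ** p = (1 / l') *\<^sub>R y - (k' / l') *\<^sub>R p" by (subst y) (simp add: scaleR_add_right)
      then show ?thesis using xy(2) p(1) sub by (simp add: subspace_diff subspace_mul)
    qed
    show ?thesis
    proof (rule listed_of_nilpotent_line[OF u pp p(2)])
      show "p ** p ** (p ** p) ** (p ** p) = 0"
        using p(3) by (simp add: matrix_mul_assoc)
      fix A assume A: "A \<in> u"
      obtain c d where "lie_bracket A p = c *\<^sub>R x + d *\<^sub>R y"
        using ideal[OF A p(1)] by blast
      then obtain k l where kl: "lie_bracket A p = k *\<^sub>R p + l *\<^sub>R (p ** p)"
        using cent by meson
      have "lie_bracket A (p ** p) = lie_bracket A p ** p + p ** lie_bracket A p"
        by (simp add: lie_bracket_def matrix_sub_ldistrib_3 matrix_sub_rdistrib_3 matrix_mul_assoc)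
      also have "\<dots> = (2 * k) *\<^sub>R (p ** p)"
        using p(3) unfolding kl
        by (simp add: matrix_add_ldistrib matrix_add_rdistrib_3 scalar_matrix_assoc[symmetric] matrix_scalar_ac
            matrix_mul_assoc scaleR_left_distrib[symmetric])
      finally show "\<exists>c. lie_bracket A (p ** p) = c *\<^sub>R (p ** p)" by blast
    qed
  next
    case False
    then have sq: "(a *\<^sub>R x + b *\<^sub>R y) ** (a *\<^sub>R x + b *\<^sub>R y) = 0" for a b by blast
    have x2: "x ** x = 0" and y2: "y ** y = 0" using sq[of 1 0] sq[of 0 1] by simp_all
    have "2 *\<^sub>R (x ** y) = 0"
      using sq[of 1 1] x2 y2 comm by (simp add: matrix_add_ldistrib matrix_add_rdistrib_3 scaleR_2)
    then have "x ** y = 0" by simp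
    then show ?thesis
      using comm ideal[OF _ xy(1)] by (intro listed_of_square_zero_ideal[OF u xy(1-4) x2 y2]) simp_all
  qed
qed

text \<open>When x and y commute, every ad A acts on their plane as a multiple of ad z. The cases
  are rank zero, one and two of ad z there.\<close>

lemma listed_of_solvable:
  assumes u: "lie3 u" and "solvable_lie u"
  shows "listed u"
proof -
  obtain x y z where span: "u = span {x, y, z}"
    and ind: "\<And>a b c. a *\<^sub>R x + b *\<^sub>R y + c *\<^sub>R z = 0 \<Longrightarrow> a = 0 \<and> b = 0 \<and> c = 0"
    and ideal: "\<And>A B. A \<in> u \<Longrightarrow> B \<in> u \<Longrightarrow> \<exists>a b. lie_bracket A B = a *\<^sub>R x + b *\<^sub>R y"
    using solvable_flag[OF assms] by blast
  note sub = lie3D(1)[OF u]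
  have mem: "x \<in> u" "y \<in> u" "z \<in> u" unfolding span by (simp_all add: span_base)
  have memn: "a *\<^sub>R x + b *\<^sub>R y \<in> u" for a b
    using mem sub by (simp add: subspace_add subspace_mul)
  show ?thesis
  proof (cases "lie_bracket x y = 0")
    case False
    then show ?thesis using listed_of_noncommuting_ideal[OF u mem(1,2)] ideal by blast
  next
    case xy: True
    have yx: "lie_bracket y x = 0" using xy lie_bracket_anticommute[of y x] by simp
    have commn: "lie_bracket (a *\<^sub>R x + b *\<^sub>R y) (c *\<^sub>R x + d *\<^sub>R y) = 0" for a b c d
      by (simp add: lie_bracket_bilinear xy yx)
    have elt: "\<exists>a b c. A = a *\<^sub>R x + b *\<^sub>R y + c *\<^sub>R z" if "A \<in> u" for A
      using that unfolding span span_3 by blast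
    have brn: "\<exists>c. \<forall>a b. lie_bracket A (a *\<^sub>R x + b *\<^sub>R y) = c *\<^sub>R lie_bracket z (a *\<^sub>R x + b *\<^sub>R y)" if "A \<in> u" for A
    proof -
      obtain k l c where "A = k *\<^sub>R x + l *\<^sub>R y + c *\<^sub>R z" using elt \<open>A \<in> u\<close> by blast
      then have "lie_bracket A (a *\<^sub>R x + b *\<^sub>R y) = c *\<^sub>R lie_bracket z (a *\<^sub>R x + b *\<^sub>R y)" for a b
        using commn[of k l a b] lie_bracket_bilinear(1)[of "k *\<^sub>R x + l *\<^sub>R y" "c *\<^sub>R z" "a *\<^sub>R x + b *\<^sub>R y"]
          lie_bracket_bilinear(3)[of c z "a *\<^sub>R x + b *\<^sub>R y"] by simp
      then show ?thesis by blast
    qed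
    show ?thesis
    proof (cases "\<exists>a b. (a \<noteq> 0 \<or> b \<noteq> 0) \<and> lie_bracket z (a *\<^sub>R x + b *\<^sub>R y) = 0")
      case True
      then obtain a b where ab: "a \<noteq> 0 \<or> b \<noteq> 0" "lie_bracket z (a *\<^sub>R x + b *\<^sub>R y) = 0" by blast
      show ?thesis
      proof (cases "lie_bracket z x = 0 \<and> lie_bracket z y = 0")
        case True
        then have zn: "lie_bracket z (c *\<^sub>R x + d *\<^sub>R y) = 0" for c d
          by (simp add: lie_bracket_bilinear)
        have "lie_bracket A B = 0" if A: "A \<in> u" and B: "B \<in> u" for A B
        proof -
          obtain c d e where B_eq: "B = c *\<^sub>R x + d *\<^sub>R y + e *\<^sub>R z" using elt B by blast
          obtain c' d' e' where A_eq: "A = c' *\<^sub>R x + d' *\<^sub>R y + e' *\<^sub>R z" using elt A by blast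
          have zz: "lie_bracket z x = 0" "lie_bracket z y = 0" "lie_bracket x z = 0" "lie_bracket y z = 0"
            using True lie_bracket_anticommute[of z x] lie_bracket_anticommute[of z y] by simp_all
          show ?thesis
            unfolding A_eq B_eq by (simp add: lie_bracket_bilinear xy yx zz)
        qed
        then show ?thesis
          using listed_of_commuting[OF u] by (simp add: lie_bracket_zero_iff)
      next
        case False
        \<comment> \<open>\<open>ad z\<close> has rank one on \<open>\<langle>x, y\<rangle>\<close>; any nonzero value of it spans an ideal.\<close>
        obtain c d where cd: "lie_bracket z (c *\<^sub>R x + d *\<^sub>R y) \<noteq> 0"
        proof (cases "lie_bracket z x = 0")
          case True
          then show ?thesis using False that[of 0 1] by simp
        next
          case nz: False
          then show ?thesis using that[of 1 0] by simp
        qed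
        define w where "w = lie_bracket z (c *\<^sub>R x + d *\<^sub>R y)"
        obtain k l where w: "w = k *\<^sub>R x + l *\<^sub>R y"
          unfolding w_def using ideal[OF mem(3) memn] by blast
        have rel: "a *\<^sub>R lie_bracket z x = - (b *\<^sub>R lie_bracket z y)"
          using ab(2) by (simp add: lie_bracket_bilinear add_eq_0_iff2)
        obtain v where v: "\<exists>s. lie_bracket z x = s *\<^sub>R v" "\<exists>t. lie_bracket z y = t *\<^sub>R v"
        proof (cases "a = 0")
          case True
          then have "lie_bracket z y = 0" using rel ab(1) by simp
          then show ?thesis by (intro that[of "lie_bracket z x"]) (auto intro: exI[of _ 0] exI[of _ 1])
        next
          case False
          have "lie_bracket z x = (1 / a) *\<^sub>R (a *\<^sub>R lie_bracket z x)"
            using False by simp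
          also have "\<dots> = (- b / a) *\<^sub>R lie_bracket z y"
            unfolding rel by simp
          finally have "\<exists>s. lie_bracket z x = s *\<^sub>R lie_bracket z y" by blast
          moreover have "\<exists>t. lie_bracket z y = t *\<^sub>R lie_bracket z y"
            by (rule exI[of _ 1]) simp
          ultimately show ?thesis by (rule that)
        qed
        obtain s t where st: "lie_bracket z x = s *\<^sub>R v" "lie_bracket z y = t *\<^sub>R v"
          using v by blast
        have zn: "lie_bracket z (e *\<^sub>R x + f *\<^sub>R y) = (e * s + f * t) *\<^sub>R v" for e f
          by (simp add: lie_bracket_bilinear st scaleR_left_distrib)
        have "c * s + d * t \<noteq> 0" using cd zn by auto
        then have "v = (1 / (c * s + d * t)) *\<^sub>R w" by (simp add: w_def zn)
        moreover have "lie_bracket z w = (k * s + l * t) *\<^sub>R v"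
          unfolding w by (rule zn)
        ultimately have "lie_bracket z w = ((k * s + l * t) * (1 / (c * s + d * t))) *\<^sub>R w"
          by (metis scaleR_scaleR)
        then obtain r where zw: "lie_bracket z w = r *\<^sub>R w" by blast
        show ?thesis
        proof (rule listed_of_nilpotent_line[OF u, of w])
          show "w \<in> u" using memn by (simp add: w)
          show "w \<noteq> 0" using cd by (simp add: w_def)
          show "w ** w ** w = 0"
            by (rule cube_zero_of_bracket_eq[OF w_def[symmetric]]) (simp only: w commn)
          fix A assume "A \<in> u"
          then obtain e where "lie_bracket A w = e *\<^sub>R lie_bracket z w"
            using brn unfolding w by blast
          then have "lie_bracket A w = (e * r) *\<^sub>R w" by (simp add: zw)
          then show "\<exists>r. lie_bracket A w = r *\<^sub>R w" by blast
        qed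
      qed
    next
      case False
      \<comment> \<open>\<open>ad z\<close> is invertible on \<open>\<langle>x, y\<rangle>\<close>, so Jacobson's lemma makes all of it nilpotent.\<close>
      then have inj: "a = 0 \<and> b = 0" if "lie_bracket z (a *\<^sub>R x + b *\<^sub>R y) = 0" for a b
        using that by blast
      obtain p q where pq: "lie_bracket z x = p *\<^sub>R x + q *\<^sub>R y" using ideal[OF mem(3,1)] by blast
      obtain r s where rs: "lie_bracket z y = r *\<^sub>R x + s *\<^sub>R y" using ideal[OF mem(3,2)] by blast
      have zn: "lie_bracket z (a *\<^sub>R x + b *\<^sub>R y) = (a * p + b * r) *\<^sub>R x + (a * q + b * s) *\<^sub>R y" for a b
        by (simp add: lie_bracket_bilinear pq rs algebra_simps)
      define D where "D = p * s - q * r"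
      have D: "D \<noteq> 0"
      proof
        assume "D = 0"
        then have "lie_bracket z (s *\<^sub>R x + (- q) *\<^sub>R y) = 0" "lie_bracket z (r *\<^sub>R x + (- p) *\<^sub>R y) = 0"
          unfolding zn by (simp_all add: D_def algebra_simps)
        then have "q = 0" "p = 0" using inj[of s "- q"] inj[of r "- p"] by simp_all
        then have "lie_bracket z (1 *\<^sub>R x + 0 *\<^sub>R y) = 0" using pq by simp
        then show False using inj[of 1 0] by simp
      qed
      show ?thesis
      proof (rule listed_of_nilpotent_ideal[OF u mem(1,2) _ _ xy])
        show "x \<noteq> 0" using ind[of 1 0 0] by auto
        show "y \<noteq> c *\<^sub>R x" for c using ind[of "- c" 1 0] by auto
        fix a b
        \<comment> \<open>The preimage of a x + b y under ad z, by Cramer's rule.\<close>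
        let ?q = "((a * s - b * r) / D) *\<^sub>R x + ((b * p - a * q) / D) *\<^sub>R y"
        have "(a * s - b * r) / D * p + (b * p - a * q) / D * r = a"
          "(a * s - b * r) / D * q + (b * p - a * q) / D * s = b"
          using D by (simp_all add: field_simps) (simp_all add: D_def algebra_simps)
        then have "lie_bracket z ?q = a *\<^sub>R x + b *\<^sub>R y" unfolding zn by simp
        then show "\<exists>q. \<exists>z\<in>u. lie_bracket z q = a *\<^sub>R x + b *\<^sub>R y \<and> lie_bracket q (a *\<^sub>R x + b *\<^sub>R y) = 0"
          using mem(3) commn by blast
      qed (use ideal in blast)
    qed
  qed
qed

subsection \<open>The listed algebras are solvable\<close>

text \<open>The blocks are multiples of one matrix and the corners are numbers, so both cancel in
  the bracket.\<close>

lemma row_algebra_bracket: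
  assumes "A \<in> row_algebra p q r s" "B \<in> row_algebra p q r s"
  shows "\<exists>x y. lie_bracket A B = mat3 0 x y 0 0 0 0 0 0"
proof -
  obtain x y z where A: "A = mat3 (- z * (p + s)) x y 0 (z * p) (z * q) 0 (z * r) (z * s)"
    using assms(1) unfolding row_algebra_def by blast
  obtain x' y' z' where B: "B = mat3 (- z' * (p + s)) x' y' 0 (z' * p) (z' * q) 0 (z' * r) (z' * s)"
    using assms(2) unfolding row_algebra_def by blast
  show ?thesis
    unfolding A B lie_bracket_def mat3_mult mat3_diff mat3_eq_iff
    by (intro exI conjI) (rule refl | simp add: algebra_simps)+
qed

lemma lie3_row_algebra:
  assumes "p \<noteq> 0 \<or> q \<noteq> 0 \<or> r \<noteq> 0 \<or> s \<noteq> 0"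
  shows "lie3 (row_algebra p q r s)"
proof -
  have "lie_bracket A B \<in> row_algebra p q r s"
    if AB: "A \<in> row_algebra p q r s" "B \<in> row_algebra p q r s" for A B
  proof -
    obtain x y where "lie_bracket A B = mat3 0 x y 0 0 0 0 0 0"
      using row_algebra_bracket[OF AB] by blast
    then show ?thesis using row_algebraI[of 0 0 p s 0 0 q 0 r 0 x y] by simp
  qed
  moreover have "row_algebra p q r s \<subseteq> sl3"
    unfolding row_algebra_def by (auto simp: algebra_simps)
  ultimately show ?thesis
    unfolding lie3_def lie_subalgebra_sl3_def using dim_row_algebra[OF assms] subspace_row_algebra by blast
qed

lemma solvable_of_metabelian:
  assumes "\<And>A B C D. A \<in> u \<Longrightarrow> B \<in> u \<Longrightarrow> C \<in> u \<Longrightarrow> D \<in> u \<Longrightarrow>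
    lie_bracket (lie_bracket A B) (lie_bracket C D) = 0"
  shows "solvable_lie u"
proof -
  let ?S = "{lie_bracket A B | A B. A \<in> u \<and> B \<in> u}"
  have zero: "lie_bracket A 0 = 0" "lie_bracket 0 A = 0" for A by (simp_all add: lie_bracket_def)
  have *: "lie_bracket X Y = 0" if X: "X \<in> ?S" and Y: "Y \<in> span ?S" for X Y
    using Y
  proof (induction rule: span_induct_alt)
    case (step c Z W)
    then show ?case using X assms by (auto simp: lie_bracket_bilinear)
  qed (simp add: zero)
  have "lie_bracket X Y = 0" if X: "X \<in> span ?S" and Y: "Y \<in> span ?S" for X Y
    using X
  proof (induction rule: span_induct_alt)
    case (step c Z W)
    then show ?case using *[OF _ Y] by (simp add: lie_bracket_bilinear)
  qed (simp add: zero)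
  then have "{lie_bracket A B | A B. A \<in> derived_algebra u \<and> B \<in> derived_algebra u} \<subseteq> {0}"
    unfolding derived_algebra_def by blast
  then have "derived_algebra (derived_algebra u) \<subseteq> span {0}"
    unfolding derived_algebra_def[of "derived_algebra u"] by (rule span_mono)
  moreover have "0 \<in> derived_algebra (derived_algebra u)"
    unfolding derived_algebra_def[of "derived_algebra u"] by (rule span_zero)
  ultimately have "(derived_algebra ^^ 2) u = {0}"
    by (auto simp: numeral_2_eq_2)
  then show ?thesis unfolding solvable_lie_def by blast
qed

lemma derived_algebra_image:
  assumes "linear f" "\<And>A B. lie_bracket (f A) (f B) = f (lie_bracket A B)"
  shows "derived_algebra (f ` u) = f ` derived_algebra u"
proof -
  have "{lie_bracket A B | A B. A \<in> f ` u \<and> B \<in> f ` u} = f ` {lie_bracket A B | A B. A \<in> u \<and> B \<in> u}"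
    by (force simp: assms(2))
  then show ?thesis
    unfolding derived_algebra_def by (simp add: linear_span_image[OF assms(1)])
qed

lemma solvable_lie_image:
  assumes "linear f" "\<And>A B. lie_bracket (f A) (f B) = f (lie_bracket A B)" "solvable_lie u"
  shows "solvable_lie (f ` u)"
proof -
  obtain n where "(derived_algebra ^^ n) u = {0}"
    using assms(3) unfolding solvable_lie_def by blast
  moreover have "(derived_algebra ^^ n) (f ` u) = f ` (derived_algebra ^^ n) u" for n
    by (induction n) (simp_all add: derived_algebra_image[OF assms(1,2)])
  ultimately have "(derived_algebra ^^ n) (f ` u) = {0}"
    using linear_0[OF assms(1)] by simp
  then show ?thesis unfolding solvable_lie_def by blast
qed

lemma solvable_lie_conj:
  assumes "u \<sim>\<^sub>G v" "solvable_lie u" shows "solvable_lie v"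
  using assms solvable_lie_image[OF linear_conj] lie_bracket_conj unfolding gl_conj_def by metis

text \<open>Minus transposition preserves brackets, and on a subspace it has the same image as
  transposition.\<close>

lemma solvable_lie_transpose:
  assumes "subspace u" "solvable_lie u" shows "solvable_lie (transpose ` u)"
proof -
  have lin: "linear (\<lambda>A :: real^3^3. - transpose A)"
    by (rule linearI) (simp_all add: mat_eq_iff_3 transpose_def)
  have "lie_bracket (- transpose A) (- transpose B) = - transpose (lie_bracket A B)" for A B
    using lie_bracket_transpose[of A B] lie_bracket_bilinear(3)[where r = "-1"] lie_bracket_bilinear(4)[where r = "-1"]
    by simp
  then have "solvable_lie ((\<lambda>A. - transpose A) ` u)"
    by (rule solvable_lie_image[OF lin _ assms(2)])
  moreover have "(\<lambda>A. - transpose A) ` u = transpose ` u"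
  proof -
    have "transpose (- A) = - transpose A" for A :: "real^3^3"
      by (simp add: mat_eq_iff_3 transpose_def)
    moreover have "u = uminus ` u"
      using subspace_neg[OF assms(1)] by (metis (no_types, lifting) image_subset_iff minus_minus subsetI subset_antisym image_eqI)
    ultimately show ?thesis by (metis (no_types, lifting) image_cong image_image)
  qed
  ultimately show ?thesis by simp
qed

fun is_row :: "label \<Rightarrow> bool" where
  "is_row U1 = True" | "is_row U3 = True" | "is_row (U7 a) = True" | "is_row (U8 t) = True"
| "is_row U11 = True" | "is_row U12 = True" | "is_row k = False"

text \<open>The values of \<open>block\<close>, \<open>block_trace\<close> and \<open>block_disc\<close> mean nothing unless \<open>is_row k\<close>.\<close>

fun block :: "label \<Rightarrow> real \<times> real \<times> real \<times> real" where
  "block U1 = (-1, 0, 0, -1)" | "block U3 = (-1, 1, 0, -1)" | "block (U7 a) = (1, 0, 0, -a)"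
| "block (U8 t) = (-1/2, -t, t, -1/2)" | "block U11 = (1, 0, 0, -1)" | "block k = (0, 1, -1, 0)"

lemma is_row_block:
  assumes "is_row k" "block k = (p, q, r, s)"
  shows "\<uu>\<^sub>3 k = row_algebra p q r s"
  using assms by (cases k) (simp_all add: \<uu>\<^sub>3_row_algebra del: \<uu>\<^sub>3.simps, auto)

lemma label_trichotomy: "is_row k \<or> is_row (dual k) \<or> k = U5 \<or> k = U6 \<or> k = U15"
  by (cases k) auto

lemma block_not_nilpotent:
  assumes "admissible k" "is_row k" "block k = (p, q, r, s)"
  shows "p + s \<noteq> 0 \<or> p * s - q * r \<noteq> 0"
  using assms by (cases k) (auto simp: admissible_def)

lemma \<uu>\<^sub>3_conj_transpose_dual: "\<uu>\<^sub>3 k \<sim>\<^sub>G transpose ` \<uu>\<^sub>3 (dual k)"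
  using gl_conj_sym[OF transpose_\<uu>\<^sub>3[of "dual k"]] by simp

lemma lie3_solvable_\<uu>\<^sub>3:
  assumes "admissible k"
  shows "lie3 (\<uu>\<^sub>3 k) \<and> solvable_lie (\<uu>\<^sub>3 k)"
proof -
  have row: "lie3 (\<uu>\<^sub>3 k) \<and> solvable_lie (\<uu>\<^sub>3 k)" if "admissible k" "is_row k" for k
  proof -
    obtain p q r s where b: "block k = (p, q, r, s)" by (cases "block k")
    note eq = is_row_block[OF that(2) b]
    have "p \<noteq> 0 \<or> q \<noteq> 0 \<or> r \<noteq> 0 \<or> s \<noteq> 0" using block_not_nilpotent[OF that b] by auto
    then have "lie3 (\<uu>\<^sub>3 k)" unfolding eq by (rule lie3_row_algebra)
    moreover have "solvable_lie (\<uu>\<^sub>3 k)" unfolding eq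
    proof (rule solvable_of_metabelian)
      fix A B C D assume "A \<in> row_algebra p q r s" "B \<in> row_algebra p q r s" "C \<in> row_algebra p q r s" "D \<in> row_algebra p q r s"
      then obtain x y x' y' where "lie_bracket A B = mat3 0 x y 0 0 0 0 0 0" "lie_bracket C D = mat3 0 x' y' 0 0 0 0 0 0"
        using row_algebra_bracket by meson
      then show "lie_bracket (lie_bracket A B) (lie_bracket C D) = 0"
        by (simp add: lie_bracket_def)
    qed
    ultimately show ?thesis by blast
  qed
  have special: "lie3 (\<uu>\<^sub>3 k) \<and> solvable_lie (\<uu>\<^sub>3 k)"
    if br: "\<And>A B. A \<in> \<uu>\<^sub>3 k \<Longrightarrow> B \<in> \<uu>\<^sub>3 k \<Longrightarrow> lie_bracket A B \<in> \<uu>\<^sub>3 k \<and> lie_bracket A B \<in> S"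
      and S: "\<And>A B. A \<in> S \<Longrightarrow> B \<in> S \<Longrightarrow> lie_bracket A B = 0"
      and tr: "\<uu>\<^sub>3 k \<subseteq> sl3" and dim: "dim (\<uu>\<^sub>3 k) = 3" for k S
    using that subspace_\<uu>\<^sub>3[of k] unfolding lie3_def lie_subalgebra_sl3_def
    by (auto intro!: solvable_of_metabelian)
  have "lie3 (\<uu>\<^sub>3 U5) \<and> solvable_lie (\<uu>\<^sub>3 U5)"
  proof (rule special[where S = "{mat3 0 x y 0 0 x 0 0 0 | x y. True}"])
    fix A B assume "A \<in> \<uu>\<^sub>3 U5" "B \<in> \<uu>\<^sub>3 U5"
    then obtain x y z x' y' z' where "A = mat3 z x y 0 0 x 0 0 (- z)" "B = mat3 z' x' y' 0 0 x' 0 0 (- z')"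
      unfolding \<uu>\<^sub>3_U5 by blast
    then have eq: "lie_bracket A B = mat3 0 (z * x' - z' * x) (2 * (z * y' - z' * y)) 0 0 (z * x' - z' * x) 0 0 (- 0)"
      by (simp add: lie_bracket_def algebra_simps)
    then show "lie_bracket A B \<in> \<uu>\<^sub>3 U5 \<and> lie_bracket A B \<in> {mat3 0 x y 0 0 x 0 0 0 | x y. True}"
      unfolding \<uu>\<^sub>3_U5 by auto
  qed (use dim_\<uu>\<^sub>3_special in \<open>auto simp: \<uu>\<^sub>3_U5 lie_bracket_def simp del: \<uu>\<^sub>3.simps\<close>)
  moreover have "lie3 (\<uu>\<^sub>3 U6) \<and> solvable_lie (\<uu>\<^sub>3 U6)"
  proof (rule special[where S = "{mat3 0 x 0 0 0 0 0 0 0 | x. True}"])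
    fix A B assume "A \<in> \<uu>\<^sub>3 U6" "B \<in> \<uu>\<^sub>3 U6"
    then obtain x y z x' y' z' where "A = mat3 y x 0 0 z 0 0 0 (- y - z)" "B = mat3 y' x' 0 0 z' 0 0 0 (- y' - z')"
      unfolding \<uu>\<^sub>3_U6 by blast
    then have eq: "lie_bracket A B = mat3 0 (y * x' + x * z' - y' * x - x' * z) 0 0 0 0 0 0 (- 0 - 0)"
      by (simp add: lie_bracket_def algebra_simps)
    then show "lie_bracket A B \<in> \<uu>\<^sub>3 U6 \<and> lie_bracket A B \<in> {mat3 0 x 0 0 0 0 0 0 0 | x. True}"
      unfolding \<uu>\<^sub>3_U6 by auto
  qed (use dim_\<uu>\<^sub>3_special in \<open>auto simp: \<uu>\<^sub>3_U6 lie_bracket_def simp del: \<uu>\<^sub>3.simps\<close>)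
  moreover have "lie3 (\<uu>\<^sub>3 U15) \<and> solvable_lie (\<uu>\<^sub>3 U15)"
  proof (rule special[where S = "{mat3 0 0 x 0 0 0 0 0 0 | x. True}"])
    fix A B assume "A \<in> \<uu>\<^sub>3 U15" "B \<in> \<uu>\<^sub>3 U15"
    then obtain x y z x' y' z' where "A = mat3 0 x z 0 0 y 0 0 0" "B = mat3 0 x' z' 0 0 y' 0 0 0"
      unfolding \<uu>\<^sub>3_U15 by blast
    then have eq: "lie_bracket A B = mat3 0 0 (x * y' - x' * y) 0 0 0 0 0 0"
      by (simp add: lie_bracket_def algebra_simps)
    then show "lie_bracket A B \<in> \<uu>\<^sub>3 U15 \<and> lie_bracket A B \<in> {mat3 0 0 x 0 0 0 0 0 0 | x. True}"
      unfolding \<uu>\<^sub>3_U15 by auto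
  qed (use dim_\<uu>\<^sub>3_special in \<open>auto simp: \<uu>\<^sub>3_U15 lie_bracket_def simp del: \<uu>\<^sub>3.simps\<close>)
  moreover have "lie3 (\<uu>\<^sub>3 k) \<and> solvable_lie (\<uu>\<^sub>3 k)" if "is_row (dual k)"
  proof -
    have "lie3 (\<uu>\<^sub>3 (dual k))" "solvable_lie (\<uu>\<^sub>3 (dual k))" using row that assms by simp_all
    then have "lie3 (transpose ` \<uu>\<^sub>3 (dual k))" "solvable_lie (transpose ` \<uu>\<^sub>3 (dual k))"
      using lie3_transpose solvable_lie_transpose subspace_\<uu>\<^sub>3 by blast+
    then show ?thesis
      using gl_conj_sym[OF \<uu>\<^sub>3_conj_transpose_dual] lie3_conj solvable_lie_conj by blast
  qed
  ultimately show ?thesis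
    using row[OF assms] label_trichotomy[of k] by metis
qed

subsection \<open>Conjugacy invariants\<close>

definition all_nilpotent :: "(real^3^3) set \<Rightarrow> bool" where
  "all_nilpotent u \<longleftrightarrow> (\<forall>A\<in>u. A ** A ** A = 0)"

text \<open>Not stable under transposition: first rows all map into the line of e1, whereas matrices
  supported in one column share a kernel but not an image. It is therefore tested on an algebra and
  on its dual.\<close>

definition nilpotent_image_line :: "(real^3^3) set \<Rightarrow> bool" where
  "nilpotent_image_line u \<longleftrightarrow> (\<exists>v. \<forall>A\<in>u. A ** A ** A = 0 \<longrightarrow> (\<forall>x. \<exists>c. A *v x = c *\<^sub>R v))"

lemma cube_conj:
  fixes P Q :: "real^3^3"
  assumes "P ** Q = mat 1" "Q ** P = mat 1"
  shows "(P ** A ** Q) ** (P ** A ** Q) ** (P ** A ** Q) = 0 \<longleftrightarrow> A ** A ** A = 0"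
proof -
  have mult: "P ** X ** Q ** (P ** Y ** Q) = P ** (X ** Y) ** Q" for X Y
    using assms(2) by (metis matrix_mul_assoc matrix_mul_rid)
  have "(P ** A ** Q) ** (P ** A ** Q) ** (P ** A ** Q) = P ** (A ** A ** A) ** Q"
    unfolding mult ..
  moreover have "P ** X ** Q = 0 \<longleftrightarrow> X = 0" for X
  proof
    assume "P ** X ** Q = 0"
    then have "Q ** (P ** X ** Q) ** P = 0" by simp
    then show "X = 0" by (simp add: conj_cancel[OF assms(2)])
  qed simp
  ultimately show ?thesis by simp
qed

lemma all_nilpotent_conj:
  assumes "u \<sim>\<^sub>G v" shows "all_nilpotent u \<longleftrightarrow> all_nilpotent v"
proof -
  obtain P Q where PQ: "P ** Q = mat 1" "Q ** P = mat 1" "v = (\<lambda>A. P ** A ** Q) ` u"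
    using assms(1) unfolding gl_conj_def by blast
  then show ?thesis
    unfolding all_nilpotent_def by (simp only: cube_conj[OF PQ(1,2)] ball_simps)
qed

lemma nilpotent_image_line_conj:
  assumes "u \<sim>\<^sub>G v" shows "nilpotent_image_line u \<longleftrightarrow> nilpotent_image_line v"
proof -
  have imp: "nilpotent_image_line v" if uv: "nilpotent_image_line u" "u \<sim>\<^sub>G v" for u v
  proof -
    obtain P Q where PQ: "P ** Q = mat 1" "Q ** P = mat 1" "v = (\<lambda>A. P ** A ** Q) ` u"
      using uv(2) unfolding gl_conj_def by blast
    obtain l where l: "\<And>A x. A \<in> u \<Longrightarrow> A ** A ** A = 0 \<Longrightarrow> \<exists>c. A *v x = c *\<^sub>R l"
      using uv(1) unfolding nilpotent_image_line_def by blast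
    have "\<exists>c. B *v x = c *\<^sub>R (P *v l)" if B: "B \<in> v" "B ** B ** B = 0" for B x
    proof -
      obtain A where A: "A \<in> u" "B = P ** A ** Q" using B(1) PQ(3) by blast
      then obtain c where "A *v (Q *v x) = c *\<^sub>R l"
        using l[of A "Q *v x"] B(2) cube_conj[OF PQ(1,2)] by auto
      then have "B *v x = c *\<^sub>R (P *v l)"
        unfolding A(2) by (simp add: matrix_vector_mul_assoc[symmetric] matrix_vector_mult_scaleR)
      then show ?thesis by blast
    qed
    then show ?thesis unfolding nilpotent_image_line_def by blast
  qed
  show ?thesis using imp[of u v] imp[of v u] assms gl_conj_sym by blast
qed

text \<open>All columns of both nilpotents are multiples of one vector, so a minor formed by one
  column of each vanishes. Explicit nilpotents can thus refute the property.\<close>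

lemma nilpotent_image_line_minor:
  assumes "nilpotent_image_line u" "A \<in> u" "B \<in> u" "A ** A ** A = 0" "B ** B ** B = 0"
  shows "A $ i $ k * B $ j $ l = A $ j $ k * B $ i $ l"
proof -
  obtain v where v: "\<And>A x. A \<in> u \<Longrightarrow> A ** A ** A = 0 \<Longrightarrow> \<exists>c. A *v x = c *\<^sub>R v"
    using assms(1) unfolding nilpotent_image_line_def by blast
  obtain a where a': "A *v axis k 1 = a *\<^sub>R v" using v assms(2,4) by blast
  have a: "A $ i $ k = a * v $ i" for i
    using arg_cong[OF a', of "\<lambda>x. x $ i"] by (simp add: matrix_vector_mult_basis column_def)
  obtain b where b': "B *v axis l 1 = b *\<^sub>R v" using v assms(3,5) by blast
  have b: "B $ i $ l = b * v $ i" for i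
    using arg_cong[OF b', of "\<lambda>x. x $ i"] by (simp add: matrix_vector_mult_basis column_def)
  show ?thesis by (simp add: a b)
qed

text \<open>For nonzero z the cube of the corner forces a trace-free block; by Cayley-Hamilton its
  cube is minus its determinant times itself, which is then nonzero.\<close>

lemma row_algebra_nilpotent:
  assumes "p + s \<noteq> 0 \<or> p * s - q * r \<noteq> 0" "A \<in> row_algebra p q r s" "A ** A ** A = 0"
  shows "\<exists>x y. A = mat3 0 x y 0 0 0 0 0 0"
proof -
  obtain x y z where A: "A = mat3 (- z * (p + s)) x y 0 (z * p) (z * q) 0 (z * r) (z * s)"
    using assms(2) unfolding row_algebra_def by blast
  have "z = 0"
  proof (rule ccontr)
    assume z: "z \<noteq> 0"
    have "(A ** A ** A) $ 1 $ 1 = - ((z * (p + s)) ^ 3)"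
      by (simp add: A power3_eq_cube)
    then have t: "s = - p" using assms(3) z by simp
    have "(A ** A ** A) $ 2 $ 2 = z ^ 3 * (p * p + q * r) * p" "(A ** A ** A) $ 2 $ 3 = z ^ 3 * (p * p + q * r) * q"
      by (simp_all add: A t power3_eq_cube algebra_simps)
    then show False using assms(1,3) z t by auto
  qed
  then show ?thesis by (simp add: A)
qed

lemma nilpotent_image_line_row_algebra:
  assumes "p + s \<noteq> 0 \<or> p * s - q * r \<noteq> 0"
  shows "nilpotent_image_line (row_algebra p q r s)"
  unfolding nilpotent_image_line_def
proof (rule exI[of _ "axis 1 1"], intro ballI impI allI)
  fix A :: "real^3^3" and x :: "real^3"
  assume "A \<in> row_algebra p q r s" "A ** A ** A = 0"
  then obtain a b where "A = mat3 0 a b 0 0 0 0 0 0"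
    using row_algebra_nilpotent[OF assms] by blast
  then have "A *v x = (a * x $ 2 + b * x $ 3) *\<^sub>R axis 1 1"
    by (simp add: vec_eq_iff matrix_vector_mult_def sum_3 forall_3 axis_def)
  then show "\<exists>c. A *v x = c *\<^sub>R axis 1 1" by blast
qed

text \<open>The first rows in both algebras are their nilpotent elements, so a conjugation between them fixes
  the line of \<open>e\<^sub>1\<close> and induces a similarity of the blocks up to a scalar.\<close>

lemma row_algebra_conjD:
  assumes "row_algebra p q r s \<sim>\<^sub>G row_algebra p' q' r' s'"
    and nn: "p + s \<noteq> 0 \<or> p * s - q * r \<noteq> 0" "p' + s' \<noteq> 0 \<or> p' * s' - q' * r' \<noteq> 0"
  obtains c where "c \<noteq> 0" "p + s = c * (p' + s')" "p * s - q * r = c\<^sup>2 * (p' * s' - q' * r')"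
    "q = 0 \<and> r = 0 \<and> p = s \<longrightarrow> q' = 0 \<and> r' = 0 \<and> p' = s'"
proof -
  obtain P Q where PQ: "P ** Q = mat 1" "Q ** P = mat 1"
    "row_algebra p' q' r' s' = (\<lambda>A. P ** A ** Q) ` row_algebra p q r s"
    using assms(1) unfolding gl_conj_def by blast
  obtain a11 a12 a13 a21 a b a31 g d where P: "P = mat3 a11 a12 a13 a21 a b a31 g d" by (rule mat3_cases)
  obtain q11 q12 q13 q21 q22 q23 q31 q32 q33 where Q: "Q = mat3 q11 q12 q13 q21 q22 q23 q31 q32 q33" by (rule mat3_cases)
  have fst_row: "\<exists>x' y'. P ** mat3 0 x y 0 0 0 0 0 0 ** Q = mat3 0 x' y' 0 0 0 0 0 0" for x y
  proof (rule row_algebra_nilpotent[OF nn(2)])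
    have "mat3 0 x y 0 0 0 0 0 0 \<in> row_algebra p q r s"
      by (rule row_algebraI[of _ 0]) simp_all
    then show "P ** mat3 0 x y 0 0 0 0 0 0 ** Q \<in> row_algebra p' q' r' s'" unfolding PQ(3) by blast
  qed (simp add: cube_conj[OF PQ(1,2)])
  \<comment> \<open>P E12 Q is the first column of \<open>P\<close> times the second row of
    \<open>Q\<close>; as that row is nonzero, the column vanishes below its first entry.\<close>
  have "a21 * q21 = 0 \<and> a21 * q22 = 0 \<and> a21 * q23 = 0 \<and> a31 * q21 = 0 \<and> a31 * q22 = 0 \<and> a31 * q23 = 0"
    using fst_row[of 1 0] unfolding P Q by simp
  moreover have "det Q \<noteq> 0" using inverse_pair(3)[OF PQ(1)] by auto
  ultimately have z: "a21 = 0" "a31 = 0"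
    unfolding Q mat3_det by auto
  define D where "D = a * d - b * g"
  have D: "D \<noteq> 0"
  proof -
    have "det P = a11 * D" unfolding P mat3_det z D_def by (simp add: algebra_simps)
    then show ?thesis using inverse_pair(3)[OF PQ(1)] by auto
  qed
  let ?h = "mat3 (- (p + s)) 0 0 0 p q 0 r s"
  have "?h \<in> row_algebra p q r s" by (rule row_algebraI[of _ 1]) simp_all
  then have "P ** ?h ** Q \<in> row_algebra p' q' r' s'" unfolding PQ(3) by blast
  then obtain x y c where "P ** ?h ** Q = mat3 (- c * (p' + s')) x y 0 (c * p') (c * q') 0 (c * r') (c * s')"
    unfolding row_algebra_def by blast
  then have "P ** ?h = mat3 (- c * (p' + s')) x y 0 (c * p') (c * q') 0 (c * r') (c * s') ** P"
    using PQ(2) by (metis matrix_mul_assoc matrix_mul_rid)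
  \<comment> \<open>In terms of the lower block R = (a b; g d) of \<open>P\<close> this reads R B =
    c B' R.\<close>
  then have e: "a * p + b * r = c * p' * a + c * q' * g" "a * q + b * s = c * p' * b + c * q' * d"
    "g * p + d * r = c * r' * a + c * s' * g" "g * q + d * s = c * r' * b + c * s' * d"
    unfolding P z by simp_all
  \<comment> \<open>Similarity by R preserves trace and determinant; multiplying by D = det R avoids
    inverses.\<close>
  have "D * (p + s) = D * (c * (p' + s'))"
  proof -
    have "d * (a * p + b * r) - b * (g * p + d * r) - g * (a * q + b * s) + a * (g * q + d * s) = D * (p + s)"
      by (simp add: D_def algebra_simps)
    then show ?thesis unfolding e by (simp add: D_def algebra_simps)
  qed
  then have tr: "p + s = c * (p' + s')" using D by simp
  have "D * (p * s - q * r) = D * (c\<^sup>2 * (p' * s' - q' * r'))"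
  proof -
    have "(a * p + b * r) * (g * q + d * s) - (a * q + b * s) * (g * p + d * r) = D * (p * s - q * r)"
      by (simp add: D_def algebra_simps)
    then show ?thesis unfolding e by (simp add: D_def algebra_simps power2_eq_square)
  qed
  then have det: "p * s - q * r = c\<^sup>2 * (p' * s' - q' * r')" using D by simp
  have c: "c \<noteq> 0" using tr det nn(1) by auto
  \<comment> \<open>Trace and determinant do not see whether a block is scalar: \<open>U1\<close>
    and \<open>U3\<close> share both and are told apart by this clause.\<close>
  have "q' = 0 \<and> r' = 0 \<and> p' = s'" if sc: "q = 0 \<and> r = 0 \<and> p = s"
  proof -
    have e': "a * p = c * p' * a + c * q' * g" "b * p = c * p' * b + c * q' * d"
      "g * p = c * r' * a + c * s' * g" "d * p = c * r' * b + c * s' * d"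
      using e sc by simp_all
    have "D * (c * q') = 0" unfolding D_def using e'(1,2) by algebra
    moreover have "D * (c * r') = 0" unfolding D_def using e'(3,4) by algebra
    moreover have "D * (c * (p' - s')) = 0"
    proof -
      have "d * (a * p) - g * (b * p) = b * (g * p) * -1 + a * (d * p)" by simp
      then show ?thesis unfolding e' D_def by algebra
    qed
    ultimately show ?thesis using D c by simp
  qed
  then show ?thesis using that[OF c tr det] by blast
qed

lemma \<uu>\<^sub>3_conj_dual:
  assumes "\<uu>\<^sub>3 k \<sim>\<^sub>G \<uu>\<^sub>3 l" shows "\<uu>\<^sub>3 (dual k) \<sim>\<^sub>G \<uu>\<^sub>3 (dual l)"
proof -
  have "\<uu>\<^sub>3 (dual k) \<sim>\<^sub>G transpose ` \<uu>\<^sub>3 k"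
    using \<uu>\<^sub>3_conj_transpose_dual[of "dual k"] by simp
  also have "\<dots> \<sim>\<^sub>G transpose ` \<uu>\<^sub>3 l" by (rule gl_conj_transpose[OF assms])
  also have "\<dots> \<sim>\<^sub>G \<uu>\<^sub>3 (dual l)" by (rule transpose_\<uu>\<^sub>3)
  finally show ?thesis .
qed

lemma all_nilpotent_transpose: "all_nilpotent (transpose ` u) \<longleftrightarrow> all_nilpotent u"
proof -
  have "transpose A ** transpose A ** transpose A = transpose (A ** A ** A)" for A :: "real^3^3"
    by (simp add: matrix_transpose_mul matrix_mul_assoc)
  moreover have "transpose A = 0 \<longleftrightarrow> A = 0" for A :: "real^3^3"
    by (auto simp: mat_eq_iff_3 transpose_def)
  ultimately show ?thesis
    unfolding all_nilpotent_def by simp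
qed

lemma all_nilpotent_\<uu>\<^sub>3:
  assumes "admissible k"
  shows "all_nilpotent (\<uu>\<^sub>3 k) \<longleftrightarrow> k = U15"
proof -
  have row: "\<not> all_nilpotent (\<uu>\<^sub>3 k)" if k: "admissible k" "is_row k" for k
  proof
    assume nil: "all_nilpotent (\<uu>\<^sub>3 k)"
    obtain p q r s where b: "block k = (p, q, r, s)" by (cases "block k")
    note nn = block_not_nilpotent[OF k b]
    have "mat3 (- (p + s)) 0 0 0 p q 0 r s \<in> row_algebra p q r s" by (rule row_algebraI[of _ 1]) simp_all
    moreover from this have "mat3 (- (p + s)) 0 0 0 p q 0 r s ** mat3 (- (p + s)) 0 0 0 p q 0 r s ** mat3 (- (p + s)) 0 0 0 p q 0 r s = 0"
      using nil unfolding is_row_block[OF k(2) b] all_nilpotent_def by blast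
    ultimately have "\<exists>x y. mat3 (- (p + s)) 0 0 0 p q 0 r s = mat3 0 x y 0 0 0 0 0 0"
      by (rule row_algebra_nilpotent[OF nn])
    then show False using nn by simp
  qed
  have star: "\<not> all_nilpotent (\<uu>\<^sub>3 k)" if "is_row (dual k)"
    using row[OF _ that] assms all_nilpotent_conj[OF \<uu>\<^sub>3_conj_transpose_dual[of k]] all_nilpotent_transpose
    by simp
  have diag: "\<not> all_nilpotent (\<uu>\<^sub>3 k)" if "mat3 1 0 0 0 0 0 0 0 (-1) \<in> \<uu>\<^sub>3 k" for k
    using bspec[OF _ that, of "\<lambda>A. A ** A ** A = 0"] unfolding all_nilpotent_def by auto
  have "\<not> all_nilpotent (\<uu>\<^sub>3 U5)" by (rule diag) (simp add: \<uu>\<^sub>3_U5 del: \<uu>\<^sub>3.simps)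
  moreover have "\<not> all_nilpotent (\<uu>\<^sub>3 U6)" by (rule diag) (simp add: \<uu>\<^sub>3_U6 del: \<uu>\<^sub>3.simps)
  moreover have "all_nilpotent (\<uu>\<^sub>3 U15)" unfolding all_nilpotent_def \<uu>\<^sub>3_U15 by auto
  moreover have "\<not> is_row U15" "\<not> is_row (dual U15)" by simp_all
  ultimately show ?thesis
    using row[OF assms] star label_trichotomy[of k] by metis
qed

lemma nilpotent_image_line_\<uu>\<^sub>3:
  assumes "admissible k" "k \<noteq> U15"
  shows "nilpotent_image_line (\<uu>\<^sub>3 k) \<longleftrightarrow> is_row k \<or> k = U6"
proof -
  have "nilpotent_image_line (\<uu>\<^sub>3 k)" if "is_row k"
  proof -
    obtain p q r s where b: "block k = (p, q, r, s)" by (cases "block k")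
    show ?thesis
      unfolding is_row_block[OF that b]
      by (rule nilpotent_image_line_row_algebra[OF block_not_nilpotent[OF assms(1) that b]])
  qed
  moreover have "nilpotent_image_line (\<uu>\<^sub>3 U6)"
    unfolding nilpotent_image_line_def
  proof (rule exI[of _ "axis 1 1"], intro ballI impI allI)
    fix A :: "real^3^3" and v :: "real^3"
    assume A: "A \<in> \<uu>\<^sub>3 U6" "A ** A ** A = 0"
    then obtain x y z where A_eq: "A = mat3 y x 0 0 z 0 0 0 (- y - z)" unfolding \<uu>\<^sub>3_U6 by blast
    have "y = 0" "z = 0" using A(2) by (simp_all add: A_eq)
    then have "A *v v = (x * v $ 2) *\<^sub>R axis 1 1"
      by (simp add: A_eq vec_eq_iff matrix_vector_mult_def sum_3 forall_3 axis_def)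
    then show "\<exists>c. A *v v = c *\<^sub>R axis 1 1" by blast
  qed
  moreover have "\<not> nilpotent_image_line (\<uu>\<^sub>3 U5)"
  proof
    assume "nilpotent_image_line (\<uu>\<^sub>3 U5)"
    moreover have "mat3 0 1 0 0 0 1 0 0 0 \<in> \<uu>\<^sub>3 U5" by (simp add: \<uu>\<^sub>3_U5 del: \<uu>\<^sub>3.simps)
    ultimately show False
      using nilpotent_image_line_minor[of "\<uu>\<^sub>3 U5" "mat3 0 1 0 0 0 1 0 0 0" "mat3 0 1 0 0 0 1 0 0 0" 1 2 2 3]
      by (simp del: \<uu>\<^sub>3.simps)
  qed
  moreover have "\<not> nilpotent_image_line (\<uu>\<^sub>3 k)" if "is_row (dual k)"
  \<comment> \<open>Two nilpotents in one column with different images: \<open>U4\<close> has them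
    in the first column, the other algebras with a row dual in the middle one.\<close>
  proof (cases "k = U4")
    case True
    have "Y\<alpha> \<in> \<uu>\<^sub>3 U4" "Y\<alpha>\<beta> \<in> \<uu>\<^sub>3 U4" by (auto intro: span_base)
    then show ?thesis
      using nilpotent_image_line_minor[of "\<uu>\<^sub>3 U4" "Y\<alpha>" "Y\<alpha>\<beta>" 2 1 3 1] True by (auto simp: mat_unit_mat3 simp del: \<uu>\<^sub>3.simps)
  next
    case False
    then have "X\<alpha> \<in> \<uu>\<^sub>3 k" "Y\<beta> \<in> \<uu>\<^sub>3 k" using that by (cases k; auto intro: span_base)+
    then show ?thesis
      using nilpotent_image_line_minor[of "\<uu>\<^sub>3 k" "X\<alpha>" "Y\<beta>" 1 2 3 2] by (auto simp: mat_unit_mat3 simp del: \<uu>\<^sub>3.simps)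
  qed
  moreover have "\<not> is_row k \<and> k \<noteq> U6" if "is_row (dual k)" using that by (cases k) auto
  ultimately show ?thesis
    using label_trichotomy[of k] assms(2) is_row.simps by metis
qed

section \<open>Separating the conjugacy classes\<close>

fun block_trace :: "label \<Rightarrow> real" where
  "block_trace U1 = -2" | "block_trace U3 = -2" | "block_trace (U7 a) = 1 - a"
| "block_trace (U8 t) = -1" | "block_trace k = 0"

fun block_disc :: "label \<Rightarrow> real" where
  "block_disc (U7 a) = (1 + a)\<^sup>2" | "block_disc (U8 t) = - 4 * t\<^sup>2" | "block_disc U11 = 4"
| "block_disc U12 = -4" | "block_disc k = 0"

text \<open>The discriminant replaces the determinant because similarity up to a factor c multiplies
  it by c^2: its sign separates distinct real, double and nonreal eigenvalues. The default 0 is its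
  true value for \<open>U1\<close> and \<open>U3\<close>.\<close>

lemma block_invariants:
  assumes "admissible k" "is_row k" "block k = (p, q, r, s)"
  shows "p + s = block_trace k" "(p + s)\<^sup>2 - 4 * (p * s - q * r) = block_disc k"
    "q = 0 \<and> r = 0 \<and> p = s \<longleftrightarrow> k = U1"
  using assms by (cases k; auto simp: admissible_def power2_eq_square algebra_simps)+

definition same_class :: "label \<Rightarrow> label \<Rightarrow> bool" where
  "same_class k l \<longleftrightarrow> k = l
     \<or> (\<exists>a b. k = U7 a \<and> l = U7 b \<and> (a = b \<or> a * b = 1))
     \<or> (\<exists>t s. k = U8 t \<and> l = U8 s \<and> (t = s \<or> t = - s))
     \<or> (\<exists>a b. k = U9 a \<and> l = U9 b \<and> (a = b \<or> a * b = 1))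
     \<or> (\<exists>t s. k = U10 t \<and> l = U10 s \<and> (t = s \<or> t = - s))"

lemma same_class_dual: "same_class (dual k) (dual l) \<Longrightarrow> same_class k l"
  unfolding same_class_def by (cases k; cases l; auto)

lemma same_class_of_row_conj:
  assumes k: "admissible k" "is_row k" and l: "admissible l" "is_row l" and conj: "\<uu>\<^sub>3 k \<sim>\<^sub>G \<uu>\<^sub>3 l"
  shows "same_class k l"
proof -
  obtain p q r s where b: "block k = (p, q, r, s)" by (cases "block k")
  obtain p' q' r' s' where b': "block l = (p', q', r', s')" by (cases "block l")
  note nn = block_not_nilpotent[OF k b] and nn' = block_not_nilpotent[OF l b']
  note inv = block_invariants[OF k b] and inv' = block_invariants[OF l b']
  have conj': "row_algebra p q r s \<sim>\<^sub>G row_algebra p' q' r' s'"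
    using conj is_row_block[OF k(2) b] is_row_block[OF l(2) b'] by simp
  obtain c where c: "c \<noteq> 0" "p + s = c * (p' + s')" "p * s - q * r = c\<^sup>2 * (p' * s' - q' * r')"
    "k = U1 \<longrightarrow> l = U1"
    using row_algebra_conjD[OF conj' nn nn'] inv(3) inv'(3) by metis
  have "l = U1 \<longrightarrow> k = U1"
    using row_algebra_conjD[OF gl_conj_sym[OF conj'] nn' nn] inv(3) inv'(3) by metis
  then have scalar: "k = U1 \<longleftrightarrow> l = U1" using c(4) by blast
  have tr: "block_trace k = c * block_trace l" using c(2) inv(1) inv'(1) by simp
  have disc: "block_disc k = c\<^sup>2 * block_disc l"
    unfolding inv(2)[symmetric] inv'(2)[symmetric] c(2,3) by (simp add: power_mult_distrib right_diff_distrib)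
  then have sgn: "sgn (block_disc k) = sgn (block_disc l)"
    using c(1) by (simp only: sgn_mult sgn_pos[of "c\<^sup>2"] zero_less_power2 simp_thms mult_1)
  have tr0: "block_trace k = 0 \<longleftrightarrow> block_trace l = 0" using tr c(1) by simp
  have ineqs: "1 + a \<noteq> 0" "1 - a \<noteq> 0" if "admissible (U7 a)" for a
    using that by (auto simp: admissible_def)
  have U7: "a = b \<or> a * b = 1" if kl: "k = U7 a" "l = U7 b" for a b
  proof -
    have "(1 + a)\<^sup>2 = c\<^sup>2 * (1 + b)\<^sup>2" "1 - a = c * (1 - b)" using tr disc kl by simp_all
    \<comment> \<open>Crosswise multiplication eliminates \<open>c\<close>; the two signs of the
      square root give a = b and a b = 1.\<close>
    then have "((1 + a) * (1 - b))\<^sup>2 = ((1 - a) * (1 + b))\<^sup>2"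
      by (simp add: power_mult_distrib)
    then have "(1 + a) * (1 - b) = (1 - a) * (1 + b) \<or> (1 + a) * (1 - b) = - ((1 - a) * (1 + b))"
      by (simp add: power2_eq_iff)
    then show ?thesis by (auto simp: algebra_simps)
  qed
  have U8: "t = s \<or> t = - s" if kl: "k = U8 t" "l = U8 s" for t s
  proof -
    have "c = 1" using tr kl by simp
    then have "t\<^sup>2 = s\<^sup>2" using disc kl by simp
    then show ?thesis by (simp add: power2_eq_iff)
  qed
  show ?thesis
    using k l scalar sgn tr0 U7 U8 unfolding same_class_def
    by (cases k; cases l; simp add: admissible_def sgn_if ineqs split: if_splits)
qed

text \<open>Apart from \<open>U15\<close>, the image line property of the algebra and of its dual
  separates rows (yes, no), columns (no, yes), \<open>U6\<close> (yes, yes) and \<open>U5\<close>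
  (no, no).\<close>

lemma same_class_of_conj:
  assumes k: "admissible k" and l: "admissible l" and conj: "\<uu>\<^sub>3 k \<sim>\<^sub>G \<uu>\<^sub>3 l"
  shows "same_class k l"
proof (cases "k = U15 \<or> l = U15")
  case True
  then have "k = l"
    using all_nilpotent_\<uu>\<^sub>3[OF k] all_nilpotent_\<uu>\<^sub>3[OF l] all_nilpotent_conj[OF conj] by blast
  then show ?thesis by (simp add: same_class_def)
next
  case False
  have dual15: "dual k \<noteq> U15" "dual l \<noteq> U15" using False by (metis dual.simps(15) dual_dual)+
  have dual6: "dual j = U6 \<longleftrightarrow> j = U6" for j by (cases j) auto
  have dualrow: "\<not> (is_row j \<and> is_row (dual j))" "is_row j \<Longrightarrow> j \<noteq> U6" "is_row j \<Longrightarrow> dual j \<noteq> U6" for j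
    by (cases j; simp)+
  have 1: "is_row k \<or> k = U6 \<longleftrightarrow> is_row l \<or> l = U6"
    using nilpotent_image_line_conj[OF conj] nilpotent_image_line_\<uu>\<^sub>3[OF k] nilpotent_image_line_\<uu>\<^sub>3[OF l] False
    by blast
  have 2: "is_row (dual k) \<or> k = U6 \<longleftrightarrow> is_row (dual l) \<or> l = U6"
    using nilpotent_image_line_conj[OF \<uu>\<^sub>3_conj_dual[OF conj]] nilpotent_image_line_\<uu>\<^sub>3[of "dual k"]
      nilpotent_image_line_\<uu>\<^sub>3[of "dual l"] dual15 k l dual6 by auto
  consider "is_row k" "is_row l" | "is_row (dual k)" "is_row (dual l)" | "k = l"
    using 1 2 label_trichotomy[of k] label_trichotomy[of l] False dualrow dual6 by metis
  then show ?thesis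
  proof cases
    case 1
    then show ?thesis using same_class_of_row_conj k l conj by blast
  next
    case 2
    then have "same_class (dual k) (dual l)"
      using k l \<uu>\<^sub>3_conj_dual[OF conj] by (intro same_class_of_row_conj) simp_all
    then show ?thesis by (rule same_class_dual)
  next
    case 3
    then show ?thesis by (simp add: same_class_def)
  qed
qed

lemma conj_of_same_class:
  assumes "admissible k" "admissible l" "same_class k l"
  shows "\<uu>\<^sub>3 k \<sim>\<^sub>G \<uu>\<^sub>3 l"
proof -
  \<comment> \<open>For a b = 1 the factor - a turns diag(1, - b) into diag(- a, 1), which is
    diag(1, - a) with its eigenvalues exchanged.\<close>
  have U7: "\<uu>\<^sub>3 (U7 a) \<sim>\<^sub>G \<uu>\<^sub>3 (U7 b)" if "a * b = 1" "a \<noteq> -1" "b \<noteq> -1" for a b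
    unfolding \<uu>\<^sub>3_row_algebra using that
    by (intro row_algebra_conjI[where c = "- a"]) (auto simp: algebra_simps power2_eq_square)
  have U8: "\<uu>\<^sub>3 (U8 t) \<sim>\<^sub>G \<uu>\<^sub>3 (U8 (- t))" if "t \<noteq> 0" for t
    unfolding \<uu>\<^sub>3_row_algebra using that by (intro row_algebra_conjI[where c = 1]) auto
  have U9: "\<uu>\<^sub>3 (U9 a) \<sim>\<^sub>G \<uu>\<^sub>3 (U9 b)" if "a * b = 1" "a \<noteq> -1" "b \<noteq> -1" for a b
    using \<uu>\<^sub>3_conj_dual[OF U7[OF that]] by (simp del: \<uu>\<^sub>3.simps)
  have U10: "\<uu>\<^sub>3 (U10 t) \<sim>\<^sub>G \<uu>\<^sub>3 (U10 (- t))" if "t \<noteq> 0" for t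
    using \<uu>\<^sub>3_conj_dual[OF U8[of "t / 2"]] that by (simp del: \<uu>\<^sub>3.simps)
  show ?thesis
    using assms(3) unfolding same_class_def
  proof (elim disjE exE conjE)
    fix t s assume eq: "k = U8 t" "l = U8 s" "t = - s"
    then show ?thesis using U8[of t] assms(1) by (simp add: admissible_def del: \<uu>\<^sub>3.simps)
  next
    fix t s assume eq: "k = U10 t" "l = U10 s" "t = - s"
    then show ?thesis using U10[of t] assms(1) by (simp add: admissible_def del: \<uu>\<^sub>3.simps)
  next
    fix a b assume "k = U7 a" "l = U7 b" "a * b = 1"
    then show ?thesis using U7[of a b] assms by (simp add: admissible_def del: \<uu>\<^sub>3.simps)
  next
    fix a b assume "k = U9 a" "l = U9 b" "a * b = 1"
    then show ?thesis using U9[of a b] assms by (simp add: admissible_def del: \<uu>\<^sub>3.simps)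
  qed simp_all
qed

theorem theorem5p4:
  "(\<forall>k. admissible k \<longrightarrow>
        lie_subalgebra_sl3 (\<uu>\<^sub>3 k) \<and> solvable_lie (\<uu>\<^sub>3 k) \<and> dim (\<uu>\<^sub>3 k) = 3) \<and>
   (\<forall>\<uu>. lie_subalgebra_sl3 \<uu> \<and> solvable_lie \<uu> \<and> dim \<uu> = 3 \<longrightarrow>
        (\<exists>k. admissible k \<and> \<uu> \<sim>\<^sub>S \<uu>\<^sub>3 k)) \<and>
   (\<forall>k l. admissible k \<and> admissible l \<longrightarrow>
        (\<uu>\<^sub>3 k \<sim>\<^sub>S \<uu>\<^sub>3 l \<longleftrightarrow>
           k = l
           \<or> (\<exists>a b. k = U7 a \<and> l = U7 b \<and> (a = b \<or> a * b = 1))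
           \<or> (\<exists>t s. k = U8 t \<and> l = U8 s \<and> (t = s \<or> t = - s))
           \<or> (\<exists>a b. k = U9 a \<and> l = U9 b \<and> (a = b \<or> a * b = 1))
           \<or> (\<exists>t s. k = U10 t \<and> l = U10 s \<and> (t = s \<or> t = - s)))) \<and>
   (\<forall>a\<in>{-1<..<1}. \<forall>b\<in>{-1<..<1}. \<uu>\<^sub>3 (U7 a) \<sim>\<^sub>S \<uu>\<^sub>3 (U7 b) \<longleftrightarrow> a = b) \<and>
   (\<forall>c. c \<noteq> 1 \<and> c \<noteq> -1 \<longrightarrow> (\<exists>a\<in>{-1<..<1}. \<uu>\<^sub>3 (U7 c) \<sim>\<^sub>S \<uu>\<^sub>3 (U7 a))) \<and>
   (\<forall>a\<in>{-1<..<1}. \<forall>b\<in>{-1<..<1}. \<uu>\<^sub>3 (U9 a) \<sim>\<^sub>S \<uu>\<^sub>3 (U9 b) \<longleftrightarrow> a = b) \<and>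
   (\<forall>c. c \<noteq> 1 \<and> c \<noteq> -1 \<longrightarrow> (\<exists>a\<in>{-1<..<1}. \<uu>\<^sub>3 (U9 c) \<sim>\<^sub>S \<uu>\<^sub>3 (U9 a)))"
proof -
  have listed: "\<forall>k. admissible k \<longrightarrow>
        lie_subalgebra_sl3 (\<uu>\<^sub>3 k) \<and> solvable_lie (\<uu>\<^sub>3 k) \<and> dim (\<uu>\<^sub>3 k) = 3"
    using lie3_solvable_\<uu>\<^sub>3 unfolding lie3_def by blast
  have complete: "\<forall>\<uu>. lie_subalgebra_sl3 \<uu> \<and> solvable_lie \<uu> \<and> dim \<uu> = 3 \<longrightarrow>
        (\<exists>k. admissible k \<and> \<uu> \<sim>\<^sub>S \<uu>\<^sub>3 k)"
    using listed_of_solvable unfolding listed_def lie3_def SL3_conjugate_iff by blast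
  have conj: "\<uu>\<^sub>3 k \<sim>\<^sub>S \<uu>\<^sub>3 l \<longleftrightarrow> same_class k l" if "admissible k \<and> admissible l" for k l
    using that conj_of_same_class same_class_of_conj unfolding SL3_conjugate_iff by blast
  \<comment> \<open>Inside the open interval the relation a b = 1 is impossible, while for |c| > 1
    the partner 1 / c lies in it, as \<open>rep\<close> uses.\<close>
  have prod: "a * b \<noteq> 1" if "a \<in> {-1<..<1}" "b \<in> {-1<..<1}" for a b :: real
  proof -
    have "\<bar>a\<bar> * \<bar>b\<bar> < 1 * 1" using that by (intro mult_strict_mono') auto
    then show ?thesis by (auto simp: abs_mult[symmetric])
  qed
  have adm: "admissible (U7 a)" "admissible (U9 a)" if "a \<in> {-1<..<1}" for a
    using that by (auto simp: admissible_def)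
  have iff7: "\<forall>a\<in>{-1<..<1}. \<forall>b\<in>{-1<..<1}. \<uu>\<^sub>3 (U7 a) \<sim>\<^sub>S \<uu>\<^sub>3 (U7 b) \<longleftrightarrow> a = b"
    using conj adm prod by (simp add: same_class_def del: \<uu>\<^sub>3.simps)
  have iff9: "\<forall>a\<in>{-1<..<1}. \<forall>b\<in>{-1<..<1}. \<uu>\<^sub>3 (U9 a) \<sim>\<^sub>S \<uu>\<^sub>3 (U9 b) \<longleftrightarrow> a = b"
    using conj adm prod by (simp add: same_class_def del: \<uu>\<^sub>3.simps)
  have rep: "\<exists>a\<in>{-1<..<1}. c = a \<or> c * a = 1" if "c \<noteq> 1 \<and> c \<noteq> -1" for c :: real
  proof (cases "\<bar>c\<bar> < 1")
    case True
    then show ?thesis by (intro bexI[of _ c]) auto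
  next
    case False
    then have "\<bar>c\<bar> > 1" using that by auto
    then have "\<bar>1 / c\<bar> < 1" "c * (1 / c) = 1" by (auto simp: field_simps)
    then show ?thesis
      by (intro bexI[of _ "1 / c"]) (simp_all only: abs_less_iff greaterThanLessThan_iff simp_thms minus_less_iff)
  qed
  have rep7: "\<forall>c. c \<noteq> 1 \<and> c \<noteq> -1 \<longrightarrow> (\<exists>a\<in>{-1<..<1}. \<uu>\<^sub>3 (U7 c) \<sim>\<^sub>S \<uu>\<^sub>3 (U7 a))"
  proof (intro allI impI)
    fix c :: real assume c: "c \<noteq> 1 \<and> c \<noteq> -1"
    obtain a where a: "a \<in> {-1<..<1}" "c = a \<or> c * a = 1" using rep[OF c] by blast
    have "admissible (U7 c)" using c by (simp add: admissible_def)
    then have "\<uu>\<^sub>3 (U7 c) \<sim>\<^sub>S \<uu>\<^sub>3 (U7 a)"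
      using conj[of "U7 c" "U7 a"] adm(1)[OF a(1)] a(2) by (auto simp: same_class_def simp del: \<uu>\<^sub>3.simps)
    then show "\<exists>a\<in>{-1<..<1}. \<uu>\<^sub>3 (U7 c) \<sim>\<^sub>S \<uu>\<^sub>3 (U7 a)" using a(1) by blast
  qed
  have rep9: "\<forall>c. c \<noteq> 1 \<and> c \<noteq> -1 \<longrightarrow> (\<exists>a\<in>{-1<..<1}. \<uu>\<^sub>3 (U9 c) \<sim>\<^sub>S \<uu>\<^sub>3 (U9 a))"
  proof (intro allI impI)
    fix c :: real assume c: "c \<noteq> 1 \<and> c \<noteq> -1"
    obtain a where a: "a \<in> {-1<..<1}" "c = a \<or> c * a = 1" using rep[OF c] by blast
    have "admissible (U9 c)" using c by (simp add: admissible_def)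
    then have "\<uu>\<^sub>3 (U9 c) \<sim>\<^sub>S \<uu>\<^sub>3 (U9 a)"
      using conj[of "U9 c" "U9 a"] adm(2)[OF a(1)] a(2) by (auto simp: same_class_def simp del: \<uu>\<^sub>3.simps)
    then show "\<exists>a\<in>{-1<..<1}. \<uu>\<^sub>3 (U9 c) \<sim>\<^sub>S \<uu>\<^sub>3 (U9 a)" using a(1) by blast
  qed
  show ?thesis
    using listed complete conj iff7 rep7 iff9 rep9 unfolding same_class_def by blast
qed

end
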